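(* The Gibbons-Hawking ansatz with 2 centers, each of charge $1$, and $\epsilon=0$ is isometric to the Eguchi-Hanson metric, up to rescaling and choice of coordinates.
   Context: Gibbons-Hawking ansatz. For $\mathbf{x}_1,\dots,\mathbf{x}_k\in\mathbf{R}^3$ (the centers), put $U=\mathbf{R}^3\setminus\{\mathbf{x}_1,\dots,\mathbf{x}_k\}$, fix charges $n_i\in\mathbf{Z}$ and $\epsilon\ge0$, and define the harmonic function $V(\mathbf{x})=\epsilon+\sum_i\frac{n_i}{|\mathbf{x}-\mathbf{x}_i|}$ on $U$. Let $M\to U$ be a principal $S^1$-bundle, with fibre coordinate $\psi$, with a connection 1-form $A$ satisfying $\nabla\times A=\nabla V$, where $\nabla\times$ and $\nabla$ are taken with respect to the Euclidean metric $d\mathbf{x}\cdot d\mathbf{x}$ on $\mathbf{R}^3$. The Gibbons-Hawking ansatz is the metric on $M$ $$ds^2=V(\mathbf{x})^{-1}(d\psi+A)^2+V(\mathbf{x})\,d\mathbf{x}\cdot d\mathbf{x}.$$ Eguchi-Hanson metric. In coordinates $(r,\theta,\phi,\varphi)$, with $\theta,\phi,\varphi$ angular coordinates on the $S^3/\{\pm1\}$ factor, and a parameter $a$ with $0<a<r$, put $$\sigma_1=\tfrac12(-\cos\varphi\,d\theta-\sin\theta\sin\varphi\,d\phi),\quad \sigma_2=\tfrac12(\sin\varphi\,d\theta-\sin\theta\cos\varphi\,d\phi),\quad \sigma_3=\tfrac12(-d\varphi-\cos\theta\,d\phi).$$ The Eguchi-Hanson metric is the metric on $\{r>a\}\times(S^3/\{\pm1\})$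 $$ds^2=\left(1-\frac{a^4}{r^4}\right)^{-1}dr^2+r^2\left(\sigma_1^2+\sigma_2^2+\left(1-\frac{a^4}{r^4}\right)\sigma_3^2\right).$$
   Formalization: The two centers are distinct, the fibre coordinate has period 4π, and the ansatz is restricted to the complement of the segment joining the centers; over all of U it is simply connected, so it cannot be isometric to the Eguchi-Hanson metric on {r>a}×(S³/{±1}). *)

theory Defs
  imports "HOL-Analysis.Analysis"
begin

section \<open>Smooth maps\<close>

text \<open>Only used on open sets; \<open>Ck_on k S f\<close> is continuous differentiability of order \<open>k\<close>.\<close>

primrec Ck_on ::
  "nat \<Rightarrow> 'a::real_normed_vector set \<Rightarrow> ('a \<Rightarrow> 'b::real_normed_vector) \<Rightarrow> bool" where
  "Ck_on 0 S f \<longleftrightarrow> continuous_on S f"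
| "Ck_on (Suc k) S f \<longleftrightarrow>
     (\<forall>x\<in>S. f differentiable (at x)) \<and> (\<forall>v. Ck_on k S (\<lambda>x. frechet_derivative f (at x) v))"

definition smooth_on ::
  "'a::real_normed_vector set \<Rightarrow> ('a \<Rightarrow> 'b::real_normed_vector) \<Rightarrow> bool" where
  "smooth_on S f \<longleftrightarrow> (\<forall>k. Ck_on k S f)"


section \<open>Riemannian manifolds given by local coordinates\<close>

text \<open>
  A coordinate patch consists of an open set \<open>cdom P\<close> of coordinates, a map \<open>par P\<close> from coordinates
  to points, and the line element \<open>ds2 P\<close>: the number \<open>ds2 P u v\<close> is the squared length of the
  tangent vector with components \<open>v\<close> at the point with coordinates \<open>u\<close>.  As is usual for angular
  coordinates, \<open>par P\<close> is only locally injective (angles are real numbers, periodically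
  identified by \<open>par P\<close>).  A Riemannian manifold is presented by a set of
  patches covering its points.
\<close>

record ('e, 'm) patch =
  cdom :: "'e set"
  par :: "'e \<Rightarrow> 'm"
  ds2 :: "'e \<Rightarrow> 'e \<Rightarrow> real"

definition points :: "('e, 'm) patch set \<Rightarrow> 'm set" where
  "points \<A> = (\<Union>P\<in>\<A>. par P ` cdom P)"

text \<open>
  \<open>f\<close> is smooth (it has smooth coordinate expressions \<open>h\<close>) and pulls the line element of \<open>\<B>\<close>
  back to that of \<open>\<A>\<close>.
\<close>

definition metric_preserving ::
  "('e::real_normed_vector, 'm) patch set \<Rightarrow> ('f::real_normed_vector, 'n) patch set
     \<Rightarrow> ('m \<Rightarrow> 'n) \<Rightarrow> bool" where
  "metric_preserving \<A> \<B> f \<longleftrightarrow>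
     (\<forall>P\<in>\<A>. \<forall>u\<in>cdom P. \<exists>Q\<in>\<B>. \<exists>N h.
        open N \<and> u \<in> N \<and> N \<subseteq> cdom P \<and> smooth_on N h \<and> h ` N \<subseteq> cdom Q \<and>
        (\<forall>y\<in>N. f (par P y) = par Q (h y) \<and>
           (\<forall>v. ds2 Q (h y) (frechet_derivative h (at y) v) = ds2 P y v)))"

definition isometry ::
  "('e::real_normed_vector, 'm) patch set \<Rightarrow> ('f::real_normed_vector, 'n) patch set
     \<Rightarrow> ('m \<Rightarrow> 'n) \<Rightarrow> bool" where
  "isometry \<A> \<B> f \<longleftrightarrow>
     bij_betw f (points \<A>) (points \<B>) \<and> metric_preserving \<A> \<B> f \<and>
     metric_preserving \<B> \<A> (inv_into (points \<A>) f)"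

definition isometric ::
  "('e::real_normed_vector, 'm) patch set \<Rightarrow> ('f::real_normed_vector, 'n) patch set \<Rightarrow> bool" where
  "isometric \<A> \<B> \<longleftrightarrow> (\<exists>f. isometry \<A> \<B> f)"

definition rescale :: "real \<Rightarrow> ('e, 'm) patch set \<Rightarrow> ('e, 'm) patch set" where
  "rescale c \<A> = (\<lambda>P. P\<lparr>ds2 := \<lambda>u v. c * ds2 P u v\<rparr>) ` \<A>"

text \<open>The open submanifold with point set \<open>points \<A> \<inter> N\<close>.\<close>

definition restrict_to :: "'m set \<Rightarrow> ('e, 'm) patch set \<Rightarrow> ('e, 'm) patch set" where
  "restrict_to N \<A> = (\<lambda>P. P\<lparr>cdom := {u \<in> cdom P. par P u \<in> N}\<rparr>) ` \<A>"


section \<open>Principal circle bundles with connection\<close>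

text \<open>
  The structure group is the circle \<open>\<real>/4\<pi>\<int>\<close>, acting through \<open>act B :: real \<Rightarrow> _\<close>.  The length
  \<open>4\<pi>\<close> is forced by the normalisation of the charges in the potential below: the flux of
  the gradient of \<open>n / \<bar>x - x\<^sub>i\<bar>\<close> through a small sphere about \<open>x\<^sub>i\<close> is \<open>-4\<pi>n\<close>, so
  that charge \<open>n\<close> means Chern number \<open>\<plusminus>n\<close>.

  An element \<open>(W, s, A)\<close> of \<open>gauges B\<close> is a smooth section \<open>s\<close> over the open set \<open>W\<close>, together
  with the vector field \<open>A\<close> on \<open>W\<close> such that the connection form is
  \<open>d\<psi> + A \<cdot> dx\<close> in the bundle coordinates \<open>(x, \<psi>) \<mapsto> act B \<psi> (s x)\<close>.  The bundle
  coordinates define the smooth structure of the total space.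
\<close>

type_synonym 'm gauge = "(real^3) set \<times> (real^3 \<Rightarrow> 'm) \<times> (real^3 \<Rightarrow> real^3)"

record 'm circle_bundle =
  total :: "'m set"
  proj :: "'m \<Rightarrow> real^3"
  act :: "real \<Rightarrow> 'm \<Rightarrow> 'm"
  gauges :: "'m gauge set"

definition principal_circle_bundle :: "(real^3) set \<Rightarrow> 'm circle_bundle \<Rightarrow> bool" where
  "principal_circle_bundle U B \<longleftrightarrow>
     \<comment> \<open>a free action of \<open>\<real>/4\<pi>\<int>\<close> on \<open>total B\<close> whose orbits are the fibres of \<open>proj B\<close>\<close>
     (\<forall>m\<in>total B. proj B m \<in> U) \<and>
     (\<forall>m\<in>total B. \<forall>\<psi>. act B \<psi> m \<in> total B \<and> proj B (act B \<psi> m) = proj B m) \<and>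
     (\<forall>m\<in>total B. \<forall>\<psi> \<psi>'. act B \<psi> (act B \<psi>' m) = act B (\<psi> + \<psi>') m) \<and>
     (\<forall>m\<in>total B. \<forall>\<psi>. act B \<psi> m = m \<longleftrightarrow> (\<exists>k::int. \<psi> = 4 * pi * of_int k)) \<and>
     (\<forall>m\<in>total B. \<forall>m'\<in>total B. proj B m = proj B m' \<longrightarrow> (\<exists>\<psi>. m' = act B \<psi> m)) \<and>
     \<comment> \<open>local sections over an open cover, with smooth transition functions\<close>
     (\<forall>(W, s, A)\<in>gauges B. open W \<and> W \<subseteq> U \<and> (\<forall>x\<in>W. s x \<in> total B \<and> proj B (s x) = x)) \<and>
     U \<subseteq> (\<Union>(W, s, A)\<in>gauges B. W) \<and>
     (\<forall>(W, s, A)\<in>gauges B. \<forall>(W', s', A')\<in>gauges B. \<forall>x\<in>W \<inter> W'. \<exists>N \<tau>.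
        open N \<and> x \<in> N \<and> N \<subseteq> W \<inter> W' \<and> smooth_on N \<tau> \<and> (\<forall>y\<in>N. s' y = act B (\<tau> y) (s y)))"

definition bundle_connection :: "'m circle_bundle \<Rightarrow> bool" where
  "bundle_connection B \<longleftrightarrow>
     (\<forall>(W, s, A)\<in>gauges B. smooth_on W A) \<and>
     (\<forall>(W, s, A)\<in>gauges B. \<forall>(W', s', A')\<in>gauges B. \<forall>N \<tau>.
        open N \<and> N \<subseteq> W \<inter> W' \<and> smooth_on N \<tau> \<and> (\<forall>y\<in>N. s' y = act B (\<tau> y) (s y)) \<longrightarrow>
        (\<forall>y\<in>N. GDERIV \<tau> y :> A' y - A y))"


section \<open>The Gibbons-Hawking ansatz\<close>

text \<open>\<open>partial_deriv A i j x\<close> is \<open>\<partial>\<^sub>i A\<^sub>j\<close> at \<open>x\<close>.\<close>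

definition partial_deriv :: "(real^3 \<Rightarrow> real^3) \<Rightarrow> 3 \<Rightarrow> 3 \<Rightarrow> real^3 \<Rightarrow> real" where
  "partial_deriv A i j x = frechet_derivative A (at x) (axis i 1) $ j"

definition curl :: "(real^3 \<Rightarrow> real^3) \<Rightarrow> real^3 \<Rightarrow> real^3" where
  "curl A x = vector
     [partial_deriv A 2 3 x - partial_deriv A 3 2 x,
      partial_deriv A 3 1 x - partial_deriv A 1 3 x,
      partial_deriv A 1 2 x - partial_deriv A 2 1 x]"

text \<open>The centers and their charges are given as a list of pairs.\<close>

definition gh_base :: "((real^3) \<times> int) list \<Rightarrow> (real^3) set" where
  "gh_base cs = - fst ` set cs"

definition gh_potential :: "real \<Rightarrow> ((real^3) \<times> int) list \<Rightarrow> real^3 \<Rightarrow> real" where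
  "gh_potential eps cs x = eps + (\<Sum>(c, n)\<leftarrow>cs. of_int n / norm (x - c))"

definition gh_bundle :: "real \<Rightarrow> ((real^3) \<times> int) list \<Rightarrow> 'm circle_bundle \<Rightarrow> bool" where
  "gh_bundle eps cs B \<longleftrightarrow>
     principal_circle_bundle (gh_base cs) B \<and> bundle_connection B \<and>
     (\<forall>(W, s, A)\<in>gauges B. \<forall>x\<in>W. GDERIV (gh_potential eps cs) x :> curl A x)"

definition gibbons_hawking ::
  "real \<Rightarrow> ((real^3) \<times> int) list \<Rightarrow> 'm circle_bundle \<Rightarrow> ((real^3) \<times> real, 'm) patch set" where
  "gibbons_hawking eps cs B =
     (\<lambda>(W, s, A).
        \<lparr>cdom = W \<times> UNIV,
         par = (\<lambda>(x, \<psi>). act B \<psi> (s x)),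
         ds2 = (\<lambda>(x, \<psi>) (dx, d\<psi>).
           inverse (gh_potential eps cs x) * (d\<psi> + A x \<bullet> dx)\<^sup>2
             + gh_potential eps cs x * (dx \<bullet> dx))\<rparr>)
     ` gauges B"


section \<open>The Eguchi-Hanson metric\<close>

text \<open>
  Points of \<open>S\<^sup>3/{\<plusminus>1}\<close> are the sets \<open>{q, -q}\<close> with \<open>q\<close> in the unit sphere of \<open>\<complex>\<^sup>2\<close>.
  The coordinates are \<open>(r, \<theta>, \<phi>, \<eta>)\<close>, where \<open>\<eta>\<close> is the angle usually written as varphi;
  it has period \<open>4\<pi>\<close> on the sphere and \<open>2\<pi>\<close> on the quotient.

  The manifold \<open>r > a\<close> has fundamental group of order 2 and does not contain the sphere \<open>r = a\<close> over
  which the metric extends.  In the two-center ansatz, whose total space is simply connected, this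
  sphere appears as the fibres over the open segment between the centers together with two missing
  points; hence the two metrics can only be compared off that segment.
\<close>

type_synonym eh_coords = "real \<times> real \<times> real \<times> real"

definition euler :: "real \<Rightarrow> real \<Rightarrow> real \<Rightarrow> complex \<times> complex" where
  "euler \<theta> \<phi> \<eta> =
     (of_real (cos (\<theta>/2)) * cis ((\<eta> + \<phi>)/2), of_real (sin (\<theta>/2)) * cis ((\<eta> - \<phi>)/2))"

fun \<sigma>1 :: "eh_coords \<Rightarrow> eh_coords \<Rightarrow> real" where
  "\<sigma>1 (r, \<theta>, \<phi>, \<eta>) (dr, d\<theta>, d\<phi>, d\<eta>) = 1/2 * (- cos \<eta> * d\<theta> - sin \<theta> * sin \<eta> * d\<phi>)"

fun \<sigma>2 :: "eh_coords \<Rightarrow> eh_coords \<Rightarrow> real" where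
  "\<sigma>2 (r, \<theta>, \<phi>, \<eta>) (dr, d\<theta>, d\<phi>, d\<eta>) = 1/2 * (sin \<eta> * d\<theta> - sin \<theta> * cos \<eta> * d\<phi>)"

fun \<sigma>3 :: "eh_coords \<Rightarrow> eh_coords \<Rightarrow> real" where
  "\<sigma>3 (r, \<theta>, \<phi>, \<eta>) (dr, d\<theta>, d\<phi>, d\<eta>) = 1/2 * (- d\<eta> - cos \<theta> * d\<phi>)"

definition eh_ds2 :: "real \<Rightarrow> eh_coords \<Rightarrow> eh_coords \<Rightarrow> real" where
  "eh_ds2 a u du =
     (let r = fst u; dr = fst du in
        inverse (1 - a^4 / r^4) * dr\<^sup>2
          + r\<^sup>2 * ((\<sigma>1 u du)\<^sup>2 + (\<sigma>2 u du)\<^sup>2 + (1 - a^4 / r^4) * (\<sigma>3 u du)\<^sup>2))"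

text \<open>
  Euler angles are coordinates only for \<open>0 < \<theta> < \<pi>\<close>, which leaves out two circles of
  the sphere.  To cover these as well, the Euler angles are also used after left translation by an
  arbitrary element \<open>((\<alpha>, -\<beta>*), (\<beta>, \<alpha>*))\<close> of SU(2), given by \<open>g = (\<alpha>, \<beta>)\<close>.  The
  forms \<open>\<sigma>\<^sub>i\<close> are left invariant, so the line element is the same expression in all of these
  coordinates; this is the content of the lemma \<open>euler_forms\<close> below, in which the expressions
  on the right do not refer to \<open>g\<close> or to the angles.
\<close>

fun su2_translate :: "complex \<times> complex \<Rightarrow> complex \<times> complex \<Rightarrow> complex \<times> complex" where
  "su2_translate (\<alpha>, \<beta>) (z, w) = (\<alpha> * z - cnj \<beta> * w, \<beta> * z + cnj \<alpha> * w)"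

definition eguchi_hanson ::
  "real \<Rightarrow> (eh_coords, real \<times> (complex \<times> complex) set) patch set" where
  "eguchi_hanson a =
     (\<lambda>g. \<lparr>cdom = {(r, \<theta>, \<phi>, \<eta>). a < r \<and> 0 < \<theta> \<and> \<theta> < pi},
          par = (\<lambda>(r, \<theta>, \<phi>, \<eta>). let q = su2_translate g (euler \<theta> \<phi> \<eta>) in (r, {q, - q})),
          ds2 = eh_ds2 a\<rparr>)
     ` sphere 0 1"

lemma euler_forms:
  fixes \<theta> \<phi> \<eta> :: "real \<Rightarrow> real"
  assumes "(\<theta> has_real_derivative d\<theta>) (at t)" "(\<phi> has_real_derivative d\<phi>) (at t)"
    and "(\<eta> has_real_derivative d\<eta>) (at t)" and "g \<in> sphere 0 1"
  defines "q \<equiv> \<lambda>s. su2_translate g (euler (\<theta> s) (\<phi> s) (\<eta> s))"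
  obtains dz dw where "(q has_vector_derivative (dz, dw)) (at t)"
    and "\<sigma>1 (r, \<theta> t, \<phi> t, \<eta> t) (dr, d\<theta>, d\<phi>, d\<eta>) = - Re (fst (q t) * dw - snd (q t) * dz)"
    and "\<sigma>2 (r, \<theta> t, \<phi> t, \<eta> t) (dr, d\<theta>, d\<phi>, d\<eta>) = Im (fst (q t) * dw - snd (q t) * dz)"
    and "\<sigma>3 (r, \<theta> t, \<phi> t, \<eta> t) (dr, d\<theta>, d\<phi>, d\<eta>) =
           - Im (cnj (fst (q t)) * dz + cnj (snd (q t)) * dw)"
proof -
  obtain \<alpha> \<beta> where g: "g = (\<alpha>, \<beta>)" by (cases g)
  have "(norm \<alpha>)\<^sup>2 + (norm \<beta>)\<^sup>2 = 1"
    using assms(4) by (simp add: g norm_Pair)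
  then have ab: "\<alpha> * cnj \<alpha> + \<beta> * cnj \<beta> = 1"
    by (metis complex_norm_square of_real_1 of_real_add)
  define C where "C = complex_of_real (cos (\<theta> t / 2))"
  define S where "S = complex_of_real (sin (\<theta> t / 2))"
  define E where "E = cis ((\<eta> t + \<phi> t) / 2)"
  define F where "F = cis ((\<eta> t - \<phi> t) / 2)"
  define Z where "Z = of_real (- (d\<theta> / 2)) * S * E + \<i> * of_real ((d\<eta> + d\<phi>) / 2) * (C * E)"
  define W where "W = of_real (d\<theta> / 2) * C * F + \<i> * of_real ((d\<eta> - d\<phi>) / 2) * (S * F)"
  have cis': "((\<lambda>s. cis (f s)) has_vector_derivative (\<i> * of_real f' * cis (f t))) (at t)"
    if "(f has_real_derivative f') (at t)" for f :: "real \<Rightarrow> real" and f'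
    using that unfolding has_vector_derivative_complex_iff
    by (auto intro!: derivative_eq_intros)
  have E': "((\<lambda>s. cis ((\<eta> s + \<phi> s) / 2)) has_vector_derivative
      \<i> * of_real ((d\<eta> + d\<phi>) / 2) * E) (at t)"
    unfolding E_def by (rule cis') (auto intro!: derivative_eq_intros assms)
  have F': "((\<lambda>s. cis ((\<eta> s - \<phi> s) / 2)) has_vector_derivative
      \<i> * of_real ((d\<eta> - d\<phi>) / 2) * F) (at t)"
    unfolding F_def by (rule cis') (auto intro!: derivative_eq_intros assms)
  have C': "((\<lambda>s. complex_of_real (cos (\<theta> s / 2))) has_vector_derivative
      of_real (- (d\<theta> / 2) * sin (\<theta> t / 2))) (at t)"
    by (rule has_vector_derivative_of_real) (auto intro!: derivative_eq_intros assms)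
  have S': "((\<lambda>s. complex_of_real (sin (\<theta> s / 2))) has_vector_derivative
      of_real (d\<theta> / 2 * cos (\<theta> t / 2))) (at t)"
    by (rule has_vector_derivative_of_real) (auto intro!: derivative_eq_intros assms)
  have Z': "((\<lambda>s. of_real (cos (\<theta> s / 2)) * cis ((\<eta> s + \<phi> s) / 2)) has_vector_derivative Z) (at t)"
    using has_vector_derivative_mult[OF C' E']
    by (simp add: Z_def C_def S_def E_def algebra_simps)
  have W': "((\<lambda>s. of_real (sin (\<theta> s / 2)) * cis ((\<eta> s - \<phi> s) / 2)) has_vector_derivative W) (at t)"
    using has_vector_derivative_mult[OF S' F']
    by (simp add: W_def C_def S_def F_def algebra_simps)
  define dz where "dz = \<alpha> * Z - cnj \<beta> * W"
  define dw where "dw = \<beta> * Z + cnj \<alpha> * W"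
  have qt: "q t = (\<alpha> * (C * E) - cnj \<beta> * (S * F), \<beta> * (C * E) + cnj \<alpha> * (S * F))"
    by (simp add: q_def g euler_def C_def S_def E_def F_def)
  have q': "(q has_vector_derivative (dz, dw)) (at t)"
    unfolding q_def g euler_def su2_translate.simps dz_def dw_def
    by (intro has_vector_derivative_Pair has_vector_derivative_diff has_vector_derivative_add
        has_vector_derivative_mult_right Z' W')
  have EF: "E * F = cis (\<eta> t)"
    by (simp add: E_def F_def cis_mult diff_divide_distrib add_divide_distrib)
  have EE: "E * cnj E = 1" "F * cnj F = 1"
    by (simp_all add: E_def F_def cis_cnj cis_mult)
  have CC: "cnj C = C" "cnj S = S" by (simp_all add: C_def S_def)
  have CS1: "C * C + S * S = 1"
    unfolding C_def S_def of_real_mult[symmetric] of_real_add[symmetric]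
    by (simp add: power2_eq_square[symmetric])
  have CS2: "C * S = of_real (sin (\<theta> t) / 2)"
    using sin_double[of "\<theta> t / 2"] unfolding C_def S_def of_real_mult[symmetric] by simp
  have CS3: "C * C - S * S = of_real (cos (\<theta> t))"
    using cos_double[of "\<theta> t / 2"] unfolding C_def S_def of_real_mult[symmetric] of_real_diff[symmetric]
    by (simp add: power2_eq_square)
  have "fst (q t) * dw - snd (q t) * dz = (\<alpha> * cnj \<alpha> + \<beta> * cnj \<beta>) * (C * E * W - S * F * Z)"
    by (simp add: qt dz_def dw_def algebra_simps)
  also have "\<dots> = C * E * W - S * F * Z"
    by (simp add: ab)
  also have "\<dots> = (E * F) * (of_real (d\<theta> / 2) * (C * C + S * S) - \<i> * of_real d\<phi> * (C * S))"
    by (simp add: Z_def W_def field_simps)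
  also have "\<dots> = cis (\<eta> t) * (of_real (d\<theta> / 2) - \<i> * of_real (d\<phi> * sin (\<theta> t) / 2))"
    by (simp add: EF CS1 CS2)
  finally have 1: "fst (q t) * dw - snd (q t) * dz =
      cis (\<eta> t) * (of_real (d\<theta> / 2) - \<i> * of_real (d\<phi> * sin (\<theta> t) / 2))" .
  have "cnj (fst (q t)) * dz + cnj (snd (q t)) * dw =
      (\<alpha> * cnj \<alpha> + \<beta> * cnj \<beta>) * (cnj (C * E) * Z + cnj (S * F) * W)"
    by (simp add: qt dz_def dw_def algebra_simps)
  also have "\<dots> = cnj (C * E) * Z + cnj (S * F) * W"
    by (simp add: ab)
  also have "\<dots> = - of_real (d\<theta> / 2) * (C * S) * (E * cnj E)
      + \<i> * of_real ((d\<eta> + d\<phi>) / 2) * (C * C) * (E * cnj E)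
      + of_real (d\<theta> / 2) * (C * S) * (F * cnj F)
      + \<i> * of_real ((d\<eta> - d\<phi>) / 2) * (S * S) * (F * cnj F)"
    by (simp add: Z_def W_def CC algebra_simps)
  also have "\<dots> = \<i> / 2 * (of_real d\<eta> * (C * C + S * S) + of_real d\<phi> * (C * C - S * S))"
    by (simp add: EE field_simps)
  also have "\<dots> = \<i> * of_real ((d\<eta> + d\<phi> * cos (\<theta> t)) / 2)"
    by (simp add: CS1 CS3)
  finally have 2: "cnj (fst (q t)) * dz + cnj (snd (q t)) * dw =
      \<i> * of_real ((d\<eta> + d\<phi> * cos (\<theta> t)) / 2)" .
  show thesis
    by (rule that[OF q']) (simp_all only: 1 2, simp_all add: field_simps)
qed

lemma points_eguchi_hanson:
  "points (eguchi_hanson a) = {a<..} \<times> (\<lambda>q. {q, - q}) ` sphere 0 1"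
proof -
  have sph: "g \<in> sphere 0 1 \<longleftrightarrow> fst g * cnj (fst g) + snd g * cnj (snd g) = 1"
    for g :: "complex \<times> complex"
  proof -
    have "g \<in> sphere 0 1 \<longleftrightarrow> (norm (fst g))\<^sup>2 + (norm (snd g))\<^sup>2 = 1"
      by (simp add: norm_prod_def)
    also have "\<dots> \<longleftrightarrow> complex_of_real ((norm (fst g))\<^sup>2 + (norm (snd g))\<^sup>2) = 1"
      by (simp only: of_real_eq_1_iff)
    finally show ?thesis
      by (simp only: of_real_add complex_norm_square)
  qed
  have eu: "euler \<theta> \<phi> \<eta> \<in> sphere 0 1" for \<theta> \<phi> \<eta>
    by (simp add: euler_def norm_Pair norm_mult)
  have tr: "su2_translate g q \<in> sphere 0 1" if "g \<in> sphere 0 1" "q \<in> sphere 0 1" for g q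
  proof -
    obtain \<alpha> \<beta> z w where gq: "g = (\<alpha>, \<beta>)" "q = (z, w)" by (cases g, cases q)
    have "fst (su2_translate g q) * cnj (fst (su2_translate g q))
        + snd (su2_translate g q) * cnj (snd (su2_translate g q))
        = (\<alpha> * cnj \<alpha> + \<beta> * cnj \<beta>) * (z * cnj z + w * cnj w)"
      by (simp add: gq algebra_simps)
    then show ?thesis
      using that by (simp only: sph gq fst_conv snd_conv) simp
  qed
  have ex: "\<exists>g\<in>sphere 0 1. su2_translate g (euler (pi/2) 0 0) = q" if "q \<in> sphere 0 1" for q
  proof -
    obtain z w where q: "q = (z, w)" by (cases q)
    define k where "k = complex_of_real (sqrt 2 / 2)"
    have kk: "k * k = 1 / 2"
      unfolding k_def of_real_mult[symmetric] by simp
    then have k0: "k \<noteq> 0" by auto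
    have ck: "cnj k = k" by (simp add: k_def)
    have e: "euler (pi/2) 0 0 = (k, k)"
      by (simp add: euler_def k_def cos_45 sin_45)
    define g where "g = ((z + cnj w) * k, (w - cnj z) * k)"
    have "fst g * cnj (fst g) + snd g * cnj (snd g) = 2 * (k * k) * (z * cnj z + w * cnj w)"
      by (simp add: g_def ck algebra_simps)
    then have "g \<in> sphere 0 1"
      using that by (simp only: sph q kk fst_conv snd_conv) simp
    moreover have "su2_translate g (euler (pi/2) 0 0) = (2 * (k * k) * z, 2 * (k * k) * w)"
      by (simp add: g_def e ck algebra_simps)
    ultimately show ?thesis
      by (auto simp: q kk)
  qed
  show ?thesis
  proof (intro equalityI subsetI)
    fix p assume "p \<in> points (eguchi_hanson a)"
    then show "p \<in> {a<..} \<times> (\<lambda>q. {q, - q}) ` sphere 0 1"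
      unfolding points_def eguchi_hanson_def Let_def
      by (auto simp del: su2_translate.simps mem_sphere mem_sphere_0 intro!: imageI tr eu)
  next
    fix p :: "real \<times> (complex \<times> complex) set"
    assume "p \<in> {a<..} \<times> (\<lambda>q. {q, - q}) ` sphere 0 1"
    then obtain r q where p: "p = (r, {q, - q})" "a < r" "q \<in> sphere 0 1"
      by auto
    then obtain g where g: "g \<in> sphere 0 1" "su2_translate g (euler (pi/2) 0 0) = q"
      using ex by blast
    show "p \<in> points (eguchi_hanson a)"
      unfolding points_def eguchi_hanson_def Let_def using p g
      by (auto simp del: su2_translate.simps mem_sphere mem_sphere_0
          intro!: bexI[of _ g] image_eqI[of _ _ "(r, pi/2, 0, 0)"])
  qed
qed

end

theory Submission
  imports Defs
begin

text \<open>
  Let \<open>\<rho> = (\<bar>x - x\<^sub>1\<bar> + \<bar>x - x\<^sub>2\<bar>) / 2\<close>, let \<open>2c\<close> be the distance between the centers and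
  let \<open>C = (\<bar>x - x\<^sub>2\<bar> - \<bar>x - x\<^sub>1\<bar>) / 2c\<close>. The Hopf map \<open>(z, w) \<mapsto> (2zw, \<bar>z\<bar>^2 - \<bar>w\<bar>^2)\<close>, with
  \<open>\<rho> = c r^2/a^2\<close> and \<open>C = \<bar>z\<bar>^2 - \<bar>w\<bar>^2\<close>, makes Eguchi-Hanson space a circle bundle over the
  complement of the segment between the centers, for the action
  \<open>(exp (i\<psi>/4) z, exp (-i\<psi>/4) w)\<close>. In terms of the connection form \<open>\<omega>\<close> orthogonal to the orbits its
  metric is \<open>a^2/8c\<close> times \<open>V\<^sup>-\<^sup>1 \<omega>^2 + V dx \<cdot> dx\<close>, and in suitable sections \<open>\<omega>\<close> is given by the Dirac potentials
  of two monopoles, whose curl is the gradient of \<open>V\<close>. So \<open>\<omega>\<close> and the connection of the given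
  bundle have the same curvature. By the Poincare lemma the bundles with connection are locally
  isomorphic, and the isomorphisms form a locally constant sheaf. The complement of the segment is
  the union of two starlike sets (complements of rays) with connected intersection, hence the sheaf
  has a global section; this is the isometry.
\<close>

text \<open>The given bundle is abstract, with arbitrary gauges and no model, so the isometry cannot
  be written down and has to be glued. Over each point it is determined up to a rotation of the
  fibre; matching the two connections makes this rotation locally constant, and what remains is a
  possible holonomy around loops. There is none because the complement of the segment is simply
  connected, and the two starlike sets make this usable directly. The constants are forced. The
  angle \<open>\<psi>/4\<close> makes \<open>\<psi> = 4\<pi>\<close> act as -1, hence trivially on
  pairs {q, -q}, so that exactly the circle of length \<open>4\<pi>\<close> acts freely. The
  relation \<open>\<rho> = c r^2/a^2\<close> sends r = a to the segment and turns 1 - a^4/r^4 into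
  \<open>1 - c^2/\<rho>^2\<close>. The scale can be read off on the axis outside the segment: there
  dx has length \<open>\<bar>d\<rho>\<bar>\<close> and \<open>V = 2\<rho>/(\<rho>^2 - c^2)\<close>,
  while dr^2/(1 - a^4/r^4) becomes \<open>a^2 \<rho> d\<rho>^2 / (4c (\<rho>^2 - c^2))\<close>,
  which is a^2/8c times V times the squared length.\<close>

section \<open>Smooth functions\<close>

abbreviation fderiv :: "('a::real_normed_vector \<Rightarrow> 'b::real_normed_vector) \<Rightarrow> 'a \<Rightarrow> 'a \<Rightarrow> 'b" where
  "fderiv f x \<equiv> frechet_derivative f (at x)"

lemma Ck_on_cong:
  assumes "open S" "\<And>x. x \<in> S \<Longrightarrow> f x = g x"
  shows "Ck_on k S f \<longleftrightarrow> Ck_on k S g"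
  using assms(2)
proof (induction k arbitrary: f g)
  case 0
  then show ?case by (auto cong: continuous_on_cong)
next
  case (Suc k)
  have D: "(f has_derivative d) (at x) \<longleftrightarrow> (g has_derivative d) (at x)" if "x \<in> S" for x d
    using Suc.prems that assms(1) has_derivative_transform_within_open by metis
  then have E: "fderiv f x = fderiv g x" if "x \<in> S" for x
    using that by (simp add: frechet_derivative_def)
  have "(\<forall>v. Ck_on k S (\<lambda>x. fderiv f x v)) \<longleftrightarrow>
      (\<forall>v. Ck_on k S (\<lambda>x. fderiv g x v))"
    using E by (intro all_cong1 Suc.IH) auto
  then show ?case
    using D by (auto simp: differentiable_def)
qed

text \<open>Lets an explicit derivative stand in for the choice operator behind
  \<open>frechet_derivative\<close>; the higher orders below are reached through this rule.\<close>

lemma Ck_on_SucI: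
  assumes "open S" "\<And>x. x \<in> S \<Longrightarrow> (f has_derivative f' x) (at x)"
    and "\<And>v. Ck_on k S (\<lambda>x. f' x v)"
  shows "Ck_on (Suc k) S f"
proof -
  have "fderiv f x = f' x" if "x \<in> S" for x
    using frechet_derivative_at[OF assms(2)[OF that]] by simp
  then have "Ck_on k S (\<lambda>x. fderiv f x v)" for v
    using assms(3)[of v] by (subst Ck_on_cong[OF assms(1), where g = "\<lambda>x. f' x v"]) auto
  then show ?thesis using assms(2) by (auto simp: differentiable_def)
qed

lemma Ck_on_Suc_has_derivative:
  assumes "Ck_on (Suc k) S f" "x \<in> S"
  shows "(f has_derivative fderiv f x) (at x)"
  using assms frechet_derivative_works by auto

lemma Ck_on_Suc_mono: "Ck_on (Suc k) S f \<Longrightarrow> Ck_on k S f"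
proof (induction k arbitrary: f)
  case 0
  then show ?case
    by (auto intro!: continuous_at_imp_continuous_on differentiable_imp_continuous_within)
next
  case (Suc k)
  then show ?case by (metis Ck_on.simps(2))
qed

lemma Ck_on_subset: "Ck_on k S f \<Longrightarrow> T \<subseteq> S \<Longrightarrow> Ck_on k T f"
  by (induction k arbitrary: f) (auto intro: continuous_on_subset)

lemma smooth_on_subset: "smooth_on S f \<Longrightarrow> T \<subseteq> S \<Longrightarrow> smooth_on T f"
  by (meson Ck_on_subset smooth_on_def)

lemma smooth_on_has_derivative:
  assumes "smooth_on S f" "x \<in> S"
  shows "(f has_derivative fderiv f x) (at x)"
  using assms Ck_on_Suc_has_derivative unfolding smooth_on_def by blast

lemma smooth_on_frechet_derivative:
  "smooth_on S f \<Longrightarrow> smooth_on S (\<lambda>x. fderiv f x v)"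
  by (metis Ck_on.simps(2) smooth_on_def)

lemma smooth_on_continuous: "smooth_on S f \<Longrightarrow> continuous_on S f"
  by (metis Ck_on.simps(1) smooth_on_def)

lemma smooth_onI_derivative:
  assumes "open S" "\<And>x. x \<in> S \<Longrightarrow> (f has_derivative f' x) (at x)"
    and "\<And>v. smooth_on S (\<lambda>x. f' x v)"
  shows "smooth_on S f"
  using Ck_on_SucI[OF assms(1,2)] assms(3) Ck_on_Suc_mono unfolding smooth_on_def by blast

lemma Ck_on_const: "open S \<Longrightarrow> Ck_on k S (\<lambda>x. c)"
proof (induction k arbitrary: c)
  case (Suc k)
  then show ?case by (auto intro!: Ck_on_SucI[where f' = "\<lambda>_ _. 0"] derivative_eq_intros)
qed auto

lemma smooth_on_const: "open S \<Longrightarrow> smooth_on S (\<lambda>x. c)"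
  by (simp add: smooth_on_def Ck_on_const)

lemma smooth_on_bounded_linear:
  assumes "open S" "bounded_linear f"
  shows "smooth_on S f"
  by (rule smooth_onI_derivative[where f' = "\<lambda>_. f"])
    (use assms in \<open>auto intro: bounded_linear_imp_has_derivative smooth_on_const\<close>)

lemma Ck_on_linear_compose:
  assumes "open S" "bounded_linear l" "Ck_on k S f"
  shows "Ck_on k S (\<lambda>x. l (f x))"
  using assms(3)
proof (induction k arbitrary: f)
  case 0
  then show ?case
    by (simp add: bounded_linear.continuous_on[OF assms(2)])
next
  case (Suc k)
  show ?case
  proof (rule Ck_on_SucI[OF assms(1)])
    show "((\<lambda>x. l (f x)) has_derivative (\<lambda>v. l (fderiv f x v))) (at x)"
      if "x \<in> S" for x
      using bounded_linear.has_derivative[OF assms(2) Ck_on_Suc_has_derivative[OF Suc.prems that]] .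
    show "Ck_on k S (\<lambda>x. l (fderiv f x v))" for v
      using Suc by auto
  qed
qed

lemma smooth_on_linear_compose:
  "open S \<Longrightarrow> bounded_linear l \<Longrightarrow> smooth_on S f \<Longrightarrow> smooth_on S (\<lambda>x. l (f x))"
  by (simp add: smooth_on_def Ck_on_linear_compose)

lemma Ck_on_add:
  assumes "open S" "Ck_on k S f" "Ck_on k S g"
  shows "Ck_on k S (\<lambda>x. f x + g x)"
  using assms(2,3)
proof (induction k arbitrary: f g)
  case 0
  then show ?case by (auto intro: continuous_on_add)
next
  case (Suc k)
  show ?case
  proof (rule Ck_on_SucI[OF assms(1)])
    show "((\<lambda>x. f x + g x) has_derivative
        (\<lambda>v. fderiv f x v + fderiv g x v)) (at x)"
      if "x \<in> S" for x
      by (intro has_derivative_add Ck_on_Suc_has_derivative[OF _ that]) (use Suc in auto)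
    show "Ck_on k S (\<lambda>x. fderiv f x v + fderiv g x v)" for v
      using Suc by auto
  qed
qed

lemma Ck_on_bilinear:
  assumes "open S" "bounded_bilinear b" "Ck_on k S f" "Ck_on k S g"
  shows "Ck_on k S (\<lambda>x. b (f x) (g x))"
  using assms(3,4)
proof (induction k arbitrary: f g)
  case 0
  then show ?case by (simp add: bounded_bilinear.continuous_on[OF assms(2)])
next
  case (Suc k)
  show ?case
  proof (rule Ck_on_SucI[OF assms(1)])
    show "((\<lambda>x. b (f x) (g x)) has_derivative
        (\<lambda>v. b (f x) (fderiv g x v) + b (fderiv f x v) (g x))) (at x)"
      if "x \<in> S" for x
      by (intro bounded_bilinear.FDERIV[OF assms(2)] Ck_on_Suc_has_derivative[OF _ that])
        (use Suc in auto)
    show "Ck_on k S (\<lambda>x. b (f x) (fderiv g x v)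
        + b (fderiv f x v) (g x))" for v
      \<comment> \<open>The undifferentiated factor of each summand enters the induction hypothesis
        at the lower order only.\<close>
      using Suc.prems Suc.prems[THEN Ck_on_Suc_mono]
      by (intro Ck_on_add[OF assms(1)] Suc.IH) (auto simp del: split_paired_All)
  qed
qed

lemma Ck_on_sum:
  assumes "open S" "\<And>i. i \<in> I \<Longrightarrow> Ck_on k S (f i)"
  shows "Ck_on k S (\<lambda>x. \<Sum>i\<in>I. f i x)"
  using assms(2)
proof (induction I rule: infinite_finite_induct)
  case (insert i I)
  then show ?case by (simp add: Ck_on_add[OF assms(1)])
qed (auto simp: Ck_on_const[OF assms(1)])

text \<open>The chain rule involves the value of a derivative at a varying vector; expanding that vector in
  a basis reduces it to directional derivatives in fixed directions.\<close>

lemma Ck_on_compose: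
  fixes f :: "'a::real_normed_vector \<Rightarrow> 'b::euclidean_space"
    and g :: "'b \<Rightarrow> 'c::real_normed_vector"
  assumes "open S" "open T" "Ck_on k S f" "Ck_on k T g" "f ` S \<subseteq> T"
  shows "Ck_on k S (\<lambda>x. g (f x))"
  using assms(3,4)
proof (induction k arbitrary: g)
  case 0
  then show ?case
    using assms(5) by (auto intro: continuous_on_compose2)
next
  case (Suc k)
  let ?f' = "\<lambda>x. fderiv f x" and ?g' = "\<lambda>y. fderiv g y"
  have f: "(f has_derivative ?f' x) (at x)" if "x \<in> S" for x
    using Ck_on_Suc_has_derivative[OF Suc.prems(1) that] .
  have g: "(g has_derivative ?g' (f x)) (at (f x))" if "x \<in> S" for x
    using Ck_on_Suc_has_derivative[OF Suc.prems(2)] assms(5) that by blast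
  show ?case
  proof (rule Ck_on_SucI[OF assms(1)])
    show "((\<lambda>x. g (f x)) has_derivative
        (\<lambda>v. \<Sum>b\<in>Basis. (?f' x v \<bullet> b) *\<^sub>R ?g' (f x) b)) (at x)"
      if "x \<in> S" for x
    proof -
      interpret l: bounded_linear "?g' (f x)"
        using g[OF that] by (rule has_derivative_bounded_linear)
      have "?g' (f x) (?f' x v) = (\<Sum>b\<in>Basis. (?f' x v \<bullet> b) *\<^sub>R ?g' (f x) b)" for v
        by (subst euclidean_representation[of "?f' x v", symmetric])
          (simp only: l.sum l.scaleR)
      then show ?thesis
        using has_derivative_compose[OF f[OF that] g[OF that]] by (simp add: o_def)
    qed
    show "Ck_on k S (\<lambda>x. \<Sum>b\<in>Basis. (?f' x v \<bullet> b) *\<^sub>R ?g' (f x) b)" for v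
    proof (intro Ck_on_sum Ck_on_bilinear[OF assms(1) bounded_bilinear_scaleR] assms)
      fix b :: 'b
      show "Ck_on k S (\<lambda>x. ?f' x v \<bullet> b)"
        using Suc.prems by (intro Ck_on_linear_compose[OF assms(1) bounded_linear_inner_left]) auto
      \<comment> \<open>The induction hypothesis is applied to a directional derivative of
        \<open>g\<close> and the same \<open>f\<close>, which is why only \<open>g\<close> is
        generalised.\<close>
      show "Ck_on k S (\<lambda>x. ?g' (f x) b)"
        using Suc.prems Ck_on_Suc_mono by (intro Suc.IH) auto
    qed
  qed
qed

lemma smooth_on_compose:
  fixes f :: "'a::real_normed_vector \<Rightarrow> 'b::euclidean_space"
  assumes "smooth_on T g" "smooth_on S f" "open S" "open T" "f ` S \<subseteq> T"
  shows "smooth_on S (\<lambda>x. g (f x))"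
  using assms Ck_on_compose unfolding smooth_on_def by blast

lemma smooth_on_bilinear:
  "open S \<Longrightarrow> bounded_bilinear b \<Longrightarrow> smooth_on S f \<Longrightarrow> smooth_on S g
    \<Longrightarrow> smooth_on S (\<lambda>x. b (f x) (g x))"
  by (simp add: smooth_on_def Ck_on_bilinear)

lemmas smooth_on_mult = smooth_on_bilinear[OF _ bounded_bilinear_mult]
lemmas smooth_on_scaleR = smooth_on_bilinear[OF _ bounded_bilinear_scaleR]
lemmas smooth_on_inner = smooth_on_bilinear[OF _ bounded_bilinear_inner]

lemma smooth_on_add:
  "open S \<Longrightarrow> smooth_on S f \<Longrightarrow> smooth_on S g \<Longrightarrow> smooth_on S (\<lambda>x. f x + g x)"
  by (simp add: smooth_on_def Ck_on_add)

lemma smooth_on_uminus: "open S \<Longrightarrow> smooth_on S f \<Longrightarrow> smooth_on S (\<lambda>x. - f x)"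
  by (rule smooth_on_linear_compose) (auto intro: bounded_linear_minus bounded_linear_ident)

lemma smooth_on_diff:
  "open S \<Longrightarrow> smooth_on S f \<Longrightarrow> smooth_on S g \<Longrightarrow> smooth_on S (\<lambda>x. f x - g x)"
  using smooth_on_add[of S f "\<lambda>x. - g x"] by (simp add: smooth_on_uminus)

lemma smooth_on_ident: "open S \<Longrightarrow> smooth_on S (\<lambda>x. x)"
  by (rule smooth_on_bounded_linear) (auto intro: bounded_linear_ident)

lemma smooth_on_Pair:
  assumes "open S" "smooth_on S f" "smooth_on S g"
  shows "smooth_on S (\<lambda>x. (f x, g x))"
proof -
  have "smooth_on S (\<lambda>x. (f x, 0) + (0, g x))"
    by (intro smooth_on_add smooth_on_linear_compose[of S "\<lambda>y. (y, 0)"]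
        smooth_on_linear_compose[of S "\<lambda>y. (0, y)"] assms bounded_linear_Pair
        bounded_linear_ident bounded_linear_zero)
  then show ?thesis by simp
qed

lemmas smooth_on_fst = smooth_on_linear_compose[OF _ bounded_linear_fst]
lemmas smooth_on_snd = smooth_on_linear_compose[OF _ bounded_linear_snd]
lemmas smooth_on_Re = smooth_on_linear_compose[OF _ bounded_linear_Re]
lemmas smooth_on_Im = smooth_on_linear_compose[OF _ bounded_linear_Im]
lemmas smooth_on_cnj = smooth_on_linear_compose[OF _ bounded_linear_cnj]
lemmas smooth_on_of_real = smooth_on_linear_compose[OF _ bounded_linear_of_real]

section \<open>Smoothness of elementary functions\<close>

lemma Ck_on_real_SucI:
  fixes f :: "real \<Rightarrow> 'a::real_normed_vector"
  assumes "open S" "\<And>x. x \<in> S \<Longrightarrow> (f has_vector_derivative f' x) (at x)" "Ck_on k S f'"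
  shows "Ck_on (Suc k) S f"
proof (rule Ck_on_SucI[OF assms(1)])
  show "(f has_derivative (\<lambda>v. v *\<^sub>R f' x)) (at x)" if "x \<in> S" for x
    using assms(2)[OF that] by (simp add: has_vector_derivative_def)
  show "Ck_on k S (\<lambda>x. v *\<^sub>R f' x)" for v
    by (rule Ck_on_linear_compose[OF assms(1) bounded_linear_scaleR_right assms(3)])
qed

text \<open>The derivative is a polynomial in \<open>inverse\<close> itself, so the induction on the
  order feeds on its own hypothesis. The derivatives of \<open>sqrt\<close> and \<open>cis\<close>
  likewise return to the function, whereas that of \<open>arctan\<close> is a rational function
  already known to be smooth.\<close>

lemma smooth_on_real_inverse: "smooth_on (- {0}) (inverse :: real \<Rightarrow> real)"
proof -
  have "Ck_on k (- {0}) (inverse :: real \<Rightarrow> real)" for k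
  proof (induction k)
    case 0
    then show ?case by (auto intro!: continuous_intros)
  next
    case (Suc k)
    have o: "open (- {0} :: real set)" by auto
    show ?case
    proof (rule Ck_on_real_SucI[OF o])
      show "(inverse has_vector_derivative - (inverse x * inverse x)) (at x)"
        if "x \<in> - {0}" for x :: real
        using that by (auto simp: has_real_derivative_iff_has_vector_derivative[symmetric]
            intro!: derivative_eq_intros)
      show "Ck_on k (- {0}) (\<lambda>x :: real. - (inverse x * inverse x))"
        by (intro Ck_on_linear_compose[OF o bounded_linear_minus] bounded_linear_ident
            Ck_on_bilinear[OF o bounded_bilinear_mult] Suc)
    qed
  qed
  then show ?thesis by (simp add: smooth_on_def)
qed

lemma smooth_on_inverse:
  fixes f :: "'a::real_normed_vector \<Rightarrow> real"
  shows "open S \<Longrightarrow> smooth_on S f \<Longrightarrow> (\<And>x. x \<in> S \<Longrightarrow> f x \<noteq> 0) \<Longrightarrow> smooth_on S (\<lambda>x. inverse (f x))"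
  by (rule smooth_on_compose[OF smooth_on_real_inverse]) auto

lemma smooth_on_divide:
  fixes f g :: "'a::real_normed_vector \<Rightarrow> real"
  shows "open S \<Longrightarrow> smooth_on S f \<Longrightarrow> smooth_on S g \<Longrightarrow> (\<And>x. x \<in> S \<Longrightarrow> g x \<noteq> 0)
    \<Longrightarrow> smooth_on S (\<lambda>x. f x / g x)"
  unfolding divide_inverse by (intro smooth_on_mult smooth_on_inverse) simp_all

lemma smooth_on_real_sqrt: "smooth_on {0<..} sqrt"
proof -
  have "Ck_on k {0<..} sqrt" for k
  proof (induction k)
    case 0
    then show ?case by (auto intro!: continuous_intros)
  next
    case (Suc k)
    have o: "open ({0<..} :: real set)" by auto
    show ?case
    proof (rule Ck_on_real_SucI[OF o])
      show "(sqrt has_vector_derivative 1 / 2 * inverse (sqrt x)) (at x)"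
        if "x \<in> {0<..}" for x :: real
        using that by (auto simp: has_real_derivative_iff_has_vector_derivative[symmetric]
            intro!: derivative_eq_intros)
      have "Ck_on k {0<..} (\<lambda>x. inverse (sqrt x))"
        by (rule Ck_on_compose[where g = inverse and T = "- {0}"])
          (use Suc smooth_on_real_inverse in \<open>auto simp: smooth_on_def\<close>)
      then show "Ck_on k {0<..} (\<lambda>x. 1 / 2 * inverse (sqrt x))"
        by (intro Ck_on_linear_compose[OF o bounded_linear_mult_right])
    qed
  qed
  then show ?thesis by (simp add: smooth_on_def)
qed

lemma smooth_on_sqrt:
  fixes f :: "'a::real_normed_vector \<Rightarrow> real"
  shows "open S \<Longrightarrow> smooth_on S f \<Longrightarrow> (\<And>x. x \<in> S \<Longrightarrow> 0 < f x) \<Longrightarrow> smooth_on S (\<lambda>x. sqrt (f x))"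
  by (rule smooth_on_compose[OF smooth_on_real_sqrt]) auto

lemma smooth_on_norm_diff:
  fixes c :: "'a::real_inner"
  assumes "open S" "c \<notin> S"
  shows "smooth_on S (\<lambda>x. norm (x - c))"
  unfolding norm_eq_sqrt_inner
  by (intro smooth_on_sqrt smooth_on_inner smooth_on_diff smooth_on_ident smooth_on_const assms)
    (use assms in auto)

lemma smooth_on_cis_UNIV: "smooth_on UNIV cis"
proof -
  have "Ck_on k UNIV cis" for k
  proof (induction k)
    case 0
    then show ?case by (auto intro!: continuous_intros)
  next
    case (Suc k)
    have o: "open (UNIV :: real set)" by auto
    show ?case
    proof (rule Ck_on_real_SucI[OF o])
      show "(cis has_vector_derivative \<i> * cis x) (at x)" for x :: real
        unfolding has_vector_derivative_complex_iff by (auto intro!: derivative_eq_intros)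
      show "Ck_on k UNIV (\<lambda>x. \<i> * cis x)"
        by (intro Ck_on_linear_compose[OF o bounded_linear_mult_right] Suc)
    qed
  qed
  then show ?thesis by (simp add: smooth_on_def)
qed

lemma smooth_on_cis:
  fixes f :: "'a::real_normed_vector \<Rightarrow> real"
  shows "open S \<Longrightarrow> smooth_on S f \<Longrightarrow> smooth_on S (\<lambda>x. cis (f x))"
  by (rule smooth_on_compose[OF smooth_on_cis_UNIV]) auto

lemma smooth_on_cos:
  fixes f :: "'a::real_normed_vector \<Rightarrow> real"
  assumes "open S" "smooth_on S f"
  shows "smooth_on S (\<lambda>x. cos (f x))"
  using smooth_on_Re[OF assms(1) smooth_on_cis[OF assms]] by simp

lemma smooth_on_sin:
  fixes f :: "'a::real_normed_vector \<Rightarrow> real"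
  assumes "open S" "smooth_on S f"
  shows "smooth_on S (\<lambda>x. sin (f x))"
  using smooth_on_Im[OF assms(1) smooth_on_cis[OF assms]] by simp

lemma smooth_on_arctan_UNIV: "smooth_on UNIV arctan"
proof (rule smooth_onI_derivative)
  show "(arctan has_derivative (\<lambda>v. inverse (1 + x * x) * v)) (at x)" for x
    using DERIV_arctan[of x] by (simp add: has_field_derivative_def power2_eq_square)
  have "1 + x * x \<noteq> 0" for x :: real
    by (smt (verit) zero_le_square)
  then show "smooth_on UNIV (\<lambda>x. inverse (1 + x * x) * v)" for v :: real
    by (intro smooth_on_mult smooth_on_const smooth_on_inverse smooth_on_add smooth_on_ident) auto
qed auto

lemma smooth_on_arctan:
  fixes f :: "'a::real_normed_vector \<Rightarrow> real"
  shows "open S \<Longrightarrow> smooth_on S f \<Longrightarrow> smooth_on S (\<lambda>x. arctan (f x))"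
  by (rule smooth_on_compose[OF smooth_on_arctan_UNIV]) auto

lemmas smooth_intros =
  smooth_on_const smooth_on_ident smooth_on_add smooth_on_diff smooth_on_uminus smooth_on_mult
  smooth_on_scaleR smooth_on_inner smooth_on_divide smooth_on_inverse smooth_on_sqrt smooth_on_Pair
  smooth_on_fst smooth_on_snd smooth_on_Re smooth_on_Im smooth_on_cnj smooth_on_of_real
  smooth_on_cis smooth_on_cos smooth_on_sin smooth_on_arctan

lemma frechet_derivative_eqI:
  "(f has_derivative f') (at x) \<Longrightarrow> fderiv f x = f'"
  using frechet_derivative_at by metis

section \<open>Closed forms and locally constant sheaves\<close>

text \<open>The primitive is the integral of the form along segments from a base point.\<close>

lemma closed_form_primitive:
  fixes F :: "'a::euclidean_space \<Rightarrow> 'a"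
  assumes S: "open S" "convex S" and F: "smooth_on S F"
    and sym: "\<And>x v w. x \<in> S \<Longrightarrow>
      fderiv F x v \<bullet> w = fderiv F x w \<bullet> v"
  obtains \<tau> where "\<And>x. x \<in> S \<Longrightarrow> GDERIV \<tau> x :> F x"
proof (cases "S = {}")
  case True
  then show ?thesis using that by auto
next
  case False
  then obtain p where p: "p \<in> S" by auto
  let ?D = "\<lambda>x. fderiv F x"
  define \<gamma> where "\<gamma> x t = p + t *\<^sub>R (x - p)" for x and t :: real
  \<comment> \<open>\<open>H x t\<close> plays two roles. By the symmetry of the derivative it is
    the gradient in \<open>x\<close> of the integrand \<open>f x t\<close>, and it is also the
    derivative in \<open>t\<close> of \<open>t F(\<gamma> x t)\<close>, so that its integral over
    [0, 1] is \<open>F x\<close>. The basis expansion reduces joint continuity to that of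
    derivatives in fixed directions.\<close>
  define H where "H x t = t *\<^sub>R (\<Sum>b\<in>Basis. ((x - p) \<bullet> b) *\<^sub>R ?D (\<gamma> x t) b) + F (\<gamma> x t)" for x t
  define f where "f x t = F (\<gamma> x t) \<bullet> (x - p)" for x t
  have \<gamma>: "\<gamma> x t \<in> S" if "x \<in> S" "t \<in> cbox 0 1" for x t
    using convexD_alt[OF S(2) p that(1), of t] that(2)
    by (simp add: \<gamma>_def algebra_simps)
  have DF: "(F has_derivative ?D x) (at x)" if "x \<in> S" for x
    using smooth_on_has_derivative[OF F that] .
  have lin: "linear (?D x)" if "x \<in> S" for x
    using DF[OF that] by (meson has_derivative_bounded_linear bounded_linear.linear)
  have H_eq: "H x t = t *\<^sub>R ?D (\<gamma> x t) (x - p) + F (\<gamma> x t)" if "x \<in> S" "t \<in> cbox 0 1" for x t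
  proof -
    have "?D (\<gamma> x t) (\<Sum>b\<in>Basis. ((x - p) \<bullet> b) *\<^sub>R b)
        = (\<Sum>b\<in>Basis. ((x - p) \<bullet> b) *\<^sub>R ?D (\<gamma> x t) b)"
      using lin[OF \<gamma>[OF that]] by (simp only: linear_sum linear_cmul)
    then show ?thesis by (simp add: H_def euclidean_representation)
  qed
  have c\<gamma>: "continuous_on (S \<times> cbox 0 1) (\<lambda>z. \<gamma> (fst z) (snd z))"
    unfolding \<gamma>_def by (intro continuous_intros)
  have cD: "continuous_on (S \<times> cbox 0 1) (\<lambda>z. ?D (\<gamma> (fst z) (snd z)) b)" for b
    by (rule continuous_on_compose2[OF smooth_on_continuous[OF smooth_on_frechet_derivative[OF F]] c\<gamma>])
      (use \<gamma> in auto)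
  have cF: "continuous_on (S \<times> cbox 0 1) (\<lambda>z. F (\<gamma> (fst z) (snd z)))"
    by (rule continuous_on_compose2[OF smooth_on_continuous[OF F] c\<gamma>]) (use \<gamma> in auto)
  have cH: "continuous_on (S \<times> cbox 0 1) (\<lambda>z. H (fst z) (snd z))"
    unfolding H_def by (intro continuous_intros cD cF)
  have cPair: "continuous_on (cbox 0 1) (\<lambda>t. (x, t))" for x :: 'a
    by (intro continuous_intros)
  have cHx: "continuous_on (cbox 0 1) (H x)" if "x \<in> S" for x
    using continuous_on_compose2[OF cH cPair[of x]] that by auto
  have cfx: "continuous_on (cbox 0 1) (f x)" if "x \<in> S" for x
    unfolding f_def
    using continuous_on_compose2[OF cF cPair[of x]] that by (intro continuous_on_inner) auto
  have "GDERIV (\<lambda>x. integral (cbox 0 1) (f x)) x :> F x" if x: "x \<in> S" for x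
  proof -
    have "((\<lambda>x. integral (cbox 0 1) (f x)) has_derivative
        integral (cbox 0 1) (\<lambda>t. blinfun_inner_left (H x t))) (at x within S)"
    proof (rule leibniz_rule[OF _ _ _ x S(2)])
      show "((\<lambda>x. f x t) has_derivative blinfun_inner_left (H y t)) (at y within S)"
        if "y \<in> S" "t \<in> cbox 0 1" for y t
      proof (rule has_derivative_at_withinI)
        have "((\<lambda>x. \<gamma> x t) has_derivative (\<lambda>v. t *\<^sub>R v)) (at y)"
          unfolding \<gamma>_def by (auto intro!: derivative_eq_intros)
        then have "((\<lambda>x. F (\<gamma> x t)) has_derivative (\<lambda>v. ?D (\<gamma> y t) (t *\<^sub>R v))) (at y)"
          using has_derivative_compose[of "\<lambda>x. \<gamma> x t", OF _ DF[OF \<gamma>[OF that]]] by blast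
        then have "((\<lambda>x. f x t) has_derivative
            (\<lambda>v. F (\<gamma> y t) \<bullet> v + ?D (\<gamma> y t) (t *\<^sub>R v) \<bullet> (y - p))) (at y)"
          unfolding f_def by (auto intro!: derivative_eq_intros)
        moreover have "F (\<gamma> y t) \<bullet> v + ?D (\<gamma> y t) (t *\<^sub>R v) \<bullet> (y - p) = v \<bullet> H y t" for v
          using sym[OF \<gamma>[OF that], of v "y - p"]
          by (simp add: H_eq[OF that] linear_cmul[OF lin[OF \<gamma>[OF that]]] inner_commute inner_simps)
        ultimately show "((\<lambda>x. f x t) has_derivative blinfun_inner_left (H y t)) (at y)"
          by (simp add: blinfun_inner_left.rep_eq)
      qed
      show "f y integrable_on cbox 0 1" if "y \<in> S" for y
        by (rule integrable_continuous[OF cfx[OF that]])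
      show "continuous_on (S \<times> cbox 0 1) (\<lambda>(y, t). blinfun_inner_left (H y t))"
        using cH by (auto simp: split_beta intro!: continuous_intros)
    qed
    moreover have "integral (cbox 0 1) (\<lambda>t. blinfun_inner_left (H x t)) = blinfun_inner_left (F x)"
    proof -
      have "((\<lambda>t. t *\<^sub>R F (\<gamma> x t)) has_vector_derivative H x t) (at t within cbox 0 1)"
        if t: "t \<in> cbox 0 1" for t
      proof -
        have "((\<lambda>t. \<gamma> x t) has_vector_derivative (x - p)) (at t within cbox 0 1)"
          unfolding \<gamma>_def by (auto intro!: derivative_eq_intros)
        then have "((\<lambda>t. F (\<gamma> x t)) has_vector_derivative ?D (\<gamma> x t) (x - p)) (at t within cbox 0 1)"
          using vector_derivative_diff_chain_within[of "\<gamma> x", OF _ has_derivative_at_withinI[OF DF[OF \<gamma>[OF x t]]]]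
          by (auto simp: o_def)
        then show ?thesis
          unfolding H_eq[OF x t] by (auto intro!: derivative_eq_intros)
      qed
      then have "(H x has_integral F x) (cbox 0 1)"
        using fundamental_theorem_of_calculus[of 0 1 "\<lambda>t. t *\<^sub>R F (\<gamma> x t)" "H x"]
        by (simp add: \<gamma>_def box_real)
      then have "integral (cbox 0 1) (H x) = F x" by (rule integral_unique)
      moreover have "integral (cbox 0 1) (blinfun_inner_left \<circ> H x)
          = blinfun_inner_left (integral (cbox 0 1) (H x))"
        by (rule integral_linear[OF integrable_continuous[OF cHx[OF x]]])
          (rule bounded_linear_blinfun_inner_left)
      ultimately show ?thesis by (simp add: o_def)
    qed
    ultimately have "((\<lambda>x. integral (cbox 0 1) (f x)) has_derivative blinfun_inner_left (F x)) (at x)"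
      by (simp only: at_within_open[OF x S(1)])
    then show ?thesis unfolding gderiv_def blinfun_inner_left.rep_eq .
  qed
  then show ?thesis by (rule that)
qed

lemma smooth_on_GDERIV:
  assumes "open S" "smooth_on S F" "\<And>x. x \<in> S \<Longrightarrow> GDERIV \<tau> x :> F x"
  shows "smooth_on S \<tau>"
proof (rule smooth_onI_derivative[OF assms(1)])
  show "(\<tau> has_derivative (\<lambda>v. v \<bullet> F x)) (at x)" if "x \<in> S" for x
    using assms(3)[OF that] by (simp add: gderiv_def)
  show "smooth_on S (\<lambda>x. v \<bullet> F x)" for v
    by (intro smooth_intros assms)
qed

text \<open>
  Local sections with unique continuation, presented by the property \<open>g \<sigma> x\<close> of the germ of
  \<open>\<sigma>\<close> at \<open>x\<close>.
\<close>

locale locally_constant_sheaf =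
  fixes V :: "'a::euclidean_space set" and stalk :: "'a \<Rightarrow> 'b set" and g :: "('a \<Rightarrow> 'b) \<Rightarrow> 'a \<Rightarrow> bool"
  assumes germ_cong: "g \<sigma> x \<Longrightarrow> \<forall>\<^sub>F y in nhds x. \<sigma>' y = \<sigma> y \<Longrightarrow> g \<sigma>' x"
    and germ_unique: "x \<in> V \<Longrightarrow> g \<sigma> x \<Longrightarrow> g \<sigma>' x \<Longrightarrow> \<forall>\<^sub>F y in nhds x. \<sigma> y = \<sigma>' y \<longleftrightarrow> \<sigma> x = \<sigma>' x"
    and sections_through: "x \<in> V \<Longrightarrow> \<exists>T. open T \<and> x \<in> T \<and>
      (\<forall>y\<in>T. \<forall>m\<in>stalk y. \<exists>\<sigma>. \<sigma> y = m \<and> (\<forall>z\<in>T. g \<sigma> z))"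
    and germ_stalk: "g \<sigma> x \<Longrightarrow> \<sigma> x \<in> stalk x"
begin

text \<open>By \<open>germ_unique\<close> agreement and disagreement are both open conditions, so on
  a connected set one of the two sets is empty.\<close>

lemma sections_eq_on_connected:
  assumes S: "open S" "connected S" "S \<subseteq> V"
    and g: "\<And>x. x \<in> S \<Longrightarrow> g \<sigma> x" "\<And>x. x \<in> S \<Longrightarrow> g \<sigma>' x"
    and p: "p \<in> S" "\<sigma> p = \<sigma>' p" and x: "x \<in> S"
  shows "\<sigma> x = \<sigma>' x"
proof -
  have o: "open {x \<in> S. \<sigma> x = \<sigma>' x \<longleftrightarrow> b}" for b
  proof (subst open_subopen, intro ballI)
    fix y assume "y \<in> {x \<in> S. (\<sigma> x = \<sigma>' x) = b}"
    then have y: "y \<in> S" and b: "(\<sigma> y = \<sigma>' y) = b" by auto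
    then obtain T where "open T" "y \<in> T" "\<And>z. z \<in> T \<Longrightarrow> \<sigma> z = \<sigma>' z \<longleftrightarrow> \<sigma> y = \<sigma>' y"
      using germ_unique[OF _ g(1)[OF y] g(2)[OF y]] S(3) unfolding eventually_nhds by blast
    then show "\<exists>T. open T \<and> y \<in> T \<and> T \<subseteq> {x \<in> S. (\<sigma> x = \<sigma>' x) = b}"
      using y b S(1) by (intro exI[of _ "S \<inter> T"]) auto
  qed
  show ?thesis
    using connectedD[OF S(2) o[of True] o[of False]] p x by auto
qed

text \<open>Agreement at the single point \<open>p\<close> spreads over the connected intersection,
  so the pieces glue, and \<open>germ_cong\<close> recognises the glued map as a section near every
  point.\<close>

lemma extend_section:
  assumes S: "open S" "S \<subseteq> V" and T: "open T" "T \<subseteq> V" and ST: "connected (S \<inter> T)" "p \<in> S \<inter> T"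
    and g: "\<And>x. x \<in> S \<Longrightarrow> g \<sigma> x" "\<And>x. x \<in> T \<Longrightarrow> g \<sigma>' x" and p: "\<sigma> p = \<sigma>' p"
  obtains \<rho> where "\<And>x. x \<in> S \<Longrightarrow> \<rho> x = \<sigma> x" "\<And>x. x \<in> T \<Longrightarrow> \<rho> x = \<sigma>' x"
    "\<And>x. x \<in> S \<union> T \<Longrightarrow> g \<rho> x"
proof -
  define \<rho> where "\<rho> x = (if x \<in> S then \<sigma> x else \<sigma>' x)" for x
  have 1: "\<rho> x = \<sigma> x" if "x \<in> S" for x
    using that by (simp add: \<rho>_def)
  have 2: "\<rho> x = \<sigma>' x" if "x \<in> T" for x
    using that sections_eq_on_connected[of "S \<inter> T" \<sigma> \<sigma>' p x] S T ST g p by (auto simp: \<rho>_def)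
  have "g \<rho> x" if "x \<in> S \<union> T" for x
  proof (cases "x \<in> S")
    case True
    then show ?thesis
      using germ_cong[OF g(1)[OF True], of \<rho>] eventually_nhds_in_open[OF S(1) True]
      by (simp add: 1 eventually_mono)
  next
    case False
    with that have "x \<in> T" by auto
    then show ?thesis
      using germ_cong[OF g(2)[OF \<open>x \<in> T\<close>], of \<rho>] eventually_nhds_in_open[OF T(1) \<open>x \<in> T\<close>]
      by (simp add: 2 eventually_mono)
  qed
  with 1 2 show ?thesis by (rule that)
qed

text \<open>Continuation along a segment. The result lives on a convex neighbourhood of the whole
  segment, because intersections of such neighbourhoods are again connected and continuations can be
  compared there.\<close>

lemma section_along_segment:
  assumes V: "open V" "closed_segment p x \<subseteq> V" and m: "m \<in> stalk p"
  obtains S \<sigma> where "open S" "convex S" "S \<subseteq> V" "closed_segment p x \<subseteq> S" "\<sigma> p = m"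
    "\<And>y. y \<in> S \<Longrightarrow> g \<sigma> y"
proof -
  define q where "q t = p + t *\<^sub>R (x - p)" for t :: real
  have q_in: "q t \<in> closed_segment p x" if "t \<in> {0..1}" for t
    using that unfolding closed_segment_def q_def
    by (auto intro!: exI[of _ t] simp: algebra_simps)
  have seg: "closed_segment p (q t) = q ` {0..t}" if "0 \<le> t" for t
  proof -
    have "closed_segment p (q t) = (\<lambda>u. q (u * t)) ` {0..1}"
      by (auto simp: closed_segment_image_interval q_def algebra_simps)
    also have "\<dots> = q ` ((\<lambda>u. u * t) ` {0..1})" by (simp add: image_image)
    also have "(\<lambda>u. u * t) ` {0..1} = {0..t}"
    proof (intro equalityI subsetI)
      fix v assume "v \<in> {0..t}"
      then show "v \<in> (\<lambda>u. u * t) ` {0..1}"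
        by (cases "t = 0") (auto intro!: image_eqI[of _ _ "v / t"])
    qed (use that in \<open>auto simp: mult_left_le_one_le\<close>)
    finally show ?thesis .
  qed
  \<comment> \<open>\<open>G t\<close> says that the continuation has reached \<open>q t\<close>, on
    a tube around the part of the segment covered so far. The tube is the sum of a convex set and a
    ball, hence convex.\<close>
  define G where "G t \<longleftrightarrow> (\<exists>e>0. \<exists>\<sigma>. (\<Union>s\<in>closed_segment p (q t). ball s e) \<subseteq> V \<and> \<sigma> p = m \<and>
      (\<forall>y \<in> (\<Union>s\<in>closed_segment p (q t). ball s e). g \<sigma> y))" for t
  have nb_sum: "(\<Union>s\<in>K. ball s e) = (\<Union>a\<in>K. \<Union>b\<in>ball 0 e. {a + b})" for K :: "'a set" and e :: real
  proof (intro equalityI subsetI)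
    fix y assume "y \<in> (\<Union>s\<in>K. ball s e)"
    then obtain s where "s \<in> K" "dist s y < e" by auto
    then have "y = s + (y - s)" "y - s \<in> ball 0 e" by (auto simp: dist_norm norm_minus_commute)
    with \<open>s \<in> K\<close> show "y \<in> (\<Union>a\<in>K. \<Union>b\<in>ball 0 e. {a + b})" by blast
  next
    fix y assume "y \<in> (\<Union>a\<in>K. \<Union>b\<in>ball 0 e. {a + b})"
    then obtain a b where "a \<in> K" "norm b < e" "y = a + b" by auto
    then show "y \<in> (\<Union>s\<in>K. ball s e)" by (intro UN_I[of a]) (auto simp: dist_norm)
  qed
  have nb_convex: "convex (\<Union>s\<in>K. ball s e)" if "convex K" for K :: "'a set" and e :: real
    unfolding nb_sum by (rule convex_sums[OF that convex_ball])
  \<comment> \<open>Continuation cannot get stuck at \<open>t0\<close>: the neighbourhood from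
    \<open>sections_through\<close> carries a section through any value over any of its points, so a
    continuation that has reached some \<open>s\<close> shortly before \<open>t0\<close> can be
    prolonged past \<open>t0\<close>.\<close>
  have step: "\<exists>d>0. \<forall>s t. s \<le> t0 \<and> t0 \<le> t \<and> t - s < d \<longrightarrow> (0 \<le> s \<longrightarrow> G s \<longrightarrow> G t)"
    if t0: "0 \<le> t0" "t0 \<le> 1" for t0
  proof -
    have "q t0 \<in> V" using q_in[of t0] t0 V(2) by auto
    then obtain T where T: "open T" "q t0 \<in> T"
      "\<forall>y\<in>T. \<forall>m\<in>stalk y. \<exists>\<sigma>. \<sigma> y = m \<and> (\<forall>z\<in>T. g \<sigma> z)"
      using sections_through[of "q t0"] by metis
    then have "open (T \<inter> V)" "q t0 \<in> T \<inter> V" using \<open>q t0 \<in> V\<close> V(1) by auto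
    then obtain \<delta> where \<delta>: "\<delta> > 0" "ball (q t0) \<delta> \<subseteq> T \<inter> V"
      using openE by metis
    \<comment> \<open>Parameters closer than \<open>d\<close> to \<open>t0\<close> give points
      within \<open>\<delta> / 2\<close> of \<open>q t0\<close>; the added 1 covers the case
      \<open>x = p\<close>.\<close>
    define d where "d = \<delta> / (2 * (norm (x - p) + 1))"
    have np: "norm (x - p) + 1 > 0" using norm_ge_zero[of "x - p"] by linarith
    have near: "dist (q t0) (q t) < \<delta> / 2" if "\<bar>t - t0\<bar> < d" for t
    proof -
      have "dist (q t0) (q t) = \<bar>t - t0\<bar> * norm (x - p)"
      proof -
        have "q t0 - q t = (t0 - t) *\<^sub>R (x - p)" by (simp add: q_def algebra_simps)
        then show ?thesis by (simp only: dist_norm norm_scaleR abs_minus_commute)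
      qed
      also have "\<dots> \<le> \<bar>t - t0\<bar> * (norm (x - p) + 1)" by (simp add: mult_left_mono)
      also have "\<dots> < d * (norm (x - p) + 1)" by (rule mult_strict_right_mono[OF that np])
      also have "\<dots> = \<delta> / 2" using np by (simp add: d_def field_simps)
      finally show ?thesis .
    qed
    have "G t" if st: "s \<le> t0" "t0 \<le> t" "t - s < d" "0 \<le> s" and G: "G s" for s t
    proof -
      obtain e \<sigma> where e: "e > 0" "(\<Union>s\<in>closed_segment p (q s). ball s e) \<subseteq> V" "\<sigma> p = m"
        "\<And>y. y \<in> (\<Union>s\<in>closed_segment p (q s). ball s e) \<Longrightarrow> g \<sigma> y"
        using G unfolding G_def by blast
      let ?S = "\<Union>s\<in>closed_segment p (q s). ball s e" and ?B = "ball (q t0) \<delta>"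
      have qs: "q s \<in> ?S" using e(1) by (auto intro!: bexI[of _ "q s"])
      have qsB: "q s \<in> ?B" using near[of s] st \<delta>(1) by auto
      have "q s \<in> T" using qsB \<delta>(2) by blast
      then obtain \<sigma>' where \<sigma>': "\<sigma>' (q s) = \<sigma> (q s)" "\<And>z. z \<in> T \<Longrightarrow> g \<sigma>' z"
        using T(3) germ_stalk[OF e(4)[OF qs]] by metis
      obtain \<rho> where \<rho>: "\<And>x. x \<in> ?S \<Longrightarrow> \<rho> x = \<sigma> x" "\<And>x. x \<in> ?S \<union> ?B \<Longrightarrow> g \<rho> x"
      proof (rule extend_section[of ?S ?B "q s" \<sigma> \<sigma>'])
        show "connected (?S \<inter> ?B)"
          by (intro convex_connected convex_Int nb_convex) auto
      qed (use e \<sigma>' qs qsB \<delta>(2) in auto)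
      \<comment> \<open>Up to \<open>q s\<close> the old tube of radius \<open>e\<close> is kept.
        Later points are within \<open>\<delta> / 2\<close> of \<open>q t0\<close>, so balls of
        radius \<open>\<delta> / 2\<close> about them remain in \<open>?B\<close>.\<close>
      define e' where "e' = min e (\<delta> / 2)"
      have sub: "(\<Union>s\<in>closed_segment p (q t). ball s e') \<subseteq> ?S \<union> ?B"
      proof safe
        fix y u assume "u \<in> closed_segment p (q t)" and y: "y \<in> ball u e'" and "y \<notin> ?B"
        then obtain v where v: "u = q v" "0 \<le> v" "v \<le> t" using seg[of t] st by auto
        have "v \<le> s"
        proof (rule ccontr)
          assume "\<not> v \<le> s"
          then have "dist (q t0) (q v) < \<delta> / 2" using near[of v] st v by auto
          moreover have "dist (q v) y < \<delta> / 2" using y by (simp add: e'_def v)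
          ultimately have "dist (q t0) y < \<delta>" using dist_triangle[of "q t0" y "q v"] by auto
          then show False using \<open>y \<notin> ?B\<close> by auto
        qed
        then have "u \<in> closed_segment p (q s)" using v st seg[of s] by auto
        then show "y \<in> ?S" using y by (auto simp: e'_def)
      qed
      have "p \<in> ?S" using e(1) by (auto intro!: bexI[of _ p])
      then have "\<rho> p = m" using \<rho>(1) e(3) by auto
      moreover have "?S \<union> ?B \<subseteq> V" using e(2) \<delta>(2) by blast
      moreover have "e' > 0" using e(1) \<delta>(1) by (simp add: e'_def)
      ultimately show "G t"
        unfolding G_def using sub \<rho>(2) by (intro exI[of _ e'] conjI exI[of _ \<rho>]) blast+
    qed
    moreover have "d > 0" using \<delta>(1) np by (simp add: d_def)
    ultimately show ?thesis by blast
  qed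
  have "G 0"
  proof -
    have "p \<in> V" using V(2) by auto
    then obtain T where T: "open T" "p \<in> T"
      "\<forall>y\<in>T. \<forall>m\<in>stalk y. \<exists>\<sigma>. \<sigma> y = m \<and> (\<forall>z\<in>T. g \<sigma> z)"
      using sections_through[of "p"] by metis
    then have "open (T \<inter> V)" "p \<in> T \<inter> V" using \<open>p \<in> V\<close> V(1) by auto
    then obtain \<delta> where \<delta>: "\<delta> > 0" "ball p \<delta> \<subseteq> T \<inter> V" using openE by metis
    obtain \<sigma> where "\<sigma> p = m" "\<And>z. z \<in> T \<Longrightarrow> g \<sigma> z" using T(2,3) m by metis
    then show ?thesis
      unfolding G_def using \<delta> by (intro exI[of _ \<delta>] exI[of _ \<sigma>]) (auto simp: q_def)
  qed
  \<comment> \<open>Bisection: a transitive relation between endpoints that holds for all short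
    intervals around every point holds for [0, 1]. The relation is the implication from
    \<open>G s\<close> to \<open>G t\<close>.\<close>
  moreover have "0 \<le> (0::real) \<longrightarrow> G 0 \<longrightarrow> G 1"
    by (rule Bolzano[of 0 1 "\<lambda>s t. 0 \<le> s \<longrightarrow> G s \<longrightarrow> G t"]) (use step in auto)
  ultimately have "G 1" by simp
  moreover have "q 1 = x" by (simp add: q_def)
  ultimately obtain e \<sigma> where e: "e > 0" "(\<Union>s\<in>closed_segment p x. ball s e) \<subseteq> V" "\<sigma> p = m"
    "\<And>y. y \<in> (\<Union>s\<in>closed_segment p x. ball s e) \<Longrightarrow> g \<sigma> y"
    unfolding G_def by metis
  show ?thesis
  proof (rule that[of "\<Union>s\<in>closed_segment p x. ball s e" \<sigma>])
    show "closed_segment p x \<subseteq> (\<Union>s\<in>closed_segment p x. ball s e)"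
      using e(1) by auto
  qed (use e in \<open>auto intro: nb_convex\<close>)
qed

lemma restrict:
  assumes "V' \<subseteq> V"
  shows "locally_constant_sheaf V' stalk g"
proof
  show "g \<sigma>' x" if "g \<sigma> x" "\<forall>\<^sub>F y in nhds x. \<sigma>' y = \<sigma> y" for \<sigma> \<sigma>' x
    using that by (rule germ_cong)
  show "\<forall>\<^sub>F y in nhds x. (\<sigma> y = \<sigma>' y) = (\<sigma> x = \<sigma>' x)" if "x \<in> V'" "g \<sigma> x" "g \<sigma>' x" for \<sigma> \<sigma>' x
    using germ_unique[OF _ that(2,3)] that(1) assms by blast
  show "\<exists>T. open T \<and> x \<in> T \<and> (\<forall>y\<in>T. \<forall>m\<in>stalk y. \<exists>\<sigma>. \<sigma> y = m \<and> (\<forall>z\<in>T. g \<sigma> z))"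
    if "x \<in> V'" for x
    using sections_through that assms by blast
  show "\<sigma> x \<in> stalk x" if "g \<sigma> x" for \<sigma> x
    using that by (rule germ_stalk)
qed

text \<open>Continue along every segment from \<open>p\<close> and take the value at its far end.
  Continuations belonging to neighbouring segments agree, since their domains meet in a convex set
  that contains \<open>p\<close>, where both take the value \<open>m\<close>.\<close>

lemma section_on_starlike:
  assumes V': "open V'" "V' \<subseteq> V" and p: "\<And>x. x \<in> V' \<Longrightarrow> closed_segment p x \<subseteq> V'" and m: "m \<in> stalk p"
  obtains \<sigma> where "\<sigma> p = m" "\<And>x. x \<in> V' \<Longrightarrow> g \<sigma> x"
proof -
  have "\<exists>S \<sigma>. open S \<and> convex S \<and> S \<subseteq> V' \<and> closed_segment p x \<subseteq> S \<and> \<sigma> p = m \<and> (\<forall>y\<in>S. g \<sigma> y)"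
    if "x \<in> V'" for x
  proof -
    interpret V': locally_constant_sheaf V' stalk g using V'(2) by (rule restrict)
    show ?thesis
      using V'.section_along_segment[OF V'(1) p[OF that] m] by metis
  qed
  then obtain S \<sigma> where S: "\<And>x. x \<in> V' \<Longrightarrow> open (S x) \<and> convex (S x) \<and> S x \<subseteq> V' \<and>
      closed_segment p x \<subseteq> S x \<and> \<sigma> x p = m \<and> (\<forall>y\<in>S x. g (\<sigma> x) y)"
    by metis
  \<comment> \<open>The case \<open>x = p\<close> secures the value at \<open>p\<close> even for
    empty \<open>V'\<close>.\<close>
  define \<rho> where "\<rho> x = (if x = p then m else \<sigma> x x)" for x
  have eq: "\<rho> y = \<sigma> x y" if x: "x \<in> V'" and y: "y \<in> S x" for x y
  proof -
    have "y \<in> V'" using S[OF x] y by auto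
    have "closed_segment p y \<subseteq> S x"
      using S[OF x] y by (meson closed_segment_subset ends_in_segment(1) subsetD)
    then have "\<sigma> y y = \<sigma> x y"
    proof (intro sections_eq_on_connected[of "S x \<inter> S y" "\<sigma> y" "\<sigma> x" p y])
      show "connected (S x \<inter> S y)"
        using S[OF x] S[OF \<open>y \<in> V'\<close>] by (intro convex_connected convex_Int) auto
    qed (use S[OF x] S[OF \<open>y \<in> V'\<close>] V' in auto)
    then show ?thesis using S[OF x] by (simp add: \<rho>_def)
  qed
  show ?thesis
  proof (rule that[of \<rho>])
    show "\<rho> p = m" by (simp add: \<rho>_def)
    show "g \<rho> x" if "x \<in> V'" for x
    proof -
      have "x \<in> S x" "open (S x)" using S[OF that] by auto
      have "\<forall>\<^sub>F y in nhds x. \<rho> y = \<sigma> x y"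
        using eventually_nhds_in_open[OF \<open>open (S x)\<close> \<open>x \<in> S x\<close>] eq[OF that]
        by (rule eventually_mono)
      then show ?thesis using germ_cong S[OF that] \<open>x \<in> S x\<close> by blast
    qed
  qed
qed

text \<open>The section over \<open>V1\<close> prescribes a value at \<open>q\<close>. To obtain a
  matching section over \<open>V2\<close>, this value is first carried from \<open>q\<close> to the
  centre \<open>p2\<close> along a segment in \<open>V2\<close> and then spread over
  \<open>V2\<close> from there. Connectedness of the intersection excludes holonomy.\<close>

lemma section_on_union:
  assumes V1: "open V1" "V1 \<subseteq> V" "\<And>x. x \<in> V1 \<Longrightarrow> closed_segment p1 x \<subseteq> V1"
    and V2: "open V2" "V2 \<subseteq> V" "\<And>x. x \<in> V2 \<Longrightarrow> closed_segment p2 x \<subseteq> V2"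
    and V12: "connected (V1 \<inter> V2)" "q \<in> V1 \<inter> V2" and m: "m \<in> stalk p1"
  obtains \<sigma> where "\<And>x. x \<in> V1 \<union> V2 \<Longrightarrow> g \<sigma> x"
proof -
  obtain \<sigma>1 where 1: "\<And>x. x \<in> V1 \<Longrightarrow> g \<sigma>1 x"
    using section_on_starlike[OF V1 m] by blast
  have "\<sigma>1 q \<in> stalk q" using 1 V12 germ_stalk by auto
  interpret V2: locally_constant_sheaf V2 stalk g using V2(2) by (rule restrict)
  have seg: "closed_segment q p2 \<subseteq> V2" using V2(3)[of q] V12(2) by (simp add: closed_segment_commute)
  obtain S \<sigma> where S: "open S" "convex S" "S \<subseteq> V2" "closed_segment q p2 \<subseteq> S" "\<sigma> q = \<sigma>1 q"
    "\<And>y. y \<in> S \<Longrightarrow> g \<sigma> y"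
    using V2.section_along_segment[OF V2(1) seg \<open>\<sigma>1 q \<in> stalk q\<close>] by metis
  have "p2 \<in> S" "q \<in> S" using S(4) by auto
  obtain \<sigma>2 where 2: "\<sigma>2 p2 = \<sigma> p2" "\<And>x. x \<in> V2 \<Longrightarrow> g \<sigma>2 x"
    using section_on_starlike[OF V2 germ_stalk[OF S(6)[OF \<open>p2 \<in> S\<close>]]] by blast
  have "\<sigma>2 q = \<sigma> q"
    by (rule V2.sections_eq_on_connected[of S \<sigma>2 \<sigma> p2 q])
      (use 2 S \<open>p2 \<in> S\<close> \<open>q \<in> S\<close> in \<open>auto simp: convex_connected\<close>)
  then have "\<sigma>1 q = \<sigma>2 q" using S(5) by simp
  show ?thesis
  proof (rule extend_section[of V1 V2 q \<sigma>1 \<sigma>2])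
    fix \<rho> assume "\<And>x. x \<in> V1 \<union> V2 \<Longrightarrow> g \<rho> x"
    then show ?thesis by (rule that)
  qed (use V1 V2 V12 1 2 \<open>\<sigma>1 q = \<sigma>2 q\<close> in auto)
qed

end

section \<open>The Eguchi-Hanson line element\<close>

text \<open>
  In these definitions \<open>(z, w)\<close> is a point of the unit sphere and \<open>(dz, dw)\<close> a tangent vector;
  \<open>hopf_s = - \<sigma>\<^sub>3\<close> and \<open>\<bar>hopf_\<beta>\<bar>^2 = \<sigma>\<^sub>1^2 + \<sigma>\<^sub>2^2\<close>. The circle acting by
  \<open>(exp (i\<psi>/4) z, exp (-i\<psi>/4) w)\<close> preserves the Eguchi-Hanson metric, and \<open>eh_conn\<close> is its
  connection form, with \<open>f\<close> standing for \<open>1 - a\<^sup>4/r\<^sup>4\<close>.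
\<close>

definition hopf_s :: "complex \<Rightarrow> complex \<Rightarrow> complex \<Rightarrow> complex \<Rightarrow> real" where
  "hopf_s z w dz dw = Im (cnj z * dz + cnj w * dw)"

definition hopf_\<beta> :: "complex \<Rightarrow> complex \<Rightarrow> complex \<Rightarrow> complex \<Rightarrow> complex" where
  "hopf_\<beta> z w dz dw = z * dw - w * dz"

definition eh_conn :: "real \<Rightarrow> complex \<Rightarrow> complex \<Rightarrow> complex \<Rightarrow> complex \<Rightarrow> real" where
  "eh_conn f z w dz dw =
     (let C = (cmod z)^2 - (cmod w)^2
      in 4 * (f * hopf_s z w dz dw * C - Im (cnj (2 * z * w) * hopf_\<beta> z w dz dw))
           / (1 - C^2 + f * C^2))"

definition eh_line :: "real \<Rightarrow> real \<Rightarrow> complex \<Rightarrow> complex \<Rightarrow> real \<Rightarrow> complex \<Rightarrow> complex \<Rightarrow> real" where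
  "eh_line a r z w dr dz dw = inverse (1 - a^4 / r^4) * dr^2
     + r^2 * ((cmod (hopf_\<beta> z w dz dw))^2 + (1 - a^4 / r^4) * (hopf_s z w dz dw)^2)"

text \<open>Exchanging the two coordinates reverses the circle action. This will turn the section
  with real \<open>z\<close> into one with real \<open>w\<close>.\<close>

lemma eh_conn_swap: "eh_conn f w z dw dz = - eh_conn f z w dz dw"
proof -
  define C where "C = (cmod z)^2 - (cmod w)^2"
  define s where "s = hopf_s z w dz dw"
  define n where "n = Im (cnj (2 * z * w) * hopf_\<beta> z w dz dw)"
  have "hopf_s w z dw dz = s" by (simp add: s_def hopf_s_def)
  moreover have "Im (cnj (2 * w * z) * hopf_\<beta> w z dw dz) = - n"
    by (simp add: n_def hopf_\<beta>_def algebra_simps)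
  moreover have "(cmod w)^2 - (cmod z)^2 = - C" by (simp add: C_def)
  moreover have "4 * (f * s * - C - - n) / (1 - (- C)^2 + f * (- C)^2)
      = - (4 * (f * s * C - n) / (1 - C^2 + f * C^2))"
    by (simp add: minus_divide_left[symmetric] del: minus_divide_left) (simp add: algebra_simps minus_divide_left)
  ultimately show ?thesis
    by (simp only: eh_conn_def Let_def C_def[symmetric] s_def[symmetric] n_def[symmetric])
qed

text \<open>The Hopf map takes the unit sphere of the complex plane squared to the unit sphere of
  space.\<close>

lemma hopf_norm_identity:
  assumes "(cmod z)^2 + (cmod w)^2 = 1"
  shows "(cmod (2 * z * w))^2 = 1 - ((cmod z)^2 - (cmod w)^2)^2"
proof -
  have "(cmod (2 * z * w))^2 = 4 * (cmod z)^2 * (cmod w)^2" 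
    by (simp add: norm_mult power_mult_distrib)
  then show ?thesis using assms by algebra
qed

text \<open>A convex combination of 1 and \<open>f\<close> with weight \<open>C^2\<close>.\<close>

lemma eh_conn_denominator_pos:
  fixes f C :: real
  assumes "0 < f" "C^2 \<le> 1"
  shows "0 < 1 - C^2 + f * C^2"
proof (cases "C = 0")
  case False
  then show ?thesis using assms by (smt (verit) mult_pos_pos zero_less_power2)
qed simp

text \<open>The two properties of a connection form at once: invariance under the rotation
  \<open>\<zeta>\<close> and the normalisation on the orbits, \<open>\<mu>\<close> being a quarter
  of the speed of \<open>\<psi>\<close>. The vertical velocity changes \<open>hopf_s\<close> by
  \<open>\<mu> C\<close> and the imaginary part by \<open>- \<mu> (1 - C^2)\<close>, which adds
  \<open>4 \<mu>\<close> times the denominator to the numerator.\<close>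

lemma eh_conn_rotate:
  fixes z w dz dw \<zeta> :: complex and \<mu> f :: real
  assumes zw: "(cmod z)^2 + (cmod w)^2 = 1" and f: "0 < f" and \<zeta>: "cmod \<zeta> = 1"
  shows "eh_conn f (\<zeta> * z) (cnj \<zeta> * w) (\<zeta> * (dz + \<i> * \<mu> * z)) (cnj \<zeta> * (dw - \<i> * \<mu> * w))
    = eh_conn f z w dz dw + 4 * \<mu>"
proof -
  define C where "C = (cmod z)^2 - (cmod w)^2"
  have \<zeta>1: "\<zeta> * cnj \<zeta> = 1" using \<zeta> complex_norm_square[of \<zeta>] by simp
  have s: "hopf_s (\<zeta> * z) (cnj \<zeta> * w) (\<zeta> * (dz + \<i> * \<mu> * z)) (cnj \<zeta> * (dw - \<i> * \<mu> * w))
      = hopf_s z w dz dw + \<mu> * C"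
  proof -
    have "cnj (\<zeta> * z) * (\<zeta> * (dz + \<i> * \<mu> * z)) + cnj (cnj \<zeta> * w) * (cnj \<zeta> * (dw - \<i> * \<mu> * w))
      = (\<zeta> * cnj \<zeta>) * (cnj z * dz + cnj w * dw + \<i> * \<mu> * (z * cnj z - w * cnj w))"
      by (simp add: algebra_simps)
    also have "\<dots> = cnj z * dz + cnj w * dw + \<i> * of_real (\<mu> * C)"
      by (simp only: \<zeta>1 C_def of_real_mult of_real_diff complex_norm_square) (simp add: algebra_simps)
    finally show ?thesis unfolding hopf_s_def by simp
  qed
  have \<beta>: "hopf_\<beta> (\<zeta> * z) (cnj \<zeta> * w) (\<zeta> * (dz + \<i> * \<mu> * z)) (cnj \<zeta> * (dw - \<i> * \<mu> * w))
      = hopf_\<beta> z w dz dw - \<i> * \<mu> * (2 * z * w)"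
  proof -
    have "\<zeta> * z * (cnj \<zeta> * (dw - \<i> * \<mu> * w)) - cnj \<zeta> * w * (\<zeta> * (dz + \<i> * \<mu> * z))
       = (\<zeta> * cnj \<zeta>) * (z * dw - w * dz - \<i> * \<mu> * (2 * z * w))"
      by (simp add: algebra_simps)
    then show ?thesis by (simp add: \<zeta>1 hopf_\<beta>_def)
  qed
  have p: "2 * (\<zeta> * z) * (cnj \<zeta> * w) = 2 * z * w"
  proof -
    have "2 * (\<zeta> * z) * (cnj \<zeta> * w) = (\<zeta> * cnj \<zeta>) * (2 * z * w)" by (simp add: algebra_simps)
    then show ?thesis by (simp add: \<zeta>1)
  qed
  have n: "Im (cnj (2 * z * w) * (hopf_\<beta> z w dz dw - \<i> * \<mu> * (2 * z * w)))
     = Im (cnj (2 * z * w) * hopf_\<beta> z w dz dw) - \<mu> * (1 - C^2)"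
  proof -
    have "cnj (2 * z * w) * (hopf_\<beta> z w dz dw - \<i> * \<mu> * (2 * z * w))
      = cnj (2 * z * w) * hopf_\<beta> z w dz dw - \<i> * \<mu> * (2 * z * w * cnj (2 * z * w))"
      by (simp add: algebra_simps)
    also have "2 * z * w * cnj (2 * z * w) = of_real (1 - C^2)"
      unfolding C_def hopf_norm_identity[OF zw, symmetric] complex_norm_square by simp
    finally show ?thesis by simp
  qed
  have C: "(cmod (\<zeta> * z))^2 - (cmod (cnj \<zeta> * w))^2 = C"
    by (simp add: norm_mult \<zeta> C_def)
  have "C^2 \<le> 1"
    using hopf_norm_identity[OF zw] unfolding C_def[symmetric] by (smt (verit) zero_le_power2)
  then have "1 - C^2 + f * C^2 \<noteq> 0" using eh_conn_denominator_pos[OF f] by (smt (verit))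
  then show ?thesis
    unfolding eh_conn_def Let_def s \<beta> p n C C_def[symmetric]
    by (simp add: field_simps power2_eq_square)
qed

text \<open>The algebraic core: on the left 8c/a^2 times the Eguchi-Hanson line element, on the
  right the ansatz with \<open>V = 2\<rho>/D\<close>. Here \<open>m\<close> and \<open>n\<close> are
  to be the real and imaginary part of the product of \<open>hopf_\<beta>\<close> with the conjugate
  of 2zw, and \<open>b\<close> the squared modulus of \<open>hopf_\<beta>\<close>. The terms linear
  in \<open>d\<rho>\<close> cancel on the right, leaving a pure \<open>d\<rho>^2\<close> part and an
  identity on the sphere.\<close>

lemma eh_line_real_identity:
  fixes \<rho> c C s m n b d\<rho> K D :: real
  assumes K: "K = \<rho>^2 - c^2" "0 < K" and \<rho>: "0 < \<rho>" and D: "D = \<rho>^2 - c^2 * C^2" "0 < D"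
    and mn: "m^2 + n^2 = (1 - C^2) * b"
  shows "2 * \<rho> * d\<rho>^2 / K + 8 * \<rho> * (b + K * s^2 / \<rho>^2) =
    D / (2 * \<rho>) * (4 * (K * s * C - \<rho>^2 * n) / D)^2
    + 2 * \<rho> / D * (\<rho>^2 * d\<rho>^2 / K * (1 - C^2) + 4 * \<rho> * d\<rho> * C * m
       + 4 * K * (s^2 * (1 - C^2) + 2 * s * C * n + C^2 * b) + (d\<rho> * C - 2 * \<rho> * m)^2)"
    (is "_ = ?A + 2 * \<rho> / D * ?B")
proof -
  have "K * ?B = d\<rho>^2 * (\<rho>^2 * (1 - C^2) + K * C^2)
      + 4 * K * (K * (s^2 * (1 - C^2) + 2 * s * C * n + C^2 * b) + \<rho>^2 * m^2)"
    using K(2) by (simp add: field_simps power2_eq_square)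
  also have "\<rho>^2 * (1 - C^2) + K * C^2 = D" by (simp add: K D algebra_simps)
  finally have B: "?B = d\<rho>^2 * D / K
      + 4 * (K * (s^2 * (1 - C^2) + 2 * s * C * n + C^2 * b) + \<rho>^2 * m^2)"
    by (subst nonzero_mult_div_cancel_left[symmetric, of K ?B]) (use K(2) in \<open>simp_all add: add_divide_distrib\<close>)
  have A: "?A = 8 * (K * s * C - \<rho>^2 * n)^2 / (\<rho> * D)"
    using D(2) \<rho> by (simp add: field_simps power2_eq_square)
  \<comment> \<open>The terms in \<open>s * n\<close> cancel. The factor
    \<open>D = K C^2 + \<rho>^2 (1 - C^2)\<close> then appears in the coefficient of
    \<open>s^2\<close> directly and in that of \<open>b\<close> after replacing
    \<open>m^2 + n^2\<close>.\<close>
  have key: "\<rho>^2 * (K * (s^2 * (1 - C^2) + 2 * s * C * n + C^2 * b) + \<rho>^2 * m^2)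
      + (K * s * C - \<rho>^2 * n)^2 = D * (K * s^2 + \<rho>^2 * b)"
    using mn K(1) D(1) by algebra
  have "2 * \<rho> / D * ?B + ?A = 2 * \<rho> * d\<rho>^2 / K
     + 8 / (\<rho> * D) * (\<rho>^2 * (K * (s^2 * (1 - C^2) + 2 * s * C * n + C^2 * b) + \<rho>^2 * m^2)
      + (K * s * C - \<rho>^2 * n)^2)"
    unfolding A B using D(2) \<rho> by (simp add: field_simps power2_eq_square)
  also have "\<dots> = 2 * \<rho> * d\<rho>^2 / K + 8 * (K * s^2 + \<rho>^2 * b) / \<rho>"
    unfolding key using D(2) by simp
  also have "\<dots> = 2 * \<rho> * d\<rho>^2 / K + 8 * \<rho> * (b + K * s^2 / \<rho>^2)"
    using \<rho> by (simp add: field_simps power2_eq_square)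
  finally show ?thesis by simp
qed

text \<open>Pointwise form of the comparison of metrics. All \<open>d\<close>-quantities are numbers
  related by the differentials of the defining equations; \<open>dP\<close> and \<open>dZ\<close>
  are those of \<open>P = \<kappa> * 2zw\<close> and \<open>Z = \<rho> C\<close>, so that the last
  bracket is the Euclidean line element of the base.\<close>

lemma eh_line_eq_gibbons_hawking:
  fixes z w dz dw dP :: complex and a c \<rho> d\<rho> \<kappa> d\<kappa> r dr dZ C :: real
  assumes zw: "(cmod z)^2 + (cmod w)^2 = 1" and dzw: "Re (cnj z * dz + cnj w * dw) = 0"
    and c: "0 < c" "0 < a" "c < \<rho>" and \<kappa>: "\<kappa>^2 = \<rho>^2 - c^2" "\<kappa> * d\<kappa> = \<rho> * d\<rho>"
    and r: "0 < r" "r^2 = a^2 * \<rho> / c" "2 * r * dr = a^2 * d\<rho> / c"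
    and C: "C = (cmod z)^2 - (cmod w)^2"
    and dP: "dP = of_real d\<kappa> * (2 * z * w) + of_real \<kappa> * (2 * (z * dw + w * dz))"
    and dZ: "dZ = d\<rho> * C + \<rho> * (2 * Re (cnj z * dz - cnj w * dw))"
  shows "eh_line a r z w dr dz dw = a^2 / (8 * c) *
    (inverse (2 * \<rho> / (\<rho>^2 - c^2 * C^2)) * (eh_conn (1 - a^4 / r^4) z w dz dw)^2
      + 2 * \<rho> / (\<rho>^2 - c^2 * C^2) * ((cmod dP)^2 + dZ^2))"
proof -
  define p where "p = 2 * z * w"
  define \<beta> where "\<beta> = hopf_\<beta> z w dz dw"
  define s where "s = hopf_s z w dz dw"
  define m where "m = Re (cnj p * \<beta>)"
  define n where "n = Im (cnj p * \<beta>)"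
  define b where "b = (cmod \<beta>)^2"
  define K where "K = \<rho>^2 - c^2"
  define D where "D = \<rho>^2 - c^2 * C^2"
  have \<rho>: "0 < \<rho>" using c by linarith
  have K0: "0 < K" unfolding K_def using c by (simp add: power_strict_mono)
  have pp: "(cmod p)^2 = 1 - C^2" unfolding p_def C by (rule hopf_norm_identity[OF zw])
  then have C1: "C^2 \<le> 1" by (smt (verit) zero_le_power2)
  have D0: "0 < D"
  proof -
    have "c^2 * C^2 \<le> c^2" using C1 by (simp add: mult_left_le)
    then show ?thesis using K0 by (simp add: D_def K_def)
  qed
  have f: "1 - a^4 / r^4 = K / \<rho>^2"
  proof -
    have "r^4 = (a^2 * \<rho> / c)^2" unfolding r(2)[symmetric] by simp
    then have "a^4 / r^4 = c^2 / \<rho>^2"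
      using c \<rho> by (simp add: power_divide power_mult_distrib)
    then show ?thesis using \<rho> by (simp add: K_def diff_divide_distrib)
  qed
  have mn: "m^2 + n^2 = (1 - C^2) * b"
    unfolding m_def n_def b_def pp[symmetric] cmod_power2[symmetric] by (simp add: norm_mult power_mult_distrib)
  have zz: "z * cnj z + w * cnj w = 1"
    using zw by (metis complex_norm_square of_real_1 of_real_add)
  have CC: "complex_of_real C = z * cnj z - w * cnj w"
    unfolding C of_real_diff complex_norm_square ..
  have \<alpha>: "cnj z * dz + cnj w * dw = \<i> * s"
    using dzw by (simp add: complex_eq_iff s_def hopf_s_def)
  \<comment> \<open>Inserting the factor \<open>z * cnj z + w * cnj w = 1\<close> expresses the
    differential of the Hopf map, here and in \<open>dC\<close>, through the coframe
    \<open>s\<close>, \<open>\<beta>\<close> of the sphere.\<close>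
  have dp: "2 * (z * dw + w * dz) = 2 * \<i> * s * p + 2 * C * \<beta>"
  proof -
    have "(z * cnj z + w * cnj w) * (2 * (z * dw + w * dz))
        = 2 * (cnj z * dz + cnj w * dw) * p + 2 * (z * cnj z - w * cnj w) * \<beta>"
      by (simp add: p_def \<beta>_def hopf_\<beta>_def algebra_simps)
    then show ?thesis by (simp add: zz \<alpha> CC)
  qed
  have dC: "Re (cnj z * dz - cnj w * dw) = - m"
  proof -
    have "(z * cnj z + w * cnj w) * (cnj z * dz - cnj w * dw)
        = (z * cnj z - w * cnj w) * (cnj z * dz + cnj w * dw) - cnj p * \<beta>"
      by (simp add: p_def \<beta>_def hopf_\<beta>_def algebra_simps)
    then have "cnj z * dz - cnj w * dw = C * (\<i> * s) - cnj p * \<beta>" by (simp add: zz \<alpha> CC)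
    then show ?thesis by (simp add: m_def)
  qed
  have dP2: "(cmod dP)^2 = d\<kappa>^2 * (1 - C^2) + 4 * \<kappa> * d\<kappa> * C * m
      + 4 * \<kappa>^2 * (s^2 * (1 - C^2) + 2 * s * C * n + C^2 * b)"
  proof -
    have "dP = d\<kappa> * p + \<kappa> * (2 * \<i> * s * p + 2 * C * \<beta>)"
      unfolding dP dp p_def by (simp add: algebra_simps)
    then show ?thesis
      unfolding pp[symmetric] b_def m_def n_def cmod_power2
      by (simp add: algebra_simps power2_eq_square)
  qed
  have \<kappa>0: "\<kappa> \<noteq> 0" using \<kappa> K0 by (auto simp: K_def)
  have d\<kappa>2: "d\<kappa>^2 = \<rho>^2 * d\<rho>^2 / K"
  proof -
    have "\<kappa>^2 * d\<kappa>^2 = \<rho>^2 * d\<rho>^2" using \<kappa>(2) by (metis power_mult_distrib)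
    then show ?thesis using \<kappa>(1) K0 by (simp add: K_def field_simps)
  qed
  have dr2: "dr^2 = a^2 * d\<rho>^2 / (4 * c * \<rho>)"
  proof -
    have "4 * r^2 * dr^2 = (a^2 * d\<rho> / c)^2" using r(3) by (metis power_mult_distrib power2_eq_square mult_2 numeral_Bit0 mult.assoc four_x_squared)
    then show ?thesis unfolding r(2) using c \<rho> by (simp add: field_simps power2_eq_square)
  qed
  have conn: "eh_conn (K / \<rho>^2) z w dz dw = 4 * (K * s * C - \<rho>^2 * n) / D"
  proof -
    have "1 - C^2 + K / \<rho>^2 * C^2 = D / \<rho>^2"
      using \<rho> by (simp add: K_def D_def field_simps)
    moreover have "4 * (K / \<rho>^2 * s * C - n) = 4 * (K * s * C - \<rho>^2 * n) / \<rho>^2"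
      using \<rho> by (simp add: field_simps)
    ultimately show ?thesis
      unfolding eh_conn_def Let_def C[symmetric] s_def[symmetric] p_def[symmetric] \<beta>_def[symmetric]
        n_def[symmetric] using \<rho> by simp
  qed
  have "eh_line a r z w dr dz dw = inverse (K / \<rho>^2) * (a^2 * d\<rho>^2 / (4 * c * \<rho>))
      + a^2 * \<rho> / c * (b + K / \<rho>^2 * s^2)"
    unfolding eh_line_def f dr2 r(2) b_def \<beta>_def s_def ..
  also have "\<dots> = a^2 / (8 * c) * (2 * \<rho> * d\<rho>^2 / K + 8 * \<rho> * (b + K * s^2 / \<rho>^2))"
    using c \<rho> K0 by (simp add: field_simps power2_eq_square)
  also have "2 * \<rho> * d\<rho>^2 / K + 8 * \<rho> * (b + K * s^2 / \<rho>^2) =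
      D / (2 * \<rho>) * (4 * (K * s * C - \<rho>^2 * n) / D)^2
      + 2 * \<rho> / D * (\<rho>^2 * d\<rho>^2 / K * (1 - C^2) + 4 * \<rho> * d\<rho> * C * m
       + 4 * K * (s^2 * (1 - C^2) + 2 * s * C * n + C^2 * b) + (d\<rho> * C - 2 * \<rho> * m)^2)"
    by (rule eh_line_real_identity[OF K_def K0 \<rho> D_def D0 mn])
  also have "\<dots> = inverse (2 * \<rho> / D) * (eh_conn (1 - a^4 / r^4) z w dz dw)^2
      + 2 * \<rho> / D * ((cmod dP)^2 + dZ^2)"
    unfolding dP2 dZ dC f conn \<kappa>(2)[unfolded mult.commute[of \<kappa>]] 
    using \<kappa>(1) by (simp add: d\<kappa>2 K_def[symmetric] \<kappa>(2) mult.assoc mult.left_commute)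
  finally show ?thesis unfolding D_def .
qed

text \<open>The section of the Hopf map with \<open>z\<close> real and positive, available away from
  the point \<open>C = - 1\<close>. The second velocity is the differential of
  \<open>p / (2 t)\<close>. The terms with \<open>dt\<close> are real in both imaginary parts, so
  only the angular velocity of \<open>p\<close> survives.\<close>

lemma eh_conn_real_section:
  fixes p dp :: complex and t dt C f :: real
  assumes t: "0 < t" "t^2 = (1 + C) / 2" and p: "(cmod p)^2 = 1 - C^2"
  defines "z \<equiv> complex_of_real t" and "w \<equiv> p / (2 * of_real t)"
  shows "(cmod z)^2 + (cmod w)^2 = 1" and "(cmod z)^2 - (cmod w)^2 = C" and "2 * z * w = p"
    and "eh_conn f z w (of_real dt) (dp / (2 * of_real t) - p * of_real dt / (2 * of_real (t^2)))
      = 2 * Im (cnj p * dp) * (f * C / (1 + C) - 1) / (1 - C^2 + f * C^2)"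
proof -
  have C: "0 < 1 + C" using t by (metis half_gt_zero_iff zero_less_power)
  have "(cmod w)^2 = (1 - C^2) / (4 * t^2)"
    using t(1) p by (simp add: w_def norm_divide norm_mult power_divide power_mult_distrib)
  also have "\<dots> = (1 - C) / 2"
    unfolding t(2) using C by (simp add: field_simps power2_eq_square)
  finally have w: "(cmod w)^2 = (1 - C) / 2" .
  have z: "(cmod z)^2 = (1 + C) / 2" by (simp add: z_def t(2)[symmetric])
  show "(cmod z)^2 + (cmod w)^2 = 1" and CC: "(cmod z)^2 - (cmod w)^2 = C"
    unfolding z w by (simp_all add: field_simps)
  show zw: "2 * z * w = p" using t(1) by (simp add: z_def w_def)
  let ?dw = "dp / (2 * of_real t) - p * of_real dt / (2 * of_real (t^2))"
  have "cnj w * ?dw = cnj p * dp / of_real (4 * t^2) - (cnj p * p) * of_real (dt / (4 * t^3))"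
    using t(1) by (simp add: w_def field_simps power2_eq_square power3_eq_cube)
  also have "cnj p * p = of_real (1 - C^2)" unfolding p[symmetric] complex_norm_square by simp
  finally have "Im (cnj w * ?dw) = Im (cnj p * dp) / (4 * t^2)"
    by (simp only: minus_complex.simps Im_divide_of_real of_real_mult[symmetric] Im_complex_of_real diff_zero)
  then have s: "hopf_s z w (of_real dt) ?dw = Im (cnj p * dp) / (2 * (1 + C))"
  proof -
    have "4 * t^2 = 2 * (1 + C)" by (simp add: t(2))
    moreover have "hopf_s z w (of_real dt) ?dw = Im (cnj w * ?dw)" by (simp add: hopf_s_def z_def)
    ultimately show ?thesis
      using \<open>Im (cnj w * ?dw) = Im (cnj p * dp) / (4 * t^2)\<close> by (simp only:)
  qed
  have "cnj p * hopf_\<beta> z w (of_real dt) ?dw = cnj p * dp / 2 - (cnj p * p) * of_real (dt / t)"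
    using t(1) by (simp add: hopf_\<beta>_def z_def w_def field_simps power2_eq_square)
  also have "cnj p * p = of_real (1 - C^2)" unfolding p[symmetric] complex_norm_square by simp
  finally have n: "Im (cnj p * hopf_\<beta> z w (of_real dt) ?dw) = Im (cnj p * dp) / 2"
    by (simp only: minus_complex.simps Im_divide_numeral of_real_mult[symmetric] Im_complex_of_real diff_zero)
  show "eh_conn f z w (of_real dt) ?dw
      = 2 * Im (cnj p * dp) * (f * C / (1 + C) - 1) / (1 - C^2 + f * C^2)"
    unfolding eh_conn_def Let_def CC zw s n using C
    by (intro arg_cong2[where f = "(/)"]) (simp_all add: field_simps)
qed

text \<open>Fibres of the Hopf map are circle orbits. The rotation is written as a polynomial in the
  coordinates and their conjugates instead of a quotient \<open>z' / z\<close>, so that it stays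
  smooth where \<open>z\<close> or \<open>w\<close> vanishes.\<close>

lemma hopf_fibre:
  assumes zw: "(cmod z)^2 + (cmod w)^2 = 1" and zw': "(cmod z')^2 + (cmod w')^2 = 1"
    and p: "2 * z * w = 2 * z' * w'" and C: "(cmod z)^2 - (cmod w)^2 = (cmod z')^2 - (cmod w')^2"
  defines "\<zeta> \<equiv> z' * cnj z + cnj w' * w"
  shows "z' = \<zeta> * z" "w' = cnj \<zeta> * w" "cmod \<zeta> = 1"
proof -
  have "(cmod z)^2 = (cmod z')^2" "(cmod w)^2 = (cmod w')^2" using assms(1,2,4) by linarith+
  then have zz: "z * cnj z = z' * cnj z'" and ww: "w * cnj w = w' * cnj w'"
    unfolding complex_norm_square[symmetric] by simp_all
  have 1: "z' * cnj z' + w' * cnj w' = 1"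
    using zw' by (metis complex_norm_square of_real_1 of_real_add)
  have p: "z * w = z' * w'" using p by simp
  have "\<zeta> * z = z' * (z * cnj z) + cnj w' * (z * w)" by (simp add: \<zeta>_def algebra_simps)
  also have "\<dots> = z' * (z' * cnj z' + w' * cnj w')" unfolding zz p by (simp add: algebra_simps)
  finally show z': "z' = \<zeta> * z" by (simp add: 1)
  have "cnj \<zeta> * w = cnj z' * (z * w) + w' * (w * cnj w)" by (simp add: \<zeta>_def algebra_simps)
  also have "\<dots> = w' * (z' * cnj z' + w' * cnj w')" unfolding ww p by (simp add: algebra_simps)
  finally show w': "w' = cnj \<zeta> * w" by (simp add: 1)
  have "(cmod \<zeta>)^2 * ((cmod z)^2 + (cmod w)^2) = 1"
    using zw' unfolding z' w' by (simp add: norm_mult power_mult_distrib algebra_simps)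
  then have "(cmod \<zeta>)^2 = 1^2" by (simp add: zw)
  then show "cmod \<zeta> = 1" by (rule power2_eq_imp_eq) auto
qed

section \<open>Prolate spheroidal coordinates\<close>

text \<open>
  Prolate spheroidal coordinates with the centers as foci: \<open>\<rho>\<close> is \<open>c\<close> times the hyperbolic cosine of the
  radial coordinate and \<open>C\<close> is the cosine of the angular one, so that the centers have distances
  \<open>\<rho> \<mp> c C\<close>. Equating \<open>\<rho> = c r^2/a^2\<close> and \<open>C = cos \<theta>\<close> gives the map from Eguchi-Hanson space
  to the base.
\<close>

locale two_centers =
  fixes x1 x2 e1 e2 e :: "real^3" and c a :: real
  assumes c: "0 < c" and a: "0 < a" and axis: "x1 - x2 = (2 * c) *\<^sub>R e"
    and frame: "e1 \<bullet> e1 = 1" "e2 \<bullet> e2 = 1" "e \<bullet> e = 1" "e1 \<bullet> e2 = 0" "e1 \<bullet> e = 0" "e2 \<bullet> e = 0"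
    and orientation: "cross3 e1 e2 = e"
begin

abbreviation "pot \<equiv> gh_potential 0 [(x1, 1), (x2, 1)]"

definition "mid = x2 + c *\<^sub>R e"
definition "\<rho> x = (norm (x - x1) + norm (x - x2)) / 2"
definition "C x = (norm (x - x2) - norm (x - x1)) / (2 * c)"
text \<open>\<open>P\<close> and \<open>Z\<close> are the transversal and axial Cartesian
  coordinates about the midpoint of the centers, the transversal plane being read as the complex
  plane. Below, \<open>\<kappa>\<close> is \<open>c\<close> times the hyperbolic sine of the radial
  coordinate, \<open>rr\<close> is the Eguchi-Hanson radius and \<open>f\<close> is 1 -
  a^4/r^4.\<close>

definition "P x = Complex ((x - mid) \<bullet> e1) ((x - mid) \<bullet> e2)"
definition "Z x = (x - mid) \<bullet> e"
definition "\<kappa> x = sqrt ((\<rho> x)^2 - c^2)"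
definition "rr x = a * sqrt (\<rho> x / c)"
definition "U = - closed_segment x1 x2"
definition "f x = 1 - c^2 / (\<rho> x)^2"

text \<open>The double cross product of \<open>v\<close> with \<open>e\<close> is evaluated twice by
  the Lagrange identity, once with \<open>e\<close> itself and once with \<open>e\<close> replaced
  by \<open>cross3 e1 e2\<close>.\<close>

lemma frame_expansion: "v = (v \<bullet> e1) *\<^sub>R e1 + (v \<bullet> e2) *\<^sub>R e2 + (v \<bullet> e) *\<^sub>R e"
proof -
  have ee1: "cross3 e e1 = e2"
    using Lagrange[of e1 e1 e2] cross_skew[of e1 e] frame by (simp add: orientation inner_commute)
  have ee2: "cross3 e e2 = - e1"
    using Lagrange[of e2 e1 e2] cross_skew[of e e2] frame by (simp add: orientation inner_commute)
  have "cross3 v e = (v \<bullet> e2) *\<^sub>R e1 - (v \<bullet> e1) *\<^sub>R e2"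
    using Lagrange[of v e1 e2] by (simp add: orientation)
  then have "cross3 e (cross3 v e) = (v \<bullet> e2) *\<^sub>R e2 + (v \<bullet> e1) *\<^sub>R e1"
    by (simp add: Cross3.right_diff_distrib cross_mult_right ee1 ee2)
  moreover have "cross3 e (cross3 v e) = v - (v \<bullet> e) *\<^sub>R e"
    using Lagrange[of e v e] frame by (simp add: inner_commute)
  ultimately show ?thesis by (simp add: algebra_simps)
qed

lemma frame_inner: "v \<bullet> w = (v \<bullet> e1) * (w \<bullet> e1) + (v \<bullet> e2) * (w \<bullet> e2) + (v \<bullet> e) * (w \<bullet> e)"
  by (subst (1) frame_expansion[of v]) (simp add: inner_simps inner_commute)

lemma cross_axis: "cross3 e v \<bullet> w = (v \<bullet> e1) * (w \<bullet> e2) - (v \<bullet> e2) * (w \<bullet> e1)"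
proof -
  have "cross3 w e = (w \<bullet> e2) *\<^sub>R e1 - (w \<bullet> e1) *\<^sub>R e2"
    using Lagrange[of w e1 e2] by (simp add: orientation)
  moreover have "cross3 e v \<bullet> w = cross3 w e \<bullet> v"
    by (metis cross_triple)
  ultimately show ?thesis by (simp add: inner_simps inner_commute)
qed

lemma from_centers: "x - x1 = (x - mid) - c *\<^sub>R e" "x - x2 = (x - mid) + c *\<^sub>R e"
proof -
  show "x - x2 = (x - mid) + c *\<^sub>R e" by (simp add: mid_def)
  have "x - x1 = (x - x2) - (x1 - x2)" by simp
  also have "\<dots> = (x - mid) - c *\<^sub>R e" unfolding axis by (simp add: mid_def algebra_simps flip: scaleR_2)
  finally show "x - x1 = (x - mid) - c *\<^sub>R e" .
qed

lemma norm_centers: "norm (x - x1) = \<rho> x - c * C x" "norm (x - x2) = \<rho> x + c * C x"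
  using c by (simp_all add: \<rho>_def C_def field_simps)

lemma cmod_P: "(cmod (P x))^2 = ((x - mid) \<bullet> e1)^2 + ((x - mid) \<bullet> e2)^2"
  by (simp add: P_def cmod_power2)

lemma dist_center_sq:
  "(norm (x - x1))^2 = (cmod (P x))^2 + (Z x - c)^2" "(norm (x - x2))^2 = (cmod (P x))^2 + (Z x + c)^2"
proof -
  have "(norm ((x - mid) + t *\<^sub>R e))^2 = (cmod (P x))^2 + (Z x + t)^2" for t
  proof -
    define y where "y = x - mid"
    have "(y + t *\<^sub>R e) \<bullet> (y + t *\<^sub>R e) = (y \<bullet> e1)^2 + (y \<bullet> e2)^2 + (y \<bullet> e + t)^2"
      by (subst frame_inner) (use frame in \<open>simp add: inner_add_left inner_add_right power2_eq_square inner_commute\<close>)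
    then show ?thesis
      by (simp only: power2_norm_eq_inner[where 'a = "real^3"] cmod_P Z_def y_def)
  qed
  from this[of "- c"] this[of c]
  show "(norm (x - x1))^2 = (cmod (P x))^2 + (Z x - c)^2" "(norm (x - x2))^2 = (cmod (P x))^2 + (Z x + c)^2"
    unfolding from_centers by simp_all
qed

lemma Z_eq: "Z x = \<rho> x * C x"
proof -
  have "(\<rho> x + c * C x)^2 - (\<rho> x - c * C x)^2 = 4 * c * Z x"
    using dist_center_sq[of x] unfolding norm_centers by (simp add: power2_eq_square algebra_simps)
  then have "4 * c * (\<rho> x * C x) = 4 * c * Z x" by (simp add: power2_eq_square algebra_simps)
  then show ?thesis using c by simp
qed

lemma cmod_P_eq: "(cmod (P x))^2 = ((\<rho> x)^2 - c^2) * (1 - (C x)^2)"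
  using dist_center_sq(1)[of x] unfolding norm_centers Z_eq by algebra

lemma dist_centers: "dist x1 x2 = 2 * c"
proof -
  have "norm e = 1" using frame by (simp add: norm_eq_sqrt_inner)
  then show ?thesis using c by (simp add: dist_norm axis)
qed

text \<open>The segment is the degenerate ellipsoid \<open>\<rho> = c\<close>: the equality case of
  the triangle inequality.\<close>

lemma U_iff: "x \<in> U \<longleftrightarrow> c < \<rho> x"
proof -
  have "x \<in> U \<longleftrightarrow> dist x1 x2 \<noteq> dist x1 x + dist x x2"
    unfolding U_def by (simp flip: between_mem_segment add: between)
  also have "\<dots> \<longleftrightarrow> dist x1 x2 < dist x1 x + dist x x2"
    using dist_triangle[of x1 x2 x] by linarith
  also have "\<dots> \<longleftrightarrow> c < \<rho> x"
    unfolding dist_centers by (simp add: \<rho>_def dist_norm norm_minus_commute) linarith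
  finally show ?thesis .
qed

lemma open_U: "open U"
  unfolding U_def by (simp add: open_Compl closed_segment)

lemma C_abs: "\<bar>C x\<bar> \<le> 1"
proof -
  have "\<bar>norm (x - x2) - norm (x - x1)\<bar> \<le> norm (x1 - x2)"
    using norm_triangle_ineq3[of "x - x2" "x - x1"] by simp
  then show ?thesis using c dist_centers by (simp add: C_def dist_norm abs_divide)
qed

lemma C_sq: "(C x)^2 \<le> 1"
  using C_abs abs_square_le_1 by blast

lemma
  assumes "x \<in> U"
  shows \<rho>_pos: "0 < \<rho> x" and K_pos: "0 < (\<rho> x)^2 - c^2" and \<kappa>_pos: "0 < \<kappa> x"
    and \<kappa>_sq: "(\<kappa> x)^2 = (\<rho> x)^2 - c^2" and f_pos: "0 < f x"
    and D_pos: "0 < (\<rho> x)^2 - c^2 * (C x)^2" and rr_gt: "a < rr x"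
    and rr_sq: "(rr x)^2 = a^2 * \<rho> x / c" and f_eq: "f x = 1 - a^4 / (rr x)^4"
proof -
  have *: "c < \<rho> x" using assms by (simp add: U_iff)
  show 0: "0 < \<rho> x" using * c by linarith
  show K: "0 < (\<rho> x)^2 - c^2" using * c by (simp add: power_strict_mono)
  then show "0 < \<kappa> x" "(\<kappa> x)^2 = (\<rho> x)^2 - c^2" by (simp_all add: \<kappa>_def)
  show "0 < f x" using K 0 by (simp add: f_def field_simps)
  have "c^2 * (C x)^2 \<le> c^2" using C_sq by (simp add: mult_left_le)
  then show "0 < (\<rho> x)^2 - c^2 * (C x)^2" using K by linarith
  show "a < rr x" using * c a by (simp add: rr_def)
  show r: "(rr x)^2 = a^2 * \<rho> x / c" using 0 c by (simp add: rr_def power_mult_distrib)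
  have "(rr x)^4 = ((rr x)^2)^2" by simp
  then show "f x = 1 - a^4 / (rr x)^4"
    unfolding r using 0 c a by (simp add: f_def power_divide power_mult_distrib)
qed

lemma potential:
  assumes "x \<in> U"
  shows "pot x = 2 * \<rho> x / ((\<rho> x)^2 - c^2 * (C x)^2)"
proof -
  have "(\<rho> x)^2 - c^2 * (C x)^2 = (\<rho> x - c * C x) * (\<rho> x + c * C x)"
    by (simp add: power2_eq_square algebra_simps)
  then show ?thesis
    using D_pos[OF assms] unfolding gh_potential_def
    by (auto simp: norm_centers zero_less_mult_iff add_frac_eq)
qed

text \<open>Inverse of the map from \<open>x\<close> to \<open>\<rho> x\<close>, \<open>P x\<close>
  and \<open>C x\<close>; the axial coordinate is the product by \<open>Z_eq\<close>.\<close>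

definition "base_pt r p D = mid + Re p *\<^sub>R e1 + Im p *\<^sub>R e2 + (r * D) *\<^sub>R e"

lemma base_pt:
  assumes "c < r" "\<bar>D\<bar> \<le> 1" "(cmod p)^2 = (r^2 - c^2) * (1 - D^2)"
  shows "base_pt r p D \<in> U" "\<rho> (base_pt r p D) = r" "C (base_pt r p D) = D" "P (base_pt r p D) = p"
proof -
  let ?x = "base_pt r p D"
  show P: "P ?x = p"
    using frame by (simp add: P_def base_pt_def inner_simps inner_commute complex_eq_iff)
  have Z: "Z ?x = r * D"
    using frame by (simp add: Z_def base_pt_def inner_simps inner_commute)
  have "\<bar>c * D\<bar> \<le> c" using assms(2) c by (simp add: abs_mult mult_left_le)
  then have nonneg: "0 \<le> r - c * D" "0 \<le> r + c * D" using assms(1) by linarith+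
  have "(norm (?x - x1))^2 = (r - c * D)^2"
    unfolding dist_center_sq P Z assms(3) by (simp add: power2_eq_square algebra_simps)
  then have n1: "norm (?x - x1) = r - c * D"
    by (rule power2_eq_imp_eq[OF _ norm_ge_zero nonneg(1)])
  have "(norm (?x - x2))^2 = (r + c * D)^2"
    unfolding dist_center_sq P Z assms(3) by (simp add: power2_eq_square algebra_simps)
  then have n2: "norm (?x - x2) = r + c * D"
    by (rule power2_eq_imp_eq[OF _ norm_ge_zero nonneg(2)])
  show r: "\<rho> ?x = r" by (simp add: \<rho>_def n1 n2)
  show "C ?x = D" using c by (simp add: C_def n1 n2)
  show "?x \<in> U" unfolding U_iff r by (rule assms)
qed

lemma base_pt_coords: "x = base_pt (\<rho> x) (P x) (C x)"
proof -
  have "x = mid + (x - mid)" by simp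
  also have "x - mid = Re (P x) *\<^sub>R e1 + Im (P x) *\<^sub>R e2 + (\<rho> x * C x) *\<^sub>R e"
    using frame_expansion[of "x - mid"] unfolding Z_eq[symmetric] by (simp add: P_def Z_def)
  finally show ?thesis by (simp add: base_pt_def add.assoc)
qed

lemma
  shows smooth_\<rho>: "smooth_on U \<rho>" and smooth_C: "smooth_on U C" and smooth_\<kappa>: "smooth_on U \<kappa>"
    and smooth_rr: "smooth_on U rr" and smooth_P: "smooth_on U P"
proof -
  have 1: "smooth_on U (\<lambda>x. norm (x - x1))" "smooth_on U (\<lambda>x. norm (x - x2))"
    by (rule smooth_on_norm_diff; auto simp: open_U U_def)+
  show \<rho>: "smooth_on U \<rho>"
    unfolding \<rho>_def by (intro smooth_intros 1 open_U) auto
  show "smooth_on U C"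
    unfolding C_def using c by (intro smooth_intros 1 open_U) auto
  show "smooth_on U \<kappa>"
    unfolding \<kappa>_def power2_eq_square using K_pos[unfolded power2_eq_square]
    by (intro smooth_intros \<rho> open_U) auto
  show "smooth_on U rr"
    unfolding rr_def using \<rho>_pos c
    by (intro smooth_intros \<rho> open_U) auto
  have lin: "smooth_on U (\<lambda>x. (x - mid) \<bullet> v)" for v
    by (intro smooth_intros open_U)
  have "smooth_on U (\<lambda>x. of_real ((x - mid) \<bullet> e1) + \<i> * of_real ((x - mid) \<bullet> e2))"
    by (intro smooth_intros lin open_U)
  then show "smooth_on U P" unfolding P_def Complex_eq by simp
qed

lemma P_derivative:
  assumes "(X has_derivative X') (at y)"
  shows "((\<lambda>y. P (X y)) has_derivative (\<lambda>v. Complex (X' v \<bullet> e1) (X' v \<bullet> e2))) (at y)"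
  unfolding P_def Complex_eq
  by (rule derivative_eq_intros assms refl | simp)+

lemma Z_derivative:
  assumes "(X has_derivative X') (at y)"
  shows "((\<lambda>y. Z (X y)) has_derivative (\<lambda>v. X' v \<bullet> e)) (at y)"
  unfolding Z_def by (rule derivative_eq_intros assms refl | simp)+

text \<open>The points of the sphere that lie over \<open>x\<close> once the radius is
  \<open>rr x\<close>: dividing \<open>P x\<close> by \<open>\<kappa> x\<close> and
  \<open>Z x\<close> by \<open>\<rho> x\<close> puts \<open>x\<close> on the unit sphere, where the
  Hopf map takes its values.\<close>

definition hopf_lift :: "complex \<Rightarrow> complex \<Rightarrow> real^3 \<Rightarrow> bool" where
  "hopf_lift z w x \<longleftrightarrow> (cmod z)^2 + (cmod w)^2 = 1 \<and> of_real (\<kappa> x) * (2 * z * w) = P x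
     \<and> (cmod z)^2 - (cmod w)^2 = C x"

text \<open>The parameter \<open>y\<close> is left general so that it can be the pair of bundle
  coordinates. Differentiating the relations in \<open>hopf_lift\<close> and those for
  \<open>\<kappa>^2\<close> and \<open>rr^2\<close> supplies the hypotheses of
  \<open>eh_line_eq_gibbons_hawking\<close>.\<close>

lemma eh_line_lift:
  fixes X :: "'e::real_normed_vector \<Rightarrow> real^3" and z w :: "'e \<Rightarrow> complex"
  assumes M: "open M" "y \<in> M" and XU: "X y \<in> U"
    and lift: "\<And>y. y \<in> M \<Longrightarrow> hopf_lift (z y) (w y) (X y)"
    and D: "(X has_derivative X') (at y)" "(z has_derivative z') (at y)" "(w has_derivative w') (at y)"
      "((\<lambda>y. rr (X y)) has_derivative r') (at y)"
  shows "eh_line a (rr (X y)) (z y) (w y) (r' v) (z' v) (w' v) = a^2 / (8 * c) *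
    (inverse (pot (X y)) * (eh_conn (f (X y)) (z y) (w y) (z' v) (w' v))^2
      + pot (X y) * (X' v \<bullet> X' v))"
proof -
  let ?x = "X y"
  have D\<rho>0: "(\<rho> has_derivative fderiv \<rho> ?x) (at ?x)"
    and D\<kappa>0: "(\<kappa> has_derivative fderiv \<kappa> ?x) (at ?x)"
    by (rule smooth_on_has_derivative[OF _ XU], simp add: smooth_\<rho> smooth_\<kappa>)+
  define \<rho>' where "\<rho>' v = fderiv \<rho> ?x (X' v)" for v
  define \<kappa>' where "\<kappa>' v = fderiv \<kappa> ?x (X' v)" for v
  have D\<rho>: "((\<lambda>y. \<rho> (X y)) has_derivative \<rho>') (at y)"
    using has_derivative_compose[OF D(1) D\<rho>0] by (simp add: \<rho>'_def[abs_def])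
  have D\<kappa>: "((\<lambda>y. \<kappa> (X y)) has_derivative \<kappa>') (at y)"
    using has_derivative_compose[OF D(1) D\<kappa>0] by (simp add: \<kappa>'_def[abs_def])
  have nearU: "\<forall>\<^sub>F y in nhds y. X y \<in> U"
    using has_derivative_continuous[OF D(1)] open_U XU
    by (metis continuous_within tendsto_at_iff_tendsto_nhds topological_tendstoD)
  have nearM: "\<forall>\<^sub>F y in nhds y. hopf_lift (z y) (w y) (X y)"
    using eventually_nhds_in_open[OF M] lift by (rule eventually_mono)
  \<comment> \<open>Functions that agree near \<open>y\<close> have the same derivative; each of the
    five numbered facts below is a relation differentiated in this way.\<close>
  have uniq: "g' = h'" if "(g has_derivative g') (at y)" "(h has_derivative h') (at y)"
    "\<forall>\<^sub>F y in nhds y. g y = h y" for g h :: "'e \<Rightarrow> 'z::real_normed_vector" and g' h'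
  proof -
    have "(g has_derivative h') (at y)"
    proof (rule has_derivative_transform_eventually[OF that(2)])
      show "\<forall>\<^sub>F y in at y. h y = g y" "h y = g y"
        using that(3) unfolding eventually_nhds_conv_at by (auto elim: eventually_mono)
    qed simp
    then show ?thesis using has_derivative_unique[OF that(1)] by blast
  qed
  note Dz = D(2,3)
  have 1: "(\<lambda>v. 2 * (z y \<bullet> z' v) + 2 * (w y \<bullet> w' v)) = (\<lambda>v. 0)"
  proof (rule uniq[of "\<lambda>y. z y \<bullet> z y + w y \<bullet> w y" _ "\<lambda>_. 1"])
    show "((\<lambda>y. z y \<bullet> z y + w y \<bullet> w y) has_derivative
        (\<lambda>v. 2 * (z y \<bullet> z' v) + 2 * (w y \<bullet> w' v))) (at y)"
      by (auto intro!: derivative_eq_intros Dz simp: inner_commute)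
    show "\<forall>\<^sub>F y in nhds y. z y \<bullet> z y + w y \<bullet> w y = 1"
      using nearM by (rule eventually_mono) (simp add: hopf_lift_def flip: power2_norm_eq_inner)
  qed auto
  have 2: "(\<lambda>v. Complex (X' v \<bullet> e1) (X' v \<bullet> e2)) =
    (\<lambda>v. of_real (\<kappa>' v) * (2 * z y * w y) + of_real (\<kappa> ?x) * (2 * (z y * w' v + w y * z' v)))"
    by (rule uniq[OF P_derivative[OF D(1)], of "\<lambda>y. of_real (\<kappa> (X y)) * (2 * z y * w y)"])
      (auto intro!: derivative_eq_intros Dz D\<kappa> eventually_mono[OF nearM]
        simp: hopf_lift_def algebra_simps)
  have 3: "(\<lambda>v. X' v \<bullet> e) = (\<lambda>v. \<rho>' v * C ?x + \<rho> ?x * (2 * (z y \<bullet> z' v - w y \<bullet> w' v)))"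
  proof (rule uniq[OF Z_derivative[OF D(1)], of "\<lambda>y. \<rho> (X y) * (z y \<bullet> z y - w y \<bullet> w y)"])
    have "z y \<bullet> z y - w y \<bullet> w y = C ?x"
      using lift[OF M(2)] by (simp add: hopf_lift_def flip: power2_norm_eq_inner)
    then show "((\<lambda>y. \<rho> (X y) * (z y \<bullet> z y - w y \<bullet> w y)) has_derivative
        (\<lambda>v. \<rho>' v * C ?x + \<rho> ?x * (2 * (z y \<bullet> z' v - w y \<bullet> w' v)))) (at y)"
      by (auto intro!: derivative_eq_intros Dz D\<rho> simp: inner_commute algebra_simps)
    show "\<forall>\<^sub>F y in nhds y. Z (X y) = \<rho> (X y) * (z y \<bullet> z y - w y \<bullet> w y)"
      using nearM by (rule eventually_mono) (simp add: hopf_lift_def Z_eq flip: power2_norm_eq_inner)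
  qed
  have 4: "(\<lambda>v. 2 * (\<kappa> ?x * \<kappa>' v)) = (\<lambda>v. 2 * (\<rho> ?x * \<rho>' v))"
    by (rule uniq[of "\<lambda>y. (\<kappa> (X y))^2" _ "\<lambda>y. (\<rho> (X y))^2 - c^2"])
      (auto intro!: derivative_eq_intros D\<kappa> D\<rho> eventually_mono[OF nearU] \<kappa>_sq)
  have 5: "(\<lambda>v. 2 * rr ?x * r' v) = (\<lambda>v. a^2 * \<rho>' v / c)"
    using c by (intro uniq[of "\<lambda>y. (rr (X y))^2" _ "\<lambda>y. a^2 * \<rho> (X y) / c"])
      (auto intro!: derivative_eq_intros D(4) D\<rho> eventually_mono[OF nearU] rr_sq)
  have inner: "p \<bullet> q = Re (cnj p * q)" for p q :: complex by (simp add: inner_complex_def)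
  have l: "hopf_lift (z y) (w y) ?x" by (rule lift[OF M(2)])
  have XX: "X' v \<bullet> X' v = (cmod (Complex (X' v \<bullet> e1) (X' v \<bullet> e2)))^2 + (X' v \<bullet> e)^2"
    by (subst frame_inner) (simp add: cmod_power2 flip: power2_eq_square)
  show ?thesis
    unfolding potential[OF XU] XX f_eq[OF XU]
  proof (rule eh_line_eq_gibbons_hawking[where \<kappa> = "\<kappa> ?x" and d\<kappa> = "\<kappa>' v" and d\<rho> = "\<rho>' v"])
    show "Re (cnj (z y) * z' v + cnj (w y) * w' v) = 0"
      using fun_cong[OF 1, of v] by (simp add: inner)
    show "X' v \<bullet> e = \<rho>' v * C ?x + \<rho> ?x * (2 * Re (cnj (z y) * z' v - cnj (w y) * w' v))"
      using fun_cong[OF 3, of v] by (simp add: inner)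
    show "0 < rr ?x" using rr_gt[OF XU] a by linarith
  qed (use l c a XU fun_cong[OF 2, of v] fun_cong[OF 4, of v] fun_cong[OF 5, of v] in
      \<open>auto simp: hopf_lift_def U_iff rr_sq \<kappa>_sq\<close>)
qed

end

section \<open>Monopole potentials\<close>

text \<open>The exterior derivative of the 1-form of \<open>A\<close>, evaluated on \<open>v\<close>
  and \<open>w\<close>. It trades the curl in components for the antisymmetric part of the
  derivative, which is what \<open>closed_form_primitive\<close> asks about.\<close>

lemma curl_inner_cross:
  assumes "(A has_derivative D) (at x)"
  shows "D v \<bullet> w - D w \<bullet> v = curl A x \<bullet> cross3 v w"
proof -
  have D: "fderiv A x = D" using assms by (rule frechet_derivative_eqI)
  interpret D: bounded_linear D using assms by (rule has_derivative_bounded_linear)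
  have exp: "D u = (\<Sum>i\<in>UNIV. u $ i *\<^sub>R D (axis i 1))" for u
  proof -
    have "u = (\<Sum>i\<in>UNIV. u $ i *\<^sub>R axis i 1)"
      using basis_expansion[of u] by (simp add: scalar_mult_eq_scaleR)
    then have "D u = D (\<Sum>i\<in>UNIV. u $ i *\<^sub>R axis i 1)" by simp
    then show ?thesis by (simp only: D.sum D.scaleR)
  qed
  show ?thesis
    unfolding curl_def partial_deriv_def D exp[of v] exp[of w]
    by (simp add: sum_3 inner_vec_def cross_components vector_3 algebra_simps)
qed

text \<open>The vector potential of a magnetic monopole; its Dirac string is the ray opposite to \<open>e\<close>.\<close>

definition dirac :: "real^3 \<Rightarrow> real^3 \<Rightarrow> real^3" where
  "dirac e x = - inverse (norm x * (norm x + e \<bullet> x)) *\<^sub>R cross3 e x"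

lemma bounded_linear_cross3: "bounded_linear (cross3 e)"
  unfolding linear_conv_bounded_linear[symmetric]
  by (rule linearI) (simp_all add: cross_add_right cross_mult_right)

lemma norm_has_derivative_inner:
  "x \<noteq> 0 \<Longrightarrow> (norm has_derivative (\<lambda>v. (x \<bullet> v) / norm x)) (at x)"
  using has_derivative_norm[of x] by (simp add: sgn_div_norm divide_inverse mult.commute inner_commute)

lemma has_derivative_translate:
  assumes "(g has_derivative D) (at (x - p))"
  shows "((\<lambda>x. g (x - p)) has_derivative D) (at x)"
proof -
  have "((\<lambda>x. x - p) has_derivative (\<lambda>h. h)) (at x)" by (auto intro!: derivative_eq_intros)
  from has_derivative_compose[OF this assms] show ?thesis .
qed

text \<open>Off its string the potential has curl \<open>- x / \<bar>x\<bar>^3\<close>, the field of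
  a point charge; by \<open>curl_inner_cross\<close> this is expressed without components.\<close>

lemma dirac_derivative:
  assumes e: "e \<bullet> e = 1" and x: "norm x + e \<bullet> x \<noteq> 0"
  obtains D where "(dirac e has_derivative D) (at x)"
    "\<And>v w. D v \<bullet> w - D w \<bullet> v = - (x \<bullet> cross3 v w) / (norm x)^3"
proof -
  define R where "R = norm x"
  define E where "E = e \<bullet> x"
  have x0: "x \<noteq> 0" using x by auto
  then have R: "R > 0" by (simp add: R_def)
  have RE: "R + E \<noteq> 0" using x by (simp add: R_def E_def)
  have RR: "x \<bullet> x = R^2" by (simp add: R_def power2_norm_eq_inner)
  \<comment> \<open>The derivative of the scalar prefactor of \<open>dirac\<close>, with the minus
    sign included.\<close>
  define \<phi>' where "\<phi>' v = inverse (R * (R + E))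
      * (R * ((x \<bullet> v) / R + e \<bullet> v) + (x \<bullet> v) / R * (R + E)) * inverse (R * (R + E))" for v
  have \<phi>': "\<phi>' v = inverse ((R * (R + E))^2) * (((R + E) / R + 1) * (x \<bullet> v) + R * (e \<bullet> v))" for v
  proof -
    have "R * ((x \<bullet> v) / R + e \<bullet> v) + (x \<bullet> v) / R * (R + E)
        = ((R + E) / R + 1) * (x \<bullet> v) + R * (e \<bullet> v)"
      using R by (simp add: field_simps)
    then show ?thesis unfolding \<phi>'_def by (simp add: power2_eq_square)
  qed
  define D where "D v = \<phi>' v *\<^sub>R cross3 e x - inverse (R * (R + E)) *\<^sub>R cross3 e v" for v
  have dn: "(norm has_derivative (\<lambda>v. (x \<bullet> v) / R)) (at x)"
    using norm_has_derivative_inner[OF x0] by (simp add: R_def)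
  have di: "((\<lambda>x. e \<bullet> x) has_derivative (\<lambda>v. e \<bullet> v)) (at x)"
    and dc: "(cross3 e has_derivative cross3 e) (at x)"
    by (intro bounded_linear_imp_has_derivative bounded_linear_inner_right bounded_linear_cross3)+
  have "norm x * (norm x + e \<bullet> x) \<noteq> 0" using x x0 by simp
  from has_derivative_scaleR[OF has_derivative_minus[OF Deriv.has_derivative_inverse[OF this
        has_derivative_mult[OF dn has_derivative_add[OF dn di]]]] dc]
  have "(dirac e has_derivative D) (at x)"
    unfolding dirac_def[abs_def]
    by (rule has_derivative_eq_rhs)
      (simp add: D_def \<phi>'_def R_def[symmetric] E_def[symmetric] fun_eq_iff)
  moreover have "D v \<bullet> w - D w \<bullet> v = - (x \<bullet> cross3 v w) / (norm x)^3" for v w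
  proof -
    define t where "t = x \<bullet> cross3 v w"
    define u where "u = e \<bullet> cross3 v w"
    \<comment> \<open>Both sides are the inner product of \<open>cross3 p (cross3 e x)\<close> with
      \<open>cross3 v w\<close>. Used for \<open>p = x\<close> and \<open>p = e\<close>, it leaves
      only \<open>t\<close> and \<open>u\<close>; the coefficient of \<open>u\<close> cancels
      against the term \<open>2 * u\<close>, so the field has no component along the string
      direction.\<close>
    have L: "(p \<bullet> v) * (cross3 e x \<bullet> w) - (p \<bullet> w) * (cross3 e x \<bullet> v) = u * (p \<bullet> x) - t * (p \<bullet> e)" for p
      unfolding u_def t_def by (simp add: cross3_simps)
    have "cross3 e v \<bullet> w - cross3 e w \<bullet> v = 2 * u"
      unfolding u_def by (simp add: cross3_simps)
    then have "D v \<bullet> w - D w \<bullet> v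
        = \<phi>' v * (cross3 e x \<bullet> w) - \<phi>' w * (cross3 e x \<bullet> v) - 2 * u * inverse (R * (R + E))"
      unfolding D_def by (simp add: inner_diff_left algebra_simps)
    also have "\<phi>' v * (cross3 e x \<bullet> w) - \<phi>' w * (cross3 e x \<bullet> v) = inverse ((R * (R + E))^2) *
        (((R + E) / R + 1) * ((x \<bullet> v) * (cross3 e x \<bullet> w) - (x \<bullet> w) * (cross3 e x \<bullet> v))
         + R * ((e \<bullet> v) * (cross3 e x \<bullet> w) - (e \<bullet> w) * (cross3 e x \<bullet> v)))"
      unfolding \<phi>' by (simp add: algebra_simps)
    also have "\<dots> = inverse ((R * (R + E))^2) *
        (((R + E) / R + 1) * (u * R^2 - t * E) + R * (u * E - t))"
      unfolding L RR e by (simp add: E_def inner_commute)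
    also have "\<dots> - 2 * u * inverse (R * (R + E)) = - t / R^3"
      using R RE by (simp add: divide_simps) algebra
    finally show ?thesis by (simp add: t_def R_def)
  qed
  ultimately show ?thesis by (rule that)
qed

lemma smooth_on_dirac:
  assumes S: "open S" and x: "\<And>x. x \<in> S \<Longrightarrow> norm (x - c) + e \<bullet> (x - c) \<noteq> 0"
  shows "smooth_on S (\<lambda>x. dirac e (x - c))"
proof -
  have "c \<notin> S" using x[of c] by auto
  have lin: "smooth_on S (\<lambda>x. x - c)"
    by (intro smooth_intros S)
  have n: "norm (x - c) * (norm (x - c) + e \<bullet> (x - c)) \<noteq> 0" if "x \<in> S" for x
    using x[OF that] that \<open>c \<notin> S\<close> by auto
  show ?thesis
    unfolding dirac_def
    by (intro smooth_intros smooth_on_norm_diff lin S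
        smooth_on_linear_compose[OF S bounded_linear_cross3] n \<open>c \<notin> S\<close>)
qed

lemma monopole_potential:
  fixes x :: "real^3"
  assumes "x \<noteq> 0"
  shows "GDERIV (\<lambda>x. 1 / norm x) x :> - (1 / (norm x)^3) *\<^sub>R x"
proof -
  have "(norm has_derivative (\<lambda>v. (x \<bullet> v) / norm x)) (at x)"
    using norm_has_derivative_inner[OF assms] .
  then show ?thesis
    unfolding gderiv_def using assms
    by (auto intro!: derivative_eq_intros simp: field_simps power3_eq_cube inner_commute)
qed

section \<open>Dirac potentials of the two centers and Hopf sections\<close>

context two_centers
begin

text \<open>For \<open>u = e\<close> or \<open>u = - e\<close> the two strings run along the axis in
  the same direction \<open>- u\<close>, so together they form a single ray containing the
  segment.\<close>

definition "A0 u x = dirac u (x - x1) + dirac u (x - x2)"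

text \<open>The denominators factor in spheroidal coordinates: on \<open>U\<close> the first factors
  do not vanish, and the common second factor vanishes exactly on the half-axis
  \<open>C = - \<epsilon>\<close>.\<close>

lemma dirac_denominators:
  fixes \<epsilon> :: real
  assumes "\<epsilon> = 1 \<or> \<epsilon> = - 1"
  shows "norm (x - x1) + (\<epsilon> *\<^sub>R e) \<bullet> (x - x1) = (\<rho> x - \<epsilon> * c) * (1 + \<epsilon> * C x)"
    "norm (x - x2) + (\<epsilon> *\<^sub>R e) \<bullet> (x - x2) = (\<rho> x + \<epsilon> * c) * (1 + \<epsilon> * C x)"
proof -
  have "e \<bullet> (x - mid) = \<rho> x * C x" using Z_eq[of x] by (simp add: Z_def inner_commute)
  then have "e \<bullet> (x - x1) = \<rho> x * C x - c" "e \<bullet> (x - x2) = \<rho> x * C x + c"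
    unfolding from_centers using frame by (simp_all add: inner_diff_right inner_add_right)
  with assms show "norm (x - x1) + (\<epsilon> *\<^sub>R e) \<bullet> (x - x1) = (\<rho> x - \<epsilon> * c) * (1 + \<epsilon> * C x)"
    "norm (x - x2) + (\<epsilon> *\<^sub>R e) \<bullet> (x - x2) = (\<rho> x + \<epsilon> * c) * (1 + \<epsilon> * C x)"
    by (auto simp: norm_centers algebra_simps)
qed

definition "string_free \<epsilon> = {x \<in> U. 0 < 1 + \<epsilon> * C x}"

lemma string_free_nonzero:
  assumes "\<epsilon> = 1 \<or> \<epsilon> = - 1" "x \<in> string_free \<epsilon>"
  shows "norm (x - x1) + (\<epsilon> *\<^sub>R e) \<bullet> (x - x1) \<noteq> 0" "norm (x - x2) + (\<epsilon> *\<^sub>R e) \<bullet> (x - x2) \<noteq> 0"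
  using assms c unfolding dirac_denominators[OF assms(1)] by (auto simp: string_free_def U_iff)

lemma open_string_free: "open (string_free \<epsilon>)"
proof -
  have "open (U \<inter> (\<lambda>x. 1 + \<epsilon> * C x) -` {0<..})"
    by (intro continuous_open_preimage continuous_intros smooth_on_continuous[OF smooth_C] open_U)
  also have "U \<inter> (\<lambda>x. 1 + \<epsilon> * C x) -` {0<..} = string_free \<epsilon>" by (auto simp: string_free_def)
  finally show ?thesis .
qed

lemma string_free_cover: "U \<subseteq> string_free 1 \<union> string_free (- 1)"
  by (auto simp: string_free_def)

lemma smooth_A0:
  assumes "\<epsilon> = 1 \<or> \<epsilon> = - 1"
  shows "smooth_on (string_free \<epsilon>) (A0 (\<epsilon> *\<^sub>R e))"
  unfolding A0_def
  by (intro smooth_on_add smooth_on_dirac open_string_free string_free_nonzero assms)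

lemma potential_curl:
  assumes "x \<in> U" "GDERIV pot x :> curl A x"
  shows "curl A x = - (1 / norm (x - x1) ^ 3) *\<^sub>R (x - x1) - (1 / norm (x - x2) ^ 3) *\<^sub>R (x - x2)"
    (is "_ = ?g")
proof -
  have nz: "x - x1 \<noteq> 0" "x - x2 \<noteq> 0" using assms(1) by (auto simp: U_def)
  have tr: "((\<lambda>x. 1 / norm (x - p)) has_derivative (\<lambda>h. h \<bullet> (- (1 / norm (x - p) ^ 3) *\<^sub>R (x - p)))) (at x)"
    if "x - p \<noteq> 0" for p
    using monopole_potential[OF that] unfolding gderiv_def by (rule has_derivative_translate)
  have "GDERIV pot x :> ?g"
    using has_derivative_add[OF tr[OF nz(1)] tr[OF nz(2)]]
    unfolding gderiv_def gh_potential_def by (simp add: inner_simps)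
  then have "(\<lambda>h. h \<bullet> curl A x) = (\<lambda>h. h \<bullet> ?g)"
    using assms(2) has_derivative_unique unfolding gderiv_def by blast
  then have "h \<bullet> (curl A x - ?g) = 0" for h
    by (simp add: inner_diff_right fun_eq_iff)
  then have "curl A x - ?g = 0" by (metis inner_eq_zero_iff)
  then show ?thesis by simp
qed

text \<open>Both potentials have the gradient of \<open>V\<close> as curl, so the antisymmetric
  parts of their derivatives cancel and the difference is a closed form.\<close>

lemma A0_difference_closed:
  assumes \<epsilon>: "\<epsilon> = 1 \<or> \<epsilon> = - 1" and x: "x \<in> string_free \<epsilon>"
    and A: "(A has_derivative A') (at x)" and V: "GDERIV pot x :> curl A x"
    and D: "((\<lambda>x. A x - A0 (\<epsilon> *\<^sub>R e) x) has_derivative D) (at x)"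
  shows "D v \<bullet> w = D w \<bullet> v"
proof -
  let ?u = "\<epsilon> *\<^sub>R e"
  have u: "?u \<bullet> ?u = 1" using \<epsilon> frame by auto
  obtain D1 where D1: "(dirac ?u has_derivative D1) (at (x - x1))"
      "\<And>v w. D1 v \<bullet> w - D1 w \<bullet> v = - ((x - x1) \<bullet> cross3 v w) / (norm (x - x1))^3"
    using dirac_derivative[OF u string_free_nonzero(1)[OF \<epsilon> x]] by blast
  obtain D2 where D2: "(dirac ?u has_derivative D2) (at (x - x2))"
      "\<And>v w. D2 v \<bullet> w - D2 w \<bullet> v = - ((x - x2) \<bullet> cross3 v w) / (norm (x - x2))^3"
    using dirac_derivative[OF u string_free_nonzero(2)[OF \<epsilon> x]] by blast
  have "((\<lambda>x. A x - A0 ?u x) has_derivative (\<lambda>v. A' v - (D1 v + D2 v))) (at x)"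
    unfolding A0_def by (intro has_derivative_diff has_derivative_add A has_derivative_translate D1 D2)
  then have "D = (\<lambda>v. A' v - (D1 v + D2 v))" using has_derivative_unique[OF D] by blast
  moreover have "(- (1 / k) *\<^sub>R y - (1 / l) *\<^sub>R z) \<bullet> u = - (y \<bullet> u) / k + - (z \<bullet> u) / l"
    for k l :: real and y z u :: "real^3"
    by (simp add: inner_diff_left)
  then have "A' v \<bullet> w - A' w \<bullet> v = (D1 v \<bullet> w - D1 w \<bullet> v) + (D2 v \<bullet> w - D2 w \<bullet> v)"
    unfolding curl_inner_cross[OF A] D1 D2
    using x by (subst potential_curl[OF _ V]) (simp_all add: string_free_def)
  ultimately show ?thesis by (simp add: inner_simps)
qed

text \<open>Prepares the comparison with \<open>eh_conn\<close>. The centers differ from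
  \<open>mid\<close> by multiples of \<open>e\<close>, so both cross products with \<open>e\<close>
  equal that of \<open>x - mid\<close>, and the two scalar coefficients are added as
  fractions.\<close>

lemma A0_inner:
  assumes \<epsilon>: "\<epsilon> = 1 \<or> \<epsilon> = - 1" and x: "x \<in> string_free \<epsilon>"
  shows "A0 (\<epsilon> *\<^sub>R e) x \<bullet> v = - \<epsilon> * Im (cnj (P x) * Complex (v \<bullet> e1) (v \<bullet> e2))
    * (2 * ((\<rho> x)^2 + \<epsilon> * c^2 * C x) / (((\<rho> x)^2 - c^2) * (1 + \<epsilon> * C x) * ((\<rho> x)^2 - c^2 * (C x)^2)))"
proof -
  define J where "J = Im (cnj (P x) * Complex (v \<bullet> e1) (v \<bullet> e2))"
  have "cross3 e (x - mid) \<bullet> v = J" by (simp add: cross_axis J_def P_def)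
  then have J: "cross3 e (x - x1) \<bullet> v = J" "cross3 e (x - x2) \<bullet> v = J"
    unfolding from_centers
    by (simp_all add: Cross3.right_diff_distrib cross_add_right cross_mult_right inner_simps)
  have xU: "c < \<rho> x" and q: "0 < 1 + \<epsilon> * C x" using x by (auto simp: string_free_def U_iff)
  have ee: "\<epsilon> * \<epsilon> = 1" using \<epsilon> by auto
  have D: "0 < (\<rho> x - c * C x) * (\<rho> x + c * C x)"
    using D_pos[of x] x by (simp add: string_free_def power2_eq_square algebra_simps)
  have nz: "\<rho> x - c * C x \<noteq> 0" "\<rho> x + c * C x \<noteq> 0" using D by auto
  have nz2: "\<rho> x - \<epsilon> * c \<noteq> 0" "\<rho> x + \<epsilon> * c \<noteq> 0" using \<epsilon> xU c by auto
  have dec: "(\<rho> x)^2 - c^2 = (\<rho> x - \<epsilon> * c) * (\<rho> x + \<epsilon> * c)"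
    "(\<rho> x)^2 - c^2 * (C x)^2 = (\<rho> x - c * C x) * (\<rho> x + c * C x)"
    using \<epsilon> by (auto simp: power2_eq_square algebra_simps)
  have frac: "inverse ((\<rho> x - c * C x) * ((\<rho> x - \<epsilon> * c) * (1 + \<epsilon> * C x)))
      + inverse ((\<rho> x + c * C x) * ((\<rho> x + \<epsilon> * c) * (1 + \<epsilon> * C x)))
    = 2 * ((\<rho> x)^2 + \<epsilon> * c^2 * C x) / ((\<rho> x - \<epsilon> * c) * (\<rho> x + \<epsilon> * c) * (1 + \<epsilon> * C x)
       * ((\<rho> x - c * C x) * (\<rho> x + c * C x)))"
    using nz nz2 q by (simp add: divide_simps) (simp add: power2_eq_square algebra_simps)
  have "A0 (\<epsilon> *\<^sub>R e) x \<bullet> v = - \<epsilon> * J *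
     (inverse ((\<rho> x - c * C x) * ((\<rho> x - \<epsilon> * c) * (1 + \<epsilon> * C x)))
      + inverse ((\<rho> x + c * C x) * ((\<rho> x + \<epsilon> * c) * (1 + \<epsilon> * C x))))"
    unfolding A0_def dirac_def dirac_denominators[OF \<epsilon>] unfolding norm_centers
    by (simp only: inner_add_left inner_scaleR_left cross_mult_left J distrib_left)
      (simp add: mult.commute mult.left_commute)
  then show ?thesis unfolding frac dec J_def .
qed

text \<open>The Hopf section with real \<open>z\<close> has the Dirac potential with strings at
  \<open>C = - 1\<close> as its connection. The case \<open>\<epsilon> = - 1\<close> is the same
  computation with \<open>\<epsilon> C\<close> in place of \<open>C\<close>, after which
  \<open>z\<close> and \<open>w\<close> are exchanged; this restores \<open>C\<close> and, by
  \<open>eh_conn_swap\<close>, the sign of the connection.\<close>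

lemma local_section:
  assumes \<epsilon>: "\<epsilon> = 1 \<or> \<epsilon> = - 1"
  obtains z w where "smooth_on (string_free \<epsilon>) z" "smooth_on (string_free \<epsilon>) w"
    "\<And>x. x \<in> string_free \<epsilon> \<Longrightarrow> hopf_lift (z x) (w x) x"
    "\<And>x v. x \<in> string_free \<epsilon> \<Longrightarrow> eh_conn (f x) (z x) (w x)
       (fderiv z x v) (fderiv w x v) = A0 (\<epsilon> *\<^sub>R e) x \<bullet> v"
proof -
  let ?S = "string_free \<epsilon>"
  have o: "open ?S" by (rule open_string_free)
  have SU: "?S \<subseteq> U" by (auto simp: string_free_def)
  note sm = smooth_on_subset[OF _ SU]
  define t where "t x = sqrt ((1 + \<epsilon> * C x) / 2)" for x
  \<comment> \<open>The transversal part of the Hopf image of \<open>x\<close>, to be equal to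
    \<open>2 * z x * w x\<close>.\<close>
  define p where "p x = P x * of_real (inverse (\<kappa> x))" for x
  define z where "z x = complex_of_real (t x)" for x
  define w where "w x = p x * of_real (inverse (2 * t x))" for x
  have t: "0 < t x" "(t x)^2 = (1 + \<epsilon> * C x) / 2" if "x \<in> ?S" for x
    using that by (auto simp: t_def string_free_def)
  have St: "smooth_on ?S t"
    unfolding t_def
    by (intro smooth_intros o sm smooth_C)
      (auto simp: string_free_def)
  have \<kappa>0: "\<kappa> x \<noteq> 0" if "x \<in> ?S" for x using \<kappa>_pos[of x] that SU by auto
  have Sp: "smooth_on ?S p"
    unfolding p_def
    by (intro smooth_intros o sm smooth_P smooth_\<kappa> \<kappa>0)
  have Sz: "smooth_on ?S z" unfolding z_def by (intro smooth_on_of_real St o)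
  have Sw: "smooth_on ?S w"
    unfolding w_def
    by (intro smooth_intros St Sp o)
      (use t(1) in fastforce)
  have pp: "(cmod (p x))^2 = 1 - (\<epsilon> * C x)^2" if "x \<in> ?S" for x
  proof -
    have xU: "x \<in> U" using that SU by auto
    have "(cmod (p x))^2 = (cmod (P x))^2 / (\<kappa> x)^2"
      by (simp add: p_def norm_mult norm_inverse power_mult_distrib divide_inverse power_inverse)
    also have "\<dots> = 1 - (C x)^2"
      unfolding cmod_P_eq \<kappa>_sq[OF xU] using K_pos[OF xU] by simp
    finally show ?thesis using \<epsilon> by auto
  qed
  have w_div: "w x = p x / (2 * of_real (t x))" for x by (simp add: w_def field_simps)
  have sec: "(cmod (z x))^2 + (cmod (w x))^2 = 1" "(cmod (z x))^2 - (cmod (w x))^2 = \<epsilon> * C x"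
    "2 * z x * w x = p x" if "x \<in> ?S" for x
    using eh_conn_real_section[OF t[OF that] pp[OF that]] unfolding z_def w_div by auto
  have conn: "eh_conn (f x) (z x) (w x) (fderiv z x v) (fderiv w x v)
      = \<epsilon> * (A0 (\<epsilon> *\<^sub>R e) x \<bullet> v)" if x: "x \<in> ?S" for x v
  proof -
    have xU: "x \<in> U" using x SU by auto
    define dt where "dt = fderiv t x"
    define dp where "dp = fderiv p x"
    have Dt: "(t has_derivative dt) (at x)" and Dp: "(p has_derivative dp) (at x)"
      unfolding dt_def dp_def by (rule smooth_on_has_derivative[OF _ x], simp add: St Sp)+
    have D\<kappa>: "(\<kappa> has_derivative fderiv \<kappa> x) (at x)"
      by (rule smooth_on_has_derivative[OF smooth_\<kappa> xU])
    have "(z has_derivative (\<lambda>v. of_real (dt v))) (at x)"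
      unfolding z_def by (auto intro!: derivative_eq_intros Dt)
    then have dz: "fderiv z x = (\<lambda>v. of_real (dt v))" by (rule frechet_derivative_eqI)
    have "(w has_derivative (\<lambda>v. dp v / (2 * of_real (t x))
        - p x * of_real (dt v) / (2 * of_real ((t x)^2)))) (at x)"
      unfolding w_def using t(1)[OF x]
      by (auto intro!: derivative_eq_intros Dt Dp simp: field_simps power2_eq_square)
    then have dw: "fderiv w x = (\<lambda>v. dp v / (2 * of_real (t x))
        - p x * of_real (dt v) / (2 * of_real ((t x)^2)))" by (rule frechet_derivative_eqI)
    have "((\<lambda>x. of_real (\<kappa> x) * p x) has_derivative
      (\<lambda>v. of_real (fderiv \<kappa> x v) * p x + of_real (\<kappa> x) * dp v)) (at x)"
      by (auto intro!: derivative_eq_intros D\<kappa> Dp)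
    moreover have "of_real (\<kappa> x) * p x = P x" if "x \<in> ?S" for x
      using \<kappa>0[OF that] by (simp add: p_def)
    ultimately have "(P has_derivative
      (\<lambda>v. of_real (fderiv \<kappa> x v) * p x + of_real (\<kappa> x) * dp v)) (at x)"
      by (rule has_derivative_transform_within_open[OF _ o x])
    then have "(\<lambda>v. Complex (v \<bullet> e1) (v \<bullet> e2)) =
        (\<lambda>v. of_real (fderiv \<kappa> x v) * p x + of_real (\<kappa> x) * dp v)"
      using P_derivative[OF has_derivative_ident] by (rule has_derivative_unique[rotated])
    then have dP: "Complex (v \<bullet> e1) (v \<bullet> e2) =
        of_real (fderiv \<kappa> x v) * p x + of_real (\<kappa> x) * dp v" by (rule fun_cong)
    have j: "Im (cnj (P x) * Complex (v \<bullet> e1) (v \<bullet> e2)) = (\<kappa> x)^2 * Im (cnj (p x) * dp v)"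
    proof -
      have "P x = of_real (\<kappa> x) * p x" using \<kappa>0[OF x] by (simp add: p_def)
      then show ?thesis unfolding dP by (simp add: power2_eq_square algebra_simps)
    qed
    have q: "0 < 1 + \<epsilon> * C x" using x by (simp add: string_free_def)
    have K: "0 < (\<rho> x)^2 - c^2" "0 < \<rho> x" "0 < (\<rho> x)^2 - c^2 * (C x)^2"
      using K_pos \<rho>_pos D_pos xU by auto
    define N where "N = (\<rho> x)^2 + \<epsilon> * c^2 * C x"
    have "\<epsilon>^2 = 1" using \<epsilon> by auto
    have den: "1 - (\<epsilon> * C x)^2 + f x * (\<epsilon> * C x)^2 = ((\<rho> x)^2 - c^2 * (C x)^2) / (\<rho> x)^2"
      unfolding power_mult_distrib \<open>\<epsilon>^2 = 1\<close> using K by (simp add: f_def field_simps)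
    have num: "f x * (\<epsilon> * C x) / (1 + \<epsilon> * C x) - 1
        = - (N / ((\<rho> x)^2 * (1 + \<epsilon> * C x)))"
      using K q unfolding f_def N_def by (simp add: divide_simps) (simp add: algebra_simps)
    have "eh_conn (f x) (z x) (w x) (fderiv z x v) (fderiv w x v)
      = 2 * Im (cnj (p x) * dp v) * (f x * (\<epsilon> * C x) / (1 + \<epsilon> * C x) - 1)
         / (1 - (\<epsilon> * C x)^2 + f x * (\<epsilon> * C x)^2)"
      unfolding dz dw z_def w_div using eh_conn_real_section(4)[OF t[OF x] pp[OF x]] by simp
    also have "\<dots> = - (2 * Im (cnj (p x) * dp v) * N)
        / ((1 + \<epsilon> * C x) * ((\<rho> x)^2 - c^2 * (C x)^2))"
      unfolding den num using K q by (simp del: times_complex.simps)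
    also have "\<dots> = \<epsilon> * (A0 (\<epsilon> *\<^sub>R e) x \<bullet> v)"
    proof -
      have "\<epsilon> * (- \<epsilon> * X * Y) = - (X * Y)" for X Y :: real using \<epsilon> by auto
      then show ?thesis
        unfolding A0_inner[OF \<epsilon> x] j \<kappa>_sq[OF xU] N_def[symmetric]
        using K(1) by (simp del: times_complex.simps)
    qed
    finally show ?thesis .
  qed
  have \<kappa>p: "of_real (\<kappa> x) * p x = P x" if "x \<in> ?S" for x using \<kappa>0[OF that] by (simp add: p_def)
  show ?thesis
  proof (cases "\<epsilon> = 1")
    case True
    show ?thesis
    proof (rule that[OF Sz Sw])
      show "hopf_lift (z x) (w x) x" if "x \<in> ?S" for x
        using sec[OF that] \<kappa>p[OF that] True by (simp add: hopf_lift_def)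
    qed (use conn True in simp)
  next
    case False
    then have m: "\<epsilon> = - 1" using \<epsilon> by auto
    show ?thesis
    proof (rule that[OF Sw Sz])
      show "hopf_lift (w x) (z x) x" if "x \<in> ?S" for x
        using sec[OF that] \<kappa>p[OF that] m by (simp add: hopf_lift_def mult.commute mult.left_commute)
      show "eh_conn (f x) (w x) (z x) (fderiv w x v) (fderiv z x v)
        = A0 (\<epsilon> *\<^sub>R e) x \<bullet> v" if "x \<in> ?S" for x v
        by (subst eh_conn_swap) (use conn[OF that, of v] m in simp)
    qed
  qed
qed

end

section \<open>Euler angles as local coordinates\<close>

text \<open>A branch of the argument centred at \<open>\<alpha>\<close>, smooth on the open
  half-plane about that direction; moving the centre is what keeps the cut away from any given
  point.\<close>

definition local_arg :: "real \<Rightarrow> complex \<Rightarrow> real" where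
  "local_arg \<alpha> z = \<alpha> + arctan (Im (z * cis (- \<alpha>)) / Re (z * cis (- \<alpha>)))"

lemma local_arg:
  assumes "0 < Re (z * cis (- \<alpha>))"
  shows "cmod z * cis (local_arg \<alpha> z) = z"
proof -
  define u where "u = z * cis (- \<alpha>)"
  have u: "0 < Re u" using assms by (simp add: u_def)
  have n: "cmod u = Re u * sqrt (1 + (Im u / Re u)^2)"
  proof -
    have "(cmod u)^2 = (Re u)^2 * (1 + (Im u / Re u)^2)"
      using u by (simp add: cmod_power2 field_simps)
    then show ?thesis
      using u by (metis norm_ge_zero real_sqrt_abs abs_of_pos real_sqrt_mult real_sqrt_unique)
  qed
  have pos: "0 < sqrt (1 + (Im u / Re u)^2)" by (simp add: add_pos_nonneg)
  have "cmod u * cis (arctan (Im u / Re u)) = u"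
    using u pos by (simp add: complex_eq_iff n cos_arctan sin_arctan)
  then have "cmod z * (cis \<alpha> * cis (arctan (Im u / Re u))) = (cis (- \<alpha>) * cis \<alpha>) * z"
    by (simp add: u_def norm_mult mult.commute mult.left_commute)
  then show ?thesis by (simp add: local_arg_def u_def cis_mult)
qed

lemma local_arg_cis: "0 < Re (z * cis (- \<alpha>)) \<Longrightarrow> cmod z = 1 \<Longrightarrow> cis (local_arg \<alpha> z) = z"
  using local_arg[of z \<alpha>] by simp

lemma smooth_on_local_arg:
  fixes f :: "'a::real_normed_vector \<Rightarrow> complex"
  assumes "open S" "smooth_on S f" "\<And>x. x \<in> S \<Longrightarrow> 0 < Re (f x * cis (- \<alpha>))"
  shows "smooth_on S (\<lambda>x. local_arg \<alpha> (f x))"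
proof -
  have nz: "Re (f x * cis (- \<alpha>)) \<noteq> 0" if "x \<in> S" for x using assms(3)[OF that] by simp
  show ?thesis
    unfolding local_arg_def
    by (intro smooth_intros assms(1,2) nz)
qed

text \<open>The parametrisation before the sphere is divided by the sign: its values lie in a normed
  space and can be differentiated.\<close>

definition eh_map :: "complex \<times> complex \<Rightarrow> eh_coords \<Rightarrow> real \<times> complex \<times> complex" where
  "eh_map g = (\<lambda>(r, \<theta>, \<phi>, \<eta>). (r, su2_translate g (euler \<theta> \<phi> \<eta>)))"

definition eh_dom :: "real \<Rightarrow> eh_coords set" where
  "eh_dom a = {(r, \<theta>, \<phi>, \<eta>). a < r \<and> 0 < \<theta> \<and> \<theta> < pi}"

lemma open_eh_dom: "open (eh_dom a)"
proof -
  have "eh_dom a = {a<..} \<times> {0<..<pi} \<times> UNIV \<times> UNIV" by (auto simp: eh_dom_def)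
  then show ?thesis by (simp add: open_Times)
qed

lemma sphere_Pair: "g \<in> sphere 0 1 \<longleftrightarrow> (cmod (fst g))^2 + (cmod (snd g))^2 = 1" for g :: "complex \<times> complex"
  by (simp add: norm_prod_def)

lemma smooth_eh_map: "smooth_on UNIV (eh_map g)"
proof -
  obtain \<alpha> \<beta> where g: "g = (\<alpha>, \<beta>)" by (cases g)
  have eq: "eh_map g = (\<lambda>u. (fst u,
      \<alpha> * (of_real (cos (fst (snd u) * (1 / 2))) * cis ((snd (snd (snd u)) + fst (snd (snd u))) * (1 / 2)))
      - cnj \<beta> * (of_real (sin (fst (snd u) * (1 / 2))) * cis ((snd (snd (snd u)) - fst (snd (snd u))) * (1 / 2))),
      \<beta> * (of_real (cos (fst (snd u) * (1 / 2))) * cis ((snd (snd (snd u)) + fst (snd (snd u))) * (1 / 2)))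
      + cnj \<alpha> * (of_real (sin (fst (snd u) * (1 / 2))) * cis ((snd (snd (snd u)) - fst (snd (snd u))) * (1 / 2)))))"
    by (auto simp: eh_map_def euler_def g)
  show ?thesis
    unfolding eq
    by (intro smooth_intros open_UNIV)
qed

lemma eh_map_sphere:
  assumes "g \<in> sphere 0 1"
  shows "snd (eh_map g u) \<in> sphere 0 1"
proof -
  obtain \<alpha> \<beta> where g: "g = (\<alpha>, \<beta>)" by (cases g)
  obtain z w where q: "euler (fst (snd u)) (fst (snd (snd u))) (snd (snd (snd u))) = (z, w)"
    by (cases "euler (fst (snd u)) (fst (snd (snd u))) (snd (snd (snd u)))")
  have 1: "(cmod z)^2 + (cmod w)^2 = 1"
    using q by (auto simp: euler_def norm_mult)
  have "complex_of_real ((cmod (\<alpha> * z - cnj \<beta> * w))^2 + (cmod (\<beta> * z + cnj \<alpha> * w))^2)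
      = of_real (((cmod \<alpha>)^2 + (cmod \<beta>)^2) * ((cmod z)^2 + (cmod w)^2))"
    unfolding of_real_add of_real_mult complex_norm_square by (simp add: algebra_simps)
  then have "(cmod (\<alpha> * z - cnj \<beta> * w))^2 + (cmod (\<beta> * z + cnj \<alpha> * w))^2 = 1"
    using assms 1 unfolding of_real_eq_iff sphere_Pair g by simp
  then show ?thesis
    using q by (simp add: sphere_Pair eh_map_def g case_prod_beta del: mem_sphere mem_sphere_0)
qed

text \<open>Only the line through \<open>u\<close> in direction \<open>du\<close> matters. Along it
  \<open>euler_forms\<close> expresses the three forms by the moving point of the sphere, and their
  squares combine to those of \<open>hopf_\<beta>\<close> and \<open>hopf_s\<close>.\<close>

lemma eh_ds2_eq_eh_line:
  assumes g: "g \<in> sphere 0 1" and D: "(eh_map g has_derivative Q') (at u)"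
  shows "eh_ds2 a u du = eh_line a (fst u) (fst (snd (eh_map g u))) (snd (snd (eh_map g u)))
    (fst du) (fst (snd (Q' du))) (snd (snd (Q' du)))"
proof -
  obtain r \<theta> \<phi> \<eta> where u: "u = (r, \<theta>, \<phi>, \<eta>)" by (metis surj_pair)
  obtain dr d\<theta> d\<phi> d\<eta> where du: "du = (dr, d\<theta>, d\<phi>, d\<eta>)" by (metis surj_pair)
  define q where "q s = su2_translate g (euler (\<theta> + s * d\<theta>) (\<phi> + s * d\<phi>) (\<eta> + s * d\<eta>))" for s
  have lin: "((\<lambda>s. x + s * dx) has_real_derivative dx) (at 0)" for x dx :: real
    by (auto intro!: derivative_eq_intros)
  obtain dz dw where dq: "(q has_vector_derivative (dz, dw)) (at 0)"
    and 1: "\<sigma>1 u du = - Re (fst (q 0) * dw - snd (q 0) * dz)"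
    and 2: "\<sigma>2 u du = Im (fst (q 0) * dw - snd (q 0) * dz)"
    and 3: "\<sigma>3 u du = - Im (cnj (fst (q 0)) * dz + cnj (snd (q 0)) * dw)"
    using euler_forms[OF lin[of \<theta> d\<theta>] lin[of \<phi> d\<phi>] lin[of \<eta> d\<eta>] g, of r dr]
    unfolding q_def u du by auto
  have q0: "q 0 = snd (eh_map g u)" by (simp add: q_def eh_map_def u)
  have "((\<lambda>s. u + s *\<^sub>R du) has_derivative (\<lambda>s. s *\<^sub>R du)) (at 0)"
    by (auto intro!: derivative_eq_intros)
  then have "((\<lambda>s. eh_map g (u + s *\<^sub>R du)) has_derivative (\<lambda>s. Q' (s *\<^sub>R du))) (at 0)"
    using has_derivative_compose[of "\<lambda>s. u + s *\<^sub>R du" "\<lambda>s. s *\<^sub>R du" 0 UNIV "eh_map g" Q'] D by simp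
  then have "((\<lambda>s. snd (eh_map g (u + s *\<^sub>R du))) has_derivative (\<lambda>s. snd (Q' (s *\<^sub>R du)))) (at 0)"
    by (rule has_derivative_snd)
  moreover have "(\<lambda>s. snd (eh_map g (u + s *\<^sub>R du))) = q"
    by (simp add: q_def eh_map_def u du fun_eq_iff)
  ultimately have "(q has_derivative (\<lambda>s. snd (Q' (s *\<^sub>R du)))) (at 0)" by simp
  then have "(\<lambda>s. snd (Q' (s *\<^sub>R du))) = (\<lambda>s. s *\<^sub>R (dz, dw))"
    using dq has_derivative_unique unfolding has_vector_derivative_def by blast
  from fun_cong[OF this, of 1] have d: "snd (Q' du) = (dz, dw)" by simp
  have "(\<sigma>1 u du)^2 + (\<sigma>2 u du)^2 = (cmod (hopf_\<beta> (fst (q 0)) (snd (q 0)) dz dw))^2"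
    unfolding 1 2 hopf_\<beta>_def cmod_power2 power2_minus ..
  moreover have "(\<sigma>3 u du)^2 = (hopf_s (fst (q 0)) (snd (q 0)) dz dw)^2"
    unfolding 3 hopf_s_def power2_minus ..
  ultimately show ?thesis
    unfolding eh_ds2_def eh_line_def Let_def d q0[symmetric] fst_conv snd_conv by simp
qed

text \<open>A smooth local right inverse of the parametrisation. It is defined on an open set of the
  ambient space, not just of the sphere, so that it can be composed with maps by the ordinary chain
  rule.\<close>

lemma eh_chart:
  assumes "a < r0" "q0 \<in> sphere 0 1"
  obtains g Ob E where "g \<in> sphere 0 1" "open Ob" "(r0, q0) \<in> Ob" "smooth_on Ob E"
    "\<And>r q. (r, q) \<in> Ob \<Longrightarrow> a < r \<Longrightarrow> q \<in> sphere 0 1 \<Longrightarrow> E (r, q) \<in> eh_dom a \<and> eh_map g (E (r, q)) = (r, q)"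
proof -
  have "(r0, {q0, - q0}) \<in> points (eguchi_hanson a)"
    unfolding points_eguchi_hanson using assms by auto
  then obtain g \<theta>0 \<phi>0 \<eta>0' where g: "g \<in> sphere 0 1" and \<theta>0: "0 < \<theta>0" "\<theta>0 < pi"
    and "{su2_translate g (euler \<theta>0 \<phi>0 \<eta>0'), - su2_translate g (euler \<theta>0 \<phi>0 \<eta>0')} = {q0, - q0}"
    unfolding points_def eguchi_hanson_def Let_def by (auto simp del: mem_sphere mem_sphere_0)
  then have "q0 = su2_translate g (euler \<theta>0 \<phi>0 \<eta>0') \<or> q0 = - su2_translate g (euler \<theta>0 \<phi>0 \<eta>0')"
    by (auto simp: doubleton_eq_iff)
  \<comment> \<open>The patch determines its point only up to sign; adding \<open>2\<pi>\<close> to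
    the last angle changes the sign, so \<open>q0\<close> itself is reached.\<close>
  moreover have "- su2_translate g (euler \<theta>0 \<phi>0 \<eta>0') = su2_translate g (euler \<theta>0 \<phi>0 (\<eta>0' + 2 * pi))"
  proof -
    have "cis ((\<eta>0' + 2 * pi + x) / 2) = - cis ((\<eta>0' + x) / 2)" for x
      using cis_mult[of "(\<eta>0' + x) / 2" pi] by (simp add: field_simps)
    from this[of \<phi>0] this[of "- \<phi>0"] show ?thesis by (cases g) (simp add: euler_def)
  qed
  ultimately obtain \<eta>0 where q0: "q0 = su2_translate g (euler \<theta>0 \<phi>0 \<eta>0)" by metis
  obtain \<alpha> \<beta> where gab: "g = (\<alpha>, \<beta>)" by (cases g)
  have "(cmod \<alpha>)^2 + (cmod \<beta>)^2 = 1" using g by (simp add: gab sphere_Pair del: mem_sphere mem_sphere_0)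
  then have ab: "\<alpha> * cnj \<alpha> + \<beta> * cnj \<beta> = 1"
    by (metis complex_norm_square of_real_1 of_real_add)
  \<comment> \<open>The inverse of \<open>g\<close> in SU(2), which brings the point back to plain
    Euler coordinates.\<close>
  define gi where "gi = (cnj \<alpha>, - \<beta>)"
  have inv1: "su2_translate gi (su2_translate g q) = q" for q
  proof (cases q)
    case (Pair z w)
    have "su2_translate gi (su2_translate g q) = ((\<alpha> * cnj \<alpha> + \<beta> * cnj \<beta>) * z, (\<alpha> * cnj \<alpha> + \<beta> * cnj \<beta>) * w)"
      by (simp add: Pair gi_def gab algebra_simps)
    then show ?thesis by (simp add: ab Pair)
  qed
  have inv2: "su2_translate g (su2_translate gi q) = q" for q
  proof (cases q)
    case (Pair z w)
    have "su2_translate g (su2_translate gi q) = ((\<alpha> * cnj \<alpha> + \<beta> * cnj \<beta>) * z, (\<alpha> * cnj \<alpha> + \<beta> * cnj \<beta>) * w)"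
      by (simp add: Pair gi_def gab algebra_simps)
    then show ?thesis by (simp add: ab Pair)
  qed
  define Zc where "Zc y = cnj \<alpha> * fst (snd y) + cnj \<beta> * snd (snd y)" for y :: "real \<times> complex \<times> complex"
  define Wc where "Wc y = - \<beta> * fst (snd y) + \<alpha> * snd (snd y)" for y :: "real \<times> complex \<times> complex"
  have gi_eq: "su2_translate gi q = (Zc (r, q), Wc (r, q))" for r q
    by (cases q) (simp add: gi_def Zc_def Wc_def)
  define \<alpha>0 where "\<alpha>0 = (\<eta>0 + \<phi>0) / 2"
  define \<beta>0 where "\<beta>0 = (\<eta>0 - \<phi>0) / 2"
  define Ob where "Ob = {y. 0 < Re (Zc y * cis (- \<alpha>0)) \<and> 0 < Re (Wc y * cis (- \<beta>0))}"
  \<comment> \<open>The moduli of the two coordinates are the cosine and sine of half the first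
    angle, and their arguments are half the sum and half the difference of the other two; hence the
    difference and the sum of \<open>A\<close> and \<open>B\<close> in \<open>E\<close>.\<close>
  define \<tau> where "\<tau> y = 2 * arctan (sqrt (Wc y \<bullet> Wc y) / sqrt (Zc y \<bullet> Zc y))" for y
  define A where "A y = local_arg \<alpha>0 (Zc y)" for y
  define B where "B y = local_arg \<beta>0 (Wc y)" for y
  define E where "E y = (fst y, \<tau> y, A y - B y, A y + B y)" for y
  have sZ: "smooth_on S Zc" and sW: "smooth_on S Wc" if "open S" for S
    unfolding Zc_def Wc_def
    by (intro smooth_intros that)+
  have o: "open Ob"
    unfolding Ob_def using smooth_on_continuous[OF sZ[OF open_UNIV]] smooth_on_continuous[OF sW[OF open_UNIV]]
    by (intro open_Collect_conj open_Collect_less continuous_intros)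
  have pos: "0 < Zc y \<bullet> Zc y" "0 < Wc y \<bullet> Wc y" if "y \<in> Ob" for y
    using that by (auto simp: Ob_def)
  have nz: "sqrt (Zc y \<bullet> Zc y) \<noteq> 0" if "y \<in> Ob" for y using pos(1)[OF that] by simp
  have sA: "smooth_on Ob A" and sB: "smooth_on Ob B"
    unfolding A_def B_def
    by (rule smooth_on_local_arg[OF o sZ[OF o]] smooth_on_local_arg[OF o sW[OF o]];
        simp only: Ob_def mem_Collect_eq)+
  have sE: "smooth_on Ob E"
    unfolding E_def \<tau>_def
    by (intro smooth_intros sA sB sZ sW o pos nz)
  have in0: "(r0, q0) \<in> Ob"
  proof -
    have "(Zc (r0, q0), Wc (r0, q0)) = euler \<theta>0 \<phi>0 \<eta>0"
      unfolding gi_eq[symmetric] q0 inv1 ..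
    then have "Zc (r0, q0) = of_real (cos (\<theta>0 / 2)) * cis \<alpha>0" "Wc (r0, q0) = of_real (sin (\<theta>0 / 2)) * cis \<beta>0"
      by (simp_all add: euler_def \<alpha>0_def \<beta>0_def)
    then have "Zc (r0, q0) * cis (- \<alpha>0) = of_real (cos (\<theta>0 / 2))"
      "Wc (r0, q0) * cis (- \<beta>0) = of_real (sin (\<theta>0 / 2))"
      by (simp_all add: mult.assoc cis_mult)
    then show ?thesis
      using \<theta>0 unfolding Ob_def mem_Collect_eq by (simp add: cos_gt_zero_pi sin_gt_zero)
  qed
  have chart: "E (r, q) \<in> eh_dom a \<and> eh_map g (E (r, q)) = (r, q)"
    if y: "(r, q) \<in> Ob" and r: "a < r" and q: "q \<in> sphere 0 1" for r q
  proof -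
    let ?Z = "Zc (r, q)" and ?W = "Wc (r, q)"
    have n: "sqrt (?Z \<bullet> ?Z) = cmod ?Z" "sqrt (?W \<bullet> ?W) = cmod ?W" by (simp_all add: norm_eq_sqrt_inner)
    have Zp: "0 < cmod ?Z" and Wp: "0 < cmod ?W" using pos[OF y] by auto
    have one: "(cmod ?Z)^2 + (cmod ?W)^2 = 1"
    proof -
      have "complex_of_real ((cmod ?Z)^2 + (cmod ?W)^2)
        = (\<alpha> * cnj \<alpha> + \<beta> * cnj \<beta>) * of_real ((cmod (fst q))^2 + (cmod (snd q))^2)"
        unfolding of_real_add complex_norm_square Zc_def Wc_def by (simp add: algebra_simps)
      also have "(cmod (fst q))^2 + (cmod (snd q))^2 = 1" using q by (simp add: sphere_Pair del: mem_sphere mem_sphere_0)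
      finally show ?thesis unfolding ab by (simp only: mult_1 of_real_eq_iff)
    qed
    define x where "x = cmod ?W / cmod ?Z"
    have x: "0 < x" using Zp Wp by (simp add: x_def)
    have "1 + x^2 = 1 / (cmod ?Z)^2" using Zp one by (simp add: x_def field_simps)
    then have sx: "sqrt (1 + x^2) = 1 / cmod ?Z" using Zp by (simp add: real_sqrt_divide)
    have \<tau>: "\<tau> (r, q) = 2 * arctan x" by (simp add: \<tau>_def n x_def)
    have cos: "cos (\<tau> (r, q) / 2) = cmod ?Z" by (simp add: \<tau> cos_arctan sx)
    have sin: "sin (\<tau> (r, q) / 2) = cmod ?W" using Zp by (simp add: \<tau> sin_arctan sx) (simp add: x_def)
    have "arctan x < pi / 2" by (rule arctan_ubound)
    then have dom: "E (r, q) \<in> eh_dom a" using r x by (simp add: E_def eh_dom_def \<tau>)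
    have "euler (\<tau> (r, q)) (A (r, q) - B (r, q)) (A (r, q) + B (r, q)) = (?Z, ?W)"
      using local_arg[OF conjunct1[OF y[unfolded Ob_def mem_Collect_eq]]]
        local_arg[OF conjunct2[OF y[unfolded Ob_def mem_Collect_eq]]]
      by (simp add: euler_def cos sin A_def B_def)
    then have "eh_map g (E (r, q)) = (r, su2_translate g (su2_translate gi q))"
      unfolding gi_eq[of q r] by (simp add: eh_map_def E_def)
    then show ?thesis using dom inv2 by simp
  qed
  show ?thesis by (rule that[OF g o in0 sE chart])
qed

section \<open>Lifts to Eguchi-Hanson space\<close>

definition rot :: "real \<Rightarrow> complex \<times> complex \<Rightarrow> complex \<times> complex" where
  "rot \<psi> q = (cis (\<psi> / 4) * fst q, cis (- (\<psi> / 4)) * snd q)"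

lemma rot_rot: "rot \<psi> (rot \<psi>' q) = rot (\<psi> + \<psi>') q"
  by (simp add: rot_def cis_mult add_divide_distrib flip: mult.assoc)

lemma rot_0: "rot 0 q = q"
  by (simp add: rot_def)

text \<open>Freeness of the action of the circle of length \<open>4\<pi>\<close> on pairs {q, -q}:
  one nonzero coordinate already forces the phase to be 1 or -1.\<close>

lemma rot_eq_iff:
  assumes "q \<noteq> 0"
  shows "rot \<psi> q = q \<or> rot \<psi> q = - q \<longleftrightarrow> (\<exists>k::int. \<psi> = 4 * pi * of_int k)"
proof -
  have "rot \<psi> q = q \<or> rot \<psi> q = - q \<longleftrightarrow> sin (\<psi> / 4) = 0"
  proof
    assume "rot \<psi> q = q \<or> rot \<psi> q = - q"
    moreover have "fst q \<noteq> 0 \<or> snd q \<noteq> 0" using assms by (auto simp: prod_eq_iff)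
    moreover have "x = 1 \<or> x = - 1" if "x * z = z \<or> x * z = - z" "z \<noteq> 0" for x z :: complex
      using that by (metis mult_cancel_right mult_minus1 mult_1)
    ultimately have "cis (\<psi> / 4) \<in> {1, - 1} \<or> cis (- (\<psi> / 4)) \<in> {1, - 1}"
      unfolding rot_def prod_eq_iff by fastforce
    then show "sin (\<psi> / 4) = 0" by (auto simp: complex_eq_iff)
  next
    assume s: "sin (\<psi> / 4) = 0"
    then have "cos (\<psi> / 4) = 1 \<or> cos (\<psi> / 4) = - 1" using sin_zero_abs_cos_one by fastforce
    then have "cis (\<psi> / 4) = 1 \<and> cis (- (\<psi> / 4)) = 1 \<or> cis (\<psi> / 4) = - 1 \<and> cis (- (\<psi> / 4)) = - 1"
      using s by (auto simp: complex_eq_iff)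
    then show "rot \<psi> q = q \<or> rot \<psi> q = - q" by (auto simp: rot_def prod_eq_iff)
  qed
  also have "\<dots> \<longleftrightarrow> (\<exists>k::int. \<psi> = 4 * pi * of_int k)"
    unfolding sin_zero_iff_int2 by (auto simp: field_simps)
  finally show ?thesis .
qed

lemma rot_4pi: "rot (4 * pi) q = - q"
  by (simp add: rot_def prod_eq_iff complex_eq_iff)

lemma norm_rot: "norm (rot \<psi> q) = norm q"
  by (simp add: rot_def norm_prod_def norm_mult)

lemma smooth_on_rot:
  fixes L :: "'a::real_normed_vector \<Rightarrow> complex \<times> complex"
  assumes "open S" "smooth_on S \<tau>" "smooth_on S L"
  shows "smooth_on S (\<lambda>y. rot (\<tau> y) (L y))"
proof -
  have eq: "(\<lambda>y. rot (\<tau> y) (L y)) = (\<lambda>y. (cis (\<tau> y * (1 / 4)) * fst (L y), cis (- (\<tau> y * (1 / 4))) * snd (L y)))"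
    by (simp add: rot_def)
  show ?thesis
    unfolding eq
    by (intro smooth_intros assms)
qed

lemma has_derivative_cis:
  assumes "(f has_derivative f') (at y)"
  shows "((\<lambda>y. cis (f y)) has_derivative (\<lambda>v. \<i> * of_real (f' v) * cis (f y))) (at y)"
proof -
  have "(cis has_vector_derivative \<i> * cis x) (at x)" for x
    unfolding has_vector_derivative_complex_iff by (auto intro!: derivative_eq_intros)
  then have "(cis has_derivative (\<lambda>t. t *\<^sub>R (\<i> * cis x))) (at x)" for x
    by (simp add: has_vector_derivative_def)
  from has_derivative_compose[OF assms this] show ?thesis
    by (simp add: scaleR_conv_of_real mult.commute mult.left_commute)
qed

lemma rot_has_derivative:
  assumes \<tau>: "(\<tau> has_derivative \<tau>') (at y)" and L: "(L has_derivative L') (at y)"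
  shows "((\<lambda>y. rot (\<tau> y) (L y)) has_derivative
    (\<lambda>v. (cis (\<tau> y / 4) * (fst (L' v) + \<i> * of_real (\<tau>' v / 4) * fst (L y)),
          cis (- (\<tau> y / 4)) * (snd (L' v) - \<i> * of_real (\<tau>' v / 4) * snd (L y))))) (at y)"
proof -
  have 1: "((\<lambda>y. cis (\<tau> y / 4)) has_derivative (\<lambda>v. \<i> * of_real (\<tau>' v / 4) * cis (\<tau> y / 4))) (at y)"
    by (rule has_derivative_cis) (auto intro!: derivative_eq_intros \<tau>)
  have 2: "((\<lambda>y. cis (- (\<tau> y / 4))) has_derivative (\<lambda>v. \<i> * of_real (- (\<tau>' v / 4)) * cis (- (\<tau> y / 4)))) (at y)"
    by (rule has_derivative_cis) (auto intro!: derivative_eq_intros \<tau>)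
  show ?thesis
    unfolding rot_def
    by (rule has_derivative_eq_rhs[OF has_derivative_Pair[OF
          has_derivative_mult[OF 1 has_derivative_fst[OF L]] has_derivative_mult[OF 2 has_derivative_snd[OF L]]]])
      (simp add: fun_eq_iff algebra_simps)
qed

lemma eh_conn_rot:
  assumes "(cmod (fst q))^2 + (cmod (snd q))^2 = 1" "0 < f"
  shows "eh_conn f (fst (rot \<psi> q)) (snd (rot \<psi> q))
      (cis (\<psi> / 4) * (dz + \<i> * of_real (d\<psi> / 4) * fst q)) (cis (- (\<psi> / 4)) * (dw - \<i> * of_real (d\<psi> / 4) * snd q))
    = eh_conn f (fst q) (snd q) dz dw + d\<psi>"
  using eh_conn_rotate[OF assms, of "cis (\<psi> / 4)" dz "d\<psi> / 4" dw]
  by (simp add: rot_def cis_cnj)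

definition eh_metric :: "real \<Rightarrow> real \<times> complex \<times> complex \<Rightarrow> real \<times> complex \<times> complex \<Rightarrow> real" where
  "eh_metric a y dy = eh_line a (fst y) (fst (snd y)) (snd (snd y)) (fst dy) (fst (snd dy)) (snd (snd dy))"

lemma eh_ds2_eq_eh_metric:
  assumes "g \<in> sphere 0 1" "(eh_map g has_derivative Q') (at u)"
  shows "eh_ds2 a u du = eh_metric a (eh_map g u) (Q' du)"
proof -
  have f: "(\<lambda>u. fst (eh_map g u)) = fst" by (auto simp: eh_map_def)
  have "(fst has_derivative (\<lambda>v. fst (Q' v))) (at u)"
    using has_derivative_fst[OF assms(2)] unfolding f .
  moreover have "(fst has_derivative fst) (at u)"
    by (rule bounded_linear_imp_has_derivative[OF bounded_linear_fst])
  ultimately have "(\<lambda>v. fst (Q' v)) = fst" by (rule has_derivative_unique)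
  then have "fst (Q' du) = fst du" by (rule fun_cong)
  moreover have "fst (eh_map g u) = fst u" using fun_cong[OF f, of u] .
  ultimately show ?thesis
    using eh_ds2_eq_eh_line[OF assms] by (simp add: eh_metric_def)
qed

text \<open>By the equality case of Cauchy-Schwarz, the sum of \<open>norm v\<close> and
  \<open>u \<bullet> v\<close> vanishes only on the ray spanned by \<open>- u\<close>. If a point of
  the segment from \<open>u\<close> to \<open>y\<close> lay on this ray, solving for
  \<open>t *\<^sub>R y\<close> would put \<open>y\<close> on it too, unless \<open>t = 0\<close>,
  and \<open>u\<close> itself is not on it.\<close>

lemma starlike_string_complement:
  fixes u y :: "'a::real_inner"
  assumes u: "norm u = 1" and y: "0 < norm y + u \<bullet> y" and t: "0 \<le> t" "t \<le> 1"
  shows "0 < norm ((1 - t) *\<^sub>R u + t *\<^sub>R y) + u \<bullet> ((1 - t) *\<^sub>R u + t *\<^sub>R y)"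
proof (rule ccontr)
  define v where "v = (1 - t) *\<^sub>R u + t *\<^sub>R y"
  assume "\<not> ?thesis"
  then have *: "norm v + u \<bullet> v \<le> 0" by (simp add: v_def)
  have "\<bar>u \<bullet> v\<bar> \<le> norm u * norm v" by (rule Cauchy_Schwarz_ineq2)
  then have "- u \<bullet> v = norm (- u) * norm v" using * u by simp
  then have v: "v = - norm v *\<^sub>R u"
    using norm_cauchy_schwarz_eq[of "- u" v] u by simp
  then have ty: "t *\<^sub>R y = - (norm v + 1 - t) *\<^sub>R u"
    by (simp add: v_def algebra_simps)
  have n: "0 \<le> norm v + 1 - t" using t by (simp add: add_nonneg_nonneg add_diff_eq[symmetric])
  have "t * norm y = norm (t *\<^sub>R y)" using t by simp
  also have "\<dots> = norm v + 1 - t" unfolding ty using n u by simp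
  finally have 1: "t * norm y = norm v + 1 - t" .
  have "t * (u \<bullet> y) = u \<bullet> (t *\<^sub>R y)" by simp
  also have "\<dots> = - (norm v + 1 - t)" unfolding ty using u by (simp add: dot_square_norm)
  finally have "t * (norm y + u \<bullet> y) = 0" using 1 by (simp add: algebra_simps)
  then have "t = 0" using y by simp
  then have "v = u" by (simp add: v_def)
  then have "u = - u" using v u by simp
  then have "2 *\<^sub>R u = 0" by (simp add: scaleR_2 eq_neg_iff_add_eq_0)
  then show False using u by simp
qed

section \<open>Projection to the base and lifts of the connection\<close>

context two_centers
begin

lemma hopf_lift_norm: "hopf_lift z w x \<Longrightarrow> (cmod z)^2 + (cmod w)^2 = 1"
  by (simp add: hopf_lift_def)

lemma hopf_lift_nonzero: "hopf_lift (fst q) (snd q) x \<Longrightarrow> q \<noteq> 0"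
  using hopf_lift_norm by fastforce

lemma hopf_lift_sphere: "hopf_lift (fst q) (snd q) x \<Longrightarrow> q \<in> sphere 0 1"
  unfolding sphere_Pair by (rule hopf_lift_norm)

lemma hopf_lift_rot: "hopf_lift (fst (rot \<psi> q)) (snd (rot \<psi> q)) x \<longleftrightarrow> hopf_lift (fst q) (snd q) x"
proof -
  have "fst (rot \<psi> q) * snd (rot \<psi> q) = (cis (\<psi> / 4) * cis (- (\<psi> / 4))) * (fst q * snd q)"
    by (simp add: rot_def)
  then have "2 * fst (rot \<psi> q) * snd (rot \<psi> q) = 2 * fst q * snd q"
    by (simp only: mult.assoc cis_mult) simp
  moreover have "cmod (fst (rot \<psi> q)) = cmod (fst q)" "cmod (snd (rot \<psi> q)) = cmod (snd q)"
    by (simp_all add: rot_def norm_mult)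
  ultimately show ?thesis by (simp only: hopf_lift_def)
qed

lemma hopf_lift_unit:
  assumes "x \<in> U" "hopf_lift (fst q) (snd q) x" "hopf_lift (fst q') (snd q') x"
  defines "\<zeta> \<equiv> fst q' * cnj (fst q) + cnj (snd q') * snd q"
  shows "fst q' = \<zeta> * fst q" "snd q' = cnj \<zeta> * snd q" "cmod \<zeta> = 1"
proof -
  have "2 * fst q * snd q = 2 * fst q' * snd q'"
    using assms(2,3) \<kappa>_pos[OF assms(1)] unfolding hopf_lift_def
    by (metis less_irrefl mult_cancel_left of_real_eq_0_iff)
  note hopf_fibre[OF _ _ this, folded \<zeta>_def]
  then show "fst q' = \<zeta> * fst q" "snd q' = cnj \<zeta> * snd q" "cmod \<zeta> = 1"
    using assms(2,3) by (auto simp: hopf_lift_def)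
qed

lemma hopf_lift_transitive:
  assumes "x \<in> U" "hopf_lift (fst q) (snd q) x" "hopf_lift (fst q') (snd q') x"
  obtains t where "q' = rot t q"
proof -
  define \<zeta> where "\<zeta> = fst q' * cnj (fst q) + cnj (snd q') * snd q"
  note \<zeta> = hopf_lift_unit[OF assms, folded \<zeta>_def]
  have "cis (Arg \<zeta>) = \<zeta>" using \<zeta>(3) by (subst cis_Arg) (auto simp: sgn_div_norm)
  then have "q' = rot (4 * Arg \<zeta>) q"
    using \<zeta>(1,2) by (simp add: rot_def prod_eq_iff flip: cis_cnj)
  then show ?thesis by (rule that)
qed

text \<open>The projection from Eguchi-Hanson space to the base.\<close>

definition base :: "real \<times> complex \<times> complex \<Rightarrow> real^3" where
  "base y = (let R = c * (fst y * fst y) / a^2; z = fst (snd y); w = snd (snd y) in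
     base_pt R (of_real (sqrt (R * R - c * c)) * (2 * z * w)) (z \<bullet> z - w \<bullet> w))"

lemma base_R:
  assumes "a < r"
  shows "c < c * (r * r) / a^2"
proof -
  have "a^2 < r * r" using assms a by (simp add: power2_eq_square mult_strict_mono')
  then show ?thesis using a c by (simp add: field_simps)
qed

lemma base:
  assumes r: "a < r" and q: "q \<in> sphere 0 1"
  shows "base (r, q) \<in> U" "rr (base (r, q)) = r" "hopf_lift (fst q) (snd q) (base (r, q))"
proof -
  define R where "R = c * (r * r) / a^2"
  define D where "D = (cmod (fst q))^2 - (cmod (snd q))^2"
  define p where "p = of_real (sqrt (R^2 - c^2)) * (2 * fst q * snd q)"
  have R: "c < R" unfolding R_def by (rule base_R[OF r])
  have q1: "(cmod (fst q))^2 + (cmod (snd q))^2 = 1" using q unfolding sphere_Pair .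
  have R2: "0 \<le> R^2 - c^2" using R c by (simp add: power_mono)
  have b: "base (r, q) = base_pt R p D"
    by (simp add: base_def Let_def R_def D_def p_def power2_eq_square power2_norm_eq_inner[symmetric, unfolded power2_eq_square])
  have "(cmod p)^2 = (R^2 - c^2) * (cmod (2 * fst q * snd q))^2"
    using R2 by (simp add: p_def norm_mult power_mult_distrib)
  then have p2: "(cmod p)^2 = (R^2 - c^2) * (1 - D^2)"
    unfolding hopf_norm_identity[OF q1] D_def .
  have D1: "\<bar>D\<bar> \<le> 1" using q1 zero_le_power2[of "cmod (fst q)"] zero_le_power2[of "cmod (snd q)"]
    unfolding D_def by linarith
  note bp = base_pt[OF R D1 p2, folded b]
  show "base (r, q) \<in> U" by (rule bp)
  have "R / c = (r / a)^2" using c a by (simp add: R_def field_simps power2_eq_square)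
  then show "rr (base (r, q)) = r" using r a by (simp add: rr_def bp)
  show "hopf_lift (fst q) (snd q) (base (r, q))"
    unfolding hopf_lift_def bp \<kappa>_def using q1 by (simp add: D_def p_def)
qed

lemma base_unique:
  assumes x: "x \<in> U" and l: "hopf_lift (fst q) (snd q) x"
  shows "base (rr x, q) = x"
proof -
  have "rr x * rr x = a^2 * \<rho> x / c" using rr_sq[OF x] by (simp add: power2_eq_square)
  then have R: "c * (rr x * rr x) / a^2 = \<rho> x" using c a by simp
  have "base (rr x, q) = base_pt (\<rho> x) (of_real (\<kappa> x) * (2 * fst q * snd q)) ((cmod (fst q))^2 - (cmod (snd q))^2)"
    by (simp add: base_def Let_def R \<kappa>_def power2_norm_eq_inner power2_eq_square[of "\<rho> x"] power2_eq_square[of c])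
  also have "\<dots> = x" using l base_pt_coords[of x] by (simp add: hopf_lift_def)
  finally show ?thesis .
qed

lemma smooth_base: "smooth_on ({a<..} \<times> UNIV) base"
proof -
  let ?S = "{a<..} \<times> (UNIV :: (complex \<times> complex) set)"
  have o: "open ?S" by (simp add: open_Times)
  let ?R = "\<lambda>y. c * (fst y * fst y) / a^2" and ?z = "\<lambda>y. fst (snd y)" and ?w = "\<lambda>y. snd (snd y)"
  let ?p = "\<lambda>y. of_real (sqrt (?R y * ?R y - c * c)) * (2 * ?z y * ?w y)"
  have eq: "base = (\<lambda>y. mid + Re (?p y) *\<^sub>R e1 + Im (?p y) *\<^sub>R e2 + (?R y * (?z y \<bullet> ?z y - ?w y \<bullet> ?w y)) *\<^sub>R e)"
    by (simp add: base_def base_pt_def Let_def fun_eq_iff)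
  have R: "0 < ?R y * ?R y - c * c" if "y \<in> ?S" for y
  proof -
    have "c < ?R y" using base_R[of "fst y"] that by auto
    then have "c * c < ?R y * ?R y" using c by (intro mult_strict_mono) auto
    then show ?thesis by simp
  qed
  have a0: "a^2 \<noteq> 0" using a by simp
  show ?thesis
    unfolding eq
    by (intro smooth_intros o R a0)
qed

text \<open>The map \<open>y \<mapsto> (rr y, L y)\<close> is a section of \<open>base\<close> pulling the connection form back to \<open>A\<close>.\<close>

definition lift_on :: "(real^3) set \<Rightarrow> (real^3 \<Rightarrow> real^3) \<Rightarrow> (real^3 \<Rightarrow> complex \<times> complex) \<Rightarrow> bool" where
  "lift_on N A L \<longleftrightarrow> open N \<and> N \<subseteq> U \<and> smooth_on N L \<and>
     (\<forall>y\<in>N. hopf_lift (fst (L y)) (snd (L y)) y \<and>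
        (\<forall>v. eh_conn (f y) (fst (L y)) (snd (L y)) (fst (fderiv L y v))
           (snd (fderiv L y v)) = A y \<bullet> v))"

lemma lift_on_subset: "lift_on N A L \<Longrightarrow> open M \<Longrightarrow> M \<subseteq> N \<Longrightarrow> lift_on M A L"
  unfolding lift_on_def using smooth_on_subset by blast

text \<open>A gauge transformation: rotating by \<open>\<tau>\<close> adds the differential of
  \<open>\<tau>\<close> to the pulled back connection form.\<close>

lemma lift_on_rot:
  assumes L: "lift_on N A L" and \<tau>: "smooth_on N \<tau>" "\<And>y. y \<in> N \<Longrightarrow> GDERIV \<tau> y :> A' y - A y"
  shows "lift_on N A' (\<lambda>y. rot (\<tau> y) (L y))"
  unfolding lift_on_def
proof (intro conjI ballI allI)
  have N: "open N" "smooth_on N L" using L by (auto simp: lift_on_def)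
  show "open N" "N \<subseteq> U" using L by (auto simp: lift_on_def)
  show "smooth_on N (\<lambda>y. rot (\<tau> y) (L y))" by (intro smooth_on_rot \<tau> N)
  fix y v assume y: "y \<in> N"
  have yU: "y \<in> U" and l: "hopf_lift (fst (L y)) (snd (L y)) y"
    and A: "eh_conn (f y) (fst (L y)) (snd (L y)) (fst (fderiv L y v))
           (snd (fderiv L y v)) = A y \<bullet> v"
    using L y by (auto simp: lift_on_def)
  show "hopf_lift (fst (rot (\<tau> y) (L y))) (snd (rot (\<tau> y) (L y))) y"
    using l by (simp add: hopf_lift_rot)
  have D\<tau>: "(\<tau> has_derivative (\<lambda>v. v \<bullet> (A' y - A y))) (at y)"
    using \<tau>(2)[OF y] by (simp add: gderiv_def)
  have D: "fderiv (\<lambda>y. rot (\<tau> y) (L y)) y = (\<lambda>v.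
     (cis (\<tau> y / 4) * (fst (fderiv L y v) + \<i> * of_real (v \<bullet> (A' y - A y) / 4) * fst (L y)),
      cis (- (\<tau> y / 4)) * (snd (fderiv L y v) - \<i> * of_real (v \<bullet> (A' y - A y) / 4) * snd (L y))))"
    by (intro frechet_derivative_eqI rot_has_derivative D\<tau> smooth_on_has_derivative[OF N(2) y])
  show "eh_conn (f y) (fst (rot (\<tau> y) (L y))) (snd (rot (\<tau> y) (L y)))
      (fst (fderiv (\<lambda>y. rot (\<tau> y) (L y)) y v))
      (snd (fderiv (\<lambda>y. rot (\<tau> y) (L y)) y v)) = A' y \<bullet> v"
    unfolding D fst_conv snd_conv eh_conn_rot[OF hopf_lift_norm[OF l] f_pos[OF yU]] A
    by (simp add: inner_diff_right inner_commute)
qed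

text \<open>Two lifts differ by a rotation \<open>\<zeta>\<close>, and their connection forms by its
  angular velocity. As both forms are \<open>A\<close>, the velocity is zero and
  \<open>\<zeta>\<close> is constant. This is the source of local constancy of the sheaf.\<close>

lemma lift_on_unique:
  assumes L: "lift_on N A L" and L': "lift_on N A L'" and N: "convex N"
  obtains \<zeta> where "\<And>y. y \<in> N \<Longrightarrow> fst (L' y) = \<zeta> * fst (L y) \<and> snd (L' y) = cnj \<zeta> * snd (L y)"
proof -
  have o: "open N" and NU: "N \<subseteq> U" and sm: "smooth_on N L" "smooth_on N L'"
    using L L' by (auto simp: lift_on_def)
  define \<zeta> where "\<zeta> y = fst (L' y) * cnj (fst (L y)) + cnj (snd (L' y)) * snd (L y)" for y
  have l: "hopf_lift (fst (L y)) (snd (L y)) y" "hopf_lift (fst (L' y)) (snd (L' y)) y" if "y \<in> N" for y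
    using L L' that by (auto simp: lift_on_def)
  have \<zeta>: "fst (L' y) = \<zeta> y * fst (L y)" "snd (L' y) = cnj (\<zeta> y) * snd (L y)" "cmod (\<zeta> y) = 1" if "y \<in> N" for y
    using hopf_lift_unit[OF _ l[OF that]] that NU unfolding \<zeta>_def by auto
  have s\<zeta>: "smooth_on N \<zeta>"
    unfolding \<zeta>_def
    by (intro smooth_intros sm o)
  have "(\<zeta> has_derivative (\<lambda>v. 0)) (at y)" if y: "y \<in> N" for y
  proof -
    define \<zeta>' where "\<zeta>' = fderiv \<zeta> y"
    define DL where "DL = fderiv L y"
    define DL' where "DL' = fderiv L' y"
    have D\<zeta>: "(\<zeta> has_derivative \<zeta>') (at y)" and DL: "(L has_derivative DL) (at y)"
      and DL': "(L' has_derivative DL') (at y)"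
      unfolding \<zeta>'_def DL_def DL'_def by (rule smooth_on_has_derivative[OF _ y], simp add: s\<zeta> sm)+
    have one: "\<zeta> y * cnj (\<zeta> y) = 1" if "y \<in> N" for y
      using \<zeta>(3)[OF that] complex_norm_square[of "\<zeta> y"] by simp
    have "((\<lambda>y. \<zeta> y * cnj (\<zeta> y)) has_derivative (\<lambda>v. \<zeta> y * cnj (\<zeta>' v) + \<zeta>' v * cnj (\<zeta> y))) (at y)"
      by (intro has_derivative_mult D\<zeta> has_derivative_cnj)
    moreover have "((\<lambda>y. \<zeta> y * cnj (\<zeta> y)) has_derivative (\<lambda>v. 0)) (at y)"
      by (rule has_derivative_transform_within_open[OF has_derivative_const[of 1] o y]) (simp add: one)
    ultimately have "(\<lambda>v. \<zeta> y * cnj (\<zeta>' v) + \<zeta>' v * cnj (\<zeta> y)) = (\<lambda>v. 0)" by (rule has_derivative_unique)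
    then have "\<zeta> y * cnj (\<zeta>' v) + \<zeta>' v * cnj (\<zeta> y) = 0" for v by (rule fun_cong)
    from this have "Re (\<zeta> y * cnj (\<zeta>' v) + \<zeta>' v * cnj (\<zeta> y)) = 0" for v by simp
    moreover have "Re (\<zeta> y * cnj (\<zeta>' v) + \<zeta>' v * cnj (\<zeta> y)) = 2 * Re (cnj (\<zeta> y) * \<zeta>' v)" for v
      by (simp add: algebra_simps)
    ultimately have "Re (cnj (\<zeta> y) * \<zeta>' v) = 0" for v by (metis mult_eq_0_iff zero_neq_numeral)
    then have im: "cnj (\<zeta> y) * \<zeta>' v = \<i> * of_real (Im (cnj (\<zeta> y) * \<zeta>' v))" for v
      by (simp add: complex_eq_iff)
    \<comment> \<open>Since \<open>\<zeta>\<close> has modulus 1, its derivative is tangent to the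
      circle, hence \<open>\<i> \<mu>\<close> times \<open>\<zeta>\<close>; this is the shape
      required by \<open>eh_conn_rotate\<close>.\<close>
    define \<mu> where "\<mu> v = Im (cnj (\<zeta> y) * \<zeta>' v)" for v
    have z': "\<zeta>' v = \<zeta> y * (\<i> * of_real (\<mu> v))" for v
    proof -
      have "\<zeta>' v = (\<zeta> y * cnj (\<zeta> y)) * \<zeta>' v" by (simp add: one[OF y])
      also have "\<dots> = \<zeta> y * (cnj (\<zeta> y) * \<zeta>' v)" by (simp only: mult.assoc)
      also have "cnj (\<zeta> y) * \<zeta>' v = \<i> * of_real (\<mu> v)" unfolding \<mu>_def by (rule im)
      finally show ?thesis .
    qed
    have "((\<lambda>y. fst (L' y)) has_derivative (\<lambda>v. \<zeta> y * fst (DL v) + \<zeta>' v * fst (L y))) (at y)"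
      by (rule has_derivative_transform_within_open[OF has_derivative_mult[OF D\<zeta> has_derivative_fst[OF DL]] o y])
        (simp add: \<zeta>)
    then have f': "fst (DL' v) = \<zeta> y * (fst (DL v) + \<i> * of_real (\<mu> v) * fst (L y))" for v
      using has_derivative_unique[OF has_derivative_fst[OF DL']] by (auto simp: fun_eq_iff z' algebra_simps)
    have "((\<lambda>y. snd (L' y)) has_derivative (\<lambda>v. cnj (\<zeta> y) * snd (DL v) + cnj (\<zeta>' v) * snd (L y))) (at y)"
      by (rule has_derivative_transform_within_open[OF has_derivative_mult[OF has_derivative_cnj[OF D\<zeta>] has_derivative_snd[OF DL]] o y])
        (simp add: \<zeta>)
    then have s': "snd (DL' v) = cnj (\<zeta> y) * (snd (DL v) - \<i> * of_real (\<mu> v) * snd (L y))" for v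
      using has_derivative_unique[OF has_derivative_snd[OF DL']] by (auto simp: fun_eq_iff z' algebra_simps)
    have yU: "y \<in> U" using y NU by auto
    have "\<mu> v = 0" for v
    proof -
      have "A y \<bullet> v = eh_conn (f y) (fst (L' y)) (snd (L' y)) (fst (DL' v)) (snd (DL' v))"
        using L' y by (simp add: lift_on_def DL'_def)
      also have "\<dots> = eh_conn (f y) (fst (L y)) (snd (L y)) (fst (DL v)) (snd (DL v)) + 4 * \<mu> v"
        unfolding \<zeta>[OF y] f' s'
        by (rule eh_conn_rotate[OF hopf_lift_norm[OF l(1)[OF y]] f_pos[OF yU] \<zeta>(3)[OF y]])
      also have "eh_conn (f y) (fst (L y)) (snd (L y)) (fst (DL v)) (snd (DL v)) = A y \<bullet> v"
        using L y by (simp add: lift_on_def DL_def)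
      finally show ?thesis by simp
    qed
    then have "\<zeta>' = (\<lambda>v. 0)" by (simp add: z' fun_eq_iff)
    then show ?thesis using D\<zeta> by simp
  qed
  then obtain k where "\<And>y. y \<in> N \<Longrightarrow> \<zeta> y = k"
    using has_derivative_zero_constant[OF N, of \<zeta>] has_derivative_at_withinI by metis
  then show ?thesis using that[of k] \<zeta> by metis
qed

text \<open>A Hopf section lifts one of the two Dirac potentials. On a ball the difference between
  \<open>A\<close> and that potential is closed, and rotating the section by a primitive
  \<open>\<tau>\<close> corrects it.\<close>

lemma lift_exists:
  assumes x: "x \<in> U" and W: "open W" "x \<in> W" and A: "smooth_on W A"
    and V: "\<And>x. x \<in> W \<Longrightarrow> GDERIV pot x :> curl A x"
  obtains N L where "x \<in> N" "N \<subseteq> W" "lift_on N A L"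
proof -
  obtain \<epsilon> :: real where \<epsilon>: "\<epsilon> = 1 \<or> \<epsilon> = - 1" and x\<epsilon>: "x \<in> string_free \<epsilon>"
    using x string_free_cover by blast
  obtain \<delta> where \<delta>: "0 < \<delta>" "ball x \<delta> \<subseteq> W \<inter> string_free \<epsilon>"
    using W x\<epsilon> open_string_free openE[of "W \<inter> string_free \<epsilon>" x] by blast
  let ?N = "ball x \<delta>" and ?A0 = "A0 (\<epsilon> *\<^sub>R e)"
  obtain z w where sec: "smooth_on (string_free \<epsilon>) z" "smooth_on (string_free \<epsilon>) w"
    "\<And>x. x \<in> string_free \<epsilon> \<Longrightarrow> hopf_lift (z x) (w x) x"
    "\<And>x v. x \<in> string_free \<epsilon> \<Longrightarrow> eh_conn (f x) (z x) (w x)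
       (fderiv z x v) (fderiv w x v) = ?A0 x \<bullet> v"
    using local_section[OF \<epsilon>] by blast
  have L0: "lift_on ?N ?A0 (\<lambda>y. (z y, w y))"
    unfolding lift_on_def
  proof (intro conjI ballI allI)
    show "?N \<subseteq> U" using \<delta> by (auto simp: string_free_def)
    show "smooth_on ?N (\<lambda>y. (z y, w y))"
      by (rule smooth_on_subset[OF smooth_on_Pair[OF open_string_free sec(1,2)]]) (use \<delta> in auto)
    fix y v assume "y \<in> ?N"
    then have y: "y \<in> string_free \<epsilon>" using \<delta> by auto
    show "hopf_lift (fst (z y, w y)) (snd (z y, w y)) y" using sec(3)[OF y] by simp
    have "fderiv (\<lambda>y. (z y, w y)) y
        = (\<lambda>v. (fderiv z y v, fderiv w y v))"
      by (intro frechet_derivative_eqI has_derivative_Pair smooth_on_has_derivative[OF sec(1) y]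
          smooth_on_has_derivative[OF sec(2) y])
    then show "eh_conn (f y) (fst (z y, w y)) (snd (z y, w y))
        (fst (fderiv (\<lambda>y. (z y, w y)) y v))
        (snd (fderiv (\<lambda>y. (z y, w y)) y v)) = ?A0 y \<bullet> v"
      using sec(4)[OF y] by simp
  qed simp
  have F: "smooth_on ?N (\<lambda>y. A y - ?A0 y)"
    by (intro smooth_on_diff smooth_on_subset[OF A] smooth_on_subset[OF smooth_A0[OF \<epsilon>]]) (use \<delta> in auto)
  obtain \<tau> where \<tau>: "\<And>y. y \<in> ?N \<Longrightarrow> GDERIV \<tau> y :> A y - ?A0 y"
  proof (rule closed_form_primitive[OF open_ball convex_ball F])
    fix y v u assume y: "y \<in> ?N"
    have yW: "y \<in> W" and y\<epsilon>: "y \<in> string_free \<epsilon>" using y \<delta> by auto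
    show "fderiv (\<lambda>y. A y - ?A0 y) y v \<bullet> u = fderiv (\<lambda>y. A y - ?A0 y) y u \<bullet> v"
      by (rule A0_difference_closed[OF \<epsilon> y\<epsilon> smooth_on_has_derivative[OF A yW] V[OF yW] smooth_on_has_derivative[OF F y]])
  qed blast
  have "smooth_on ?N \<tau>" by (rule smooth_on_GDERIV[OF open_ball F \<tau>])
  from lift_on_rot[OF L0 this \<tau>] show ?thesis
    using that[of ?N] \<delta> by auto
qed

text \<open>Each set is the complement of one ray, starting at one center and running through the
  other. As \<open>\<rho> \<ge> c\<close> and \<open>\<bar>C\<bar> \<le> 1\<close> hold everywhere,
  positivity of the product in \<open>dirac_denominators\<close> means positivity of both
  factors.\<close>

lemma string_free_iff:
  "string_free 1 = {x. 0 < norm (x - x1) + e \<bullet> (x - x1)}"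
  "string_free (- 1) = {x. 0 < norm (x - x2) + (- e) \<bullet> (x - x2)}"
proof -
  have q: "0 \<le> 1 + C x" "0 \<le> 1 - C x" for x using C_abs[of x] by linarith+
  have \<rho>: "c \<le> \<rho> x" for x
    using dist_triangle[of x1 x2 x] unfolding dist_centers
    by (simp add: \<rho>_def dist_norm norm_minus_commute)
  show "string_free 1 = {x. 0 < norm (x - x1) + e \<bullet> (x - x1)}"
    using dirac_denominators(1)[of 1] q \<rho>
    by (auto simp: string_free_def U_iff zero_less_mult_iff less_le)
  show "string_free (- 1) = {x. 0 < norm (x - x2) + (- e) \<bullet> (x - x2)}"
    using dirac_denominators(2)[of "- 1"] q \<rho>
    by (auto simp: string_free_def U_iff zero_less_mult_iff less_le)
qed

lemma norm_e: "norm e = 1"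
  using frame by (simp add: norm_eq_sqrt_inner)

text \<open>The centre of each starlike set lies on the axis at distance 1 from the endpoint of the
  removed ray, on the opposite side.\<close>

lemma starlike_string_free:
  "x \<in> string_free 1 \<Longrightarrow> closed_segment (x1 + e) x \<subseteq> string_free 1"
  "x \<in> string_free (- 1) \<Longrightarrow> closed_segment (x2 - e) x \<subseteq> string_free (- 1)"
proof -
  have gen: "closed_segment (p + u) x \<subseteq> {x. 0 < norm (x - p) + u \<bullet> (x - p)}"
    if "0 < norm (x - p) + u \<bullet> (x - p)" "norm u = 1" for p u x :: "real^3"
  proof
    fix y assume "y \<in> closed_segment (p + u) x"
    then obtain t where t: "0 \<le> t" "t \<le> 1" and y: "y = (1 - t) *\<^sub>R (p + u) + t *\<^sub>R x"
      by (auto simp: in_segment)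
    have "y - p = (1 - t) *\<^sub>R u + t *\<^sub>R (x - p)" unfolding y by (simp add: algebra_simps)
    then show "y \<in> {x. 0 < norm (x - p) + u \<bullet> (x - p)}"
      using starlike_string_complement[OF that(2,1) t] by simp
  qed
  show "x \<in> string_free 1 \<Longrightarrow> closed_segment (x1 + e) x \<subseteq> string_free 1"
    unfolding string_free_iff using gen[of x x1 e] norm_e by simp
  show "x \<in> string_free (- 1) \<Longrightarrow> closed_segment (x2 - e) x \<subseteq> string_free (- 1)"
    unfolding string_free_iff using gen[of x x2 "- e"] norm_e by simp
qed

lemma string_free_center: "x1 + e \<in> string_free 1"
  unfolding string_free_iff using norm_e frame by simp

text \<open>Spheroidal coordinates with a real angle \<open>t\<close> exhibit the complement of the
  axis as a continuous image of a product of intervals, which gives its connectedness.\<close>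

lemma off_axis_param:
  "string_free 1 \<inter> string_free (- 1) =
    (\<lambda>(r, D, t). base_pt r (of_real (sqrt (r^2 - c^2) * sqrt (1 - D^2)) * cis t) D) ` ({c<..} \<times> {- 1<..<1} \<times> UNIV)"
  (is "_ = ?b ` _")
proof (intro equalityI subsetI)
  fix x assume "x \<in> string_free 1 \<inter> string_free (- 1)"
  then have xU: "x \<in> U" and D: "- 1 < C x" "C x < 1" by (auto simp: string_free_def)
  have "cmod (P x) = sqrt ((\<rho> x)^2 - c^2) * sqrt (1 - (C x)^2)"
    using cmod_P_eq[of x] by (metis norm_ge_zero real_sqrt_mult real_sqrt_unique)
  moreover have "P x = of_real (cmod (P x)) * cis (Arg (P x))"
    using rcis_cmod_Arg[of "P x"] by (simp add: rcis_def)
  ultimately have "x = ?b (\<rho> x, C x, Arg (P x))"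
    using base_pt_coords[of x] by simp
  moreover have "(\<rho> x, C x, Arg (P x)) \<in> {c<..} \<times> {- 1<..<1} \<times> UNIV" using xU D by (simp add: U_iff)
  ultimately show "x \<in> ?b ` ({c<..} \<times> {- 1<..<1} \<times> UNIV)" by (rule image_eqI)
next
  fix x assume "x \<in> ?b ` ({c<..} \<times> {- 1<..<1} \<times> UNIV)"
  then obtain r D t where r: "c < r" and D: "- 1 < D" "D < 1" and x: "x = ?b (r, D, t)" by auto
  have 1: "0 \<le> r^2 - c^2" using r c by (simp add: power_mono)
  have "\<bar>D\<bar> \<le> 1" using D by auto
  then have 2: "0 \<le> 1 - D^2" by (simp add: abs_square_le_1)
  have "(cmod (of_real (sqrt (r^2 - c^2) * sqrt (1 - D^2)) * cis t))^2 = (r^2 - c^2) * (1 - D^2)"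
    using 1 2 by (simp add: norm_mult power_mult_distrib)
  note base_pt[OF r \<open>\<bar>D\<bar> \<le> 1\<close> this]
  then show "x \<in> string_free 1 \<inter> string_free (- 1)"
    using D unfolding x by (simp add: string_free_def)
qed

lemma connected_off_axis: "connected (string_free 1 \<inter> string_free (- 1))"
  unfolding off_axis_param
proof (rule connected_continuous_image)
  show "continuous_on ({c<..} \<times> {- 1<..<1} \<times> UNIV)
    (\<lambda>(r, D, t). base_pt r (of_real (sqrt (r^2 - c^2) * sqrt (1 - D^2)) * cis t) D)"
    unfolding base_pt_def case_prod_beta by (intro continuous_intros)
  show "connected ({c<..} \<times> {- 1<..<1::real} \<times> (UNIV :: real set))"
    by (intro connected_Times) auto
qed

lemma off_axis_nonempty: "\<exists>x. x \<in> string_free 1 \<inter> string_free (- 1)"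
  unfolding off_axis_param using c by (auto intro!: exI[of _ "c + 1"] exI[of _ 0])

end

section \<open>The isometry\<close>

locale two_center_bundle = two_centers x1 x2 e1 e2 e c a
  for x1 x2 e1 e2 e :: "real^3" and c a :: real +
  fixes B :: "'m circle_bundle"
  assumes gh: "gh_bundle 0 [(x1, 1), (x2, 1)] B"
begin

section \<open>Circle action and gauges of the given bundle\<close>

lemma principal_bundle: "principal_circle_bundle (- {x1, x2}) B"
  using gh by (simp add: gh_bundle_def gh_base_def)

lemma U_sub: "U \<subseteq> - {x1, x2}"
  by (auto simp: U_def)

lemma
  assumes "m \<in> total B"
  shows act_total: "act B \<psi> m \<in> total B" and act_proj: "proj B (act B \<psi> m) = proj B m"
    and act_act: "act B \<psi> (act B \<psi>' m) = act B (\<psi> + \<psi>') m"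
    and act_fixed_iff: "act B \<psi> m = m \<longleftrightarrow> (\<exists>k::int. \<psi> = 4 * pi * of_int k)"
    and act_transitive: "m' \<in> total B \<Longrightarrow> proj B m = proj B m' \<Longrightarrow> \<exists>\<psi>. m' = act B \<psi> m"
proof -
  note pb = principal_bundle[unfolded principal_circle_bundle_def]
  have 1: "\<forall>m\<in>total B. \<forall>\<psi>. act B \<psi> m \<in> total B \<and> proj B (act B \<psi> m) = proj B m"
    using pb by (elim conjE)
  have 2: "\<forall>m\<in>total B. \<forall>\<psi> \<psi>'. act B \<psi> (act B \<psi>' m) = act B (\<psi> + \<psi>') m"
    using pb by (elim conjE)
  have 3: "\<forall>m\<in>total B. \<forall>\<psi>. act B \<psi> m = m \<longleftrightarrow> (\<exists>k::int. \<psi> = 4 * pi * of_int k)"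
    using pb by (elim conjE)
  have 4: "\<forall>m\<in>total B. \<forall>m'\<in>total B. proj B m = proj B m' \<longrightarrow> (\<exists>\<psi>. m' = act B \<psi> m)"
    using pb by (elim conjE)
  show "act B \<psi> m \<in> total B" "proj B (act B \<psi> m) = proj B m"
    using 1 assms by blast+
  show "act B \<psi> (act B \<psi>' m) = act B (\<psi> + \<psi>') m" using 2 assms by blast
  show "act B \<psi> m = m \<longleftrightarrow> (\<exists>k::int. \<psi> = 4 * pi * of_int k)" using 3 assms by blast
  show "m' \<in> total B \<Longrightarrow> proj B m = proj B m' \<Longrightarrow> \<exists>\<psi>. m' = act B \<psi> m" using 4 assms by blast
qed

lemma act_0: "m \<in> total B \<Longrightarrow> act B 0 m = m"
  using act_fixed_iff[of m 0] by (auto intro: exI[of _ 0])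

lemma act_eq_iff:
  assumes "m \<in> total B"
  shows "act B \<psi> m = act B \<psi>' m \<longleftrightarrow> (\<exists>k::int. \<psi> - \<psi>' = 4 * pi * of_int k)"
proof -
  have "act B \<psi> m = act B \<psi>' m \<longleftrightarrow> act B (\<psi> - \<psi>') m = m"
  proof
    assume "act B \<psi> m = act B \<psi>' m"
    then have "act B (- \<psi>') (act B \<psi> m) = act B (- \<psi>') (act B \<psi>' m)" by simp
    then show "act B (\<psi> - \<psi>') m = m" using assms by (simp add: act_act act_0)
  next
    assume "act B (\<psi> - \<psi>') m = m"
    then have "act B \<psi>' (act B (\<psi> - \<psi>') m) = act B \<psi>' m" by simp
    then show "act B \<psi> m = act B \<psi>' m" using assms by (simp add: act_act)
  qed
  then show ?thesis using act_fixed_iff[OF assms] by simp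
qed

lemma
  assumes "(W, s, A) \<in> gauges B"
  shows gauge_open: "open W" and gauge_total: "x \<in> W \<Longrightarrow> s x \<in> total B"
    and gauge_proj: "x \<in> W \<Longrightarrow> proj B (s x) = x" and gauge_smooth: "smooth_on W A"
    and gauge_curl: "x \<in> W \<Longrightarrow> GDERIV pot x :> curl A x"
proof -
  have "\<forall>(W, s, A)\<in>gauges B. open W \<and> W \<subseteq> - {x1, x2} \<and> (\<forall>x\<in>W. s x \<in> total B \<and> proj B (s x) = x)"
    using principal_bundle unfolding principal_circle_bundle_def by (elim conjE)
  then show "open W" "x \<in> W \<Longrightarrow> s x \<in> total B" "x \<in> W \<Longrightarrow> proj B (s x) = x" using assms by auto
  have "\<forall>(W, s, A)\<in>gauges B. smooth_on W A"
    using gh unfolding gh_bundle_def bundle_connection_def by (elim conjE)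
  moreover have "\<forall>(W, s, A)\<in>gauges B. \<forall>x\<in>W. GDERIV pot x :> curl A x"
    using gh unfolding gh_bundle_def by (elim conjE)
  ultimately show "smooth_on W A" "x \<in> W \<Longrightarrow> GDERIV pot x :> curl A x"
    using assms by auto
qed

lemma gauge_cover:
  assumes "x \<in> U"
  shows "\<exists>W s A. (W, s, A) \<in> gauges B \<and> x \<in> W"
proof -
  have "- {x1, x2} \<subseteq> (\<Union>(W, s, A)\<in>gauges B. W)"
    using principal_bundle unfolding principal_circle_bundle_def by (elim conjE)
  then have "x \<in> (\<Union>(W, s, A)\<in>gauges B. W)" using assms U_sub by (meson subsetD)
  then show ?thesis by auto
qed

lemma gauge_transition:
  assumes "(W, s, A) \<in> gauges B" "(W', s', A') \<in> gauges B" "x \<in> W" "x \<in> W'"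
  obtains N \<tau> where "open N" "x \<in> N" "N \<subseteq> W \<inter> W'" "smooth_on N \<tau>"
    "\<And>y. y \<in> N \<Longrightarrow> s' y = act B (\<tau> y) (s y)" "\<And>y. y \<in> N \<Longrightarrow> GDERIV \<tau> y :> A' y - A y"
proof -
  have "\<forall>(W, s, A)\<in>gauges B. \<forall>(W', s', A')\<in>gauges B. \<forall>x\<in>W \<inter> W'. \<exists>N \<tau>.
        open N \<and> x \<in> N \<and> N \<subseteq> W \<inter> W' \<and> smooth_on N \<tau> \<and> (\<forall>y\<in>N. s' y = act B (\<tau> y) (s y))"
    using principal_bundle unfolding principal_circle_bundle_def by (elim conjE)
  from bspec[OF bspec[OF this assms(1), simplified] assms(2), simplified, rule_format, of x]
  have "\<exists>N \<tau>. open N \<and> x \<in> N \<and> N \<subseteq> W \<inter> W' \<and> smooth_on N \<tau> \<and> (\<forall>y\<in>N. s' y = act B (\<tau> y) (s y))"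
    using assms(3,4) by auto
  then obtain N \<tau> where N: "open N" "x \<in> N" "N \<subseteq> W \<inter> W'" "smooth_on N \<tau>"
    "\<And>y. y \<in> N \<Longrightarrow> s' y = act B (\<tau> y) (s y)" by blast
  have "\<forall>(W, s, A)\<in>gauges B. \<forall>(W', s', A')\<in>gauges B. \<forall>N \<tau>.
        open N \<and> N \<subseteq> W \<inter> W' \<and> smooth_on N \<tau> \<and> (\<forall>y\<in>N. s' y = act B (\<tau> y) (s y)) \<longrightarrow>
        (\<forall>y\<in>N. GDERIV \<tau> y :> A' y - A y)"
    using gh unfolding gh_bundle_def bundle_connection_def by (elim conjE)
  from bspec[OF bspec[OF this assms(1), simplified] assms(2), simplified, rule_format, of N \<tau>]
  have "\<forall>y\<in>N. GDERIV \<tau> y :> A' y - A y"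
    using N by auto
  then show ?thesis using that N by blast
qed

text \<open>
  An equivariant correspondence between the fibre of \<open>m\<close> and a circle orbit in the sphere.
  Since rotation by \<open>4\<pi>\<close> is multiplication by \<open>-1\<close>, it relates each point of the fibre to a pair
  \<open>{q, - q}\<close>.
\<close>

definition orb :: "'m \<Rightarrow> complex \<times> complex \<Rightarrow> ('m \<times> complex \<times> complex) set" where
  "orb m q = range (\<lambda>\<psi>. (act B \<psi> m, rot \<psi> q))"

text \<open>The correspondence does not depend on which of its pairs is used to generate it.\<close>

lemma orb_shift:
  assumes "m \<in> total B"
  shows "orb (act B \<psi> m) (rot \<psi> q) = orb m q"
proof -
  have "orb (act B \<psi> m) (rot \<psi> q) = range ((\<lambda>\<psi>. (act B \<psi> m, rot \<psi> q)) \<circ> (\<lambda>t. t + \<psi>))"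
    using assms by (simp add: orb_def act_act rot_rot o_def)
  also have "\<dots> = orb m q"
    unfolding image_comp[symmetric] orb_def by (simp only: surj_plus_right)
  finally show ?thesis .
qed

lemma orb_fibre:
  assumes "m \<in> total B" "q \<noteq> 0"
  shows "{p. (act B \<psi> m, p) \<in> orb m q} = {rot \<psi> q, - rot \<psi> q}"
proof (intro equalityI subsetI)
  fix p assume "p \<in> {p. (act B \<psi> m, p) \<in> orb m q}"
  then obtain \<psi>' where "act B \<psi>' m = act B \<psi> m" and p: "p = rot \<psi>' q"
    by (auto simp: orb_def)
  then obtain k :: int where "\<psi>' - \<psi> = 4 * pi * of_int k" using act_eq_iff[OF assms(1)] by blast
  moreover have "rot \<psi> q \<noteq> 0" using assms(2) norm_rot[of \<psi> q] by auto
  moreover have "p = rot (\<psi>' - \<psi>) (rot \<psi> q)" by (simp add: p rot_rot)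
  ultimately show "p \<in> {rot \<psi> q, - rot \<psi> q}" using rot_eq_iff[of "rot \<psi> q" "\<psi>' - \<psi>"] by auto
next
  fix p assume "p \<in> {rot \<psi> q, - rot \<psi> q}"
  moreover have "- rot \<psi> q = rot (4 * pi + \<psi>) q" by (simp add: rot_4pi flip: rot_rot)
  moreover have "act B (4 * pi + \<psi>) m = act B \<psi> m"
    unfolding act_eq_iff[OF assms(1)] by (auto intro: exI[of _ 1])
  ultimately have "p = rot \<psi> q \<or> p = rot (4 * pi + \<psi>) q \<and> act B \<psi> m = act B (4 * pi + \<psi>) m" by auto
  then show "p \<in> {p. (act B \<psi> m, p) \<in> orb m q}" unfolding orb_def by auto
qed

lemma orb_eq_iff:
  assumes m: "m \<in> total B" and q: "q \<noteq> 0"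
  shows "orb m q = orb m q' \<longleftrightarrow> q' = q \<or> q' = - q"
proof
  assume "orb m q = orb m q'"
  moreover have "(act B 0 m, rot 0 q') \<in> orb m q'" by (simp add: orb_def)
  ultimately have "q' \<in> {p. (act B 0 m, p) \<in> orb m q}" by (simp add: rot_0)
  then show "q' = q \<or> q' = - q" unfolding orb_fibre[OF m q] by (simp add: rot_0)
next
  have "orb m (- q) = orb (act B (4 * pi) m) (rot (4 * pi) q)"
    using act_fixed_iff[OF m, of "4 * pi"] by (auto simp: rot_4pi intro: exI[of _ 1])
  also have "\<dots> = orb m q" by (rule orb_shift[OF m])
  finally show "q' = q \<or> q' = - q \<Longrightarrow> orb m q = orb m q'" by auto
qed

text \<open>
  The sheaf of local isometries over the base: its sections are families of fibrewise
  correspondences that match the two connections.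
\<close>

definition lifts_in_gauge where
  "lifts_in_gauge W s A \<sigma> N L \<longleftrightarrow> N \<subseteq> W \<and> lift_on N A L \<and> (\<forall>y\<in>N. \<sigma> y = orb (s y) (L y))"

definition germ where
  "germ \<sigma> x \<longleftrightarrow> (\<exists>W s A N L. (W, s, A) \<in> gauges B \<and> x \<in> N \<and> lifts_in_gauge W s A \<sigma> N L)"

definition stalk where
  "stalk x = {orb m q | m q. m \<in> total B \<and> proj B m = x \<and> x \<in> U \<and> hopf_lift (fst q) (snd q) x}"

text \<open>The transition function \<open>\<tau>\<close> has differential \<open>A - A'\<close>, so
  rotating the lift by it adapts the lift to the new potential; the same rotation compensates the
  change of section inside \<open>orb\<close>.\<close>

lemma germ_any_gauge:
  assumes g: "germ \<sigma> x" and W: "(W, s, A) \<in> gauges B" "x \<in> W"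
  obtains N L where "x \<in> N" "lifts_in_gauge W s A \<sigma> N L"
proof -
  obtain W' s' A' N' L where 1: "(W', s', A') \<in> gauges B" "x \<in> N'" and l: "lifts_in_gauge W' s' A' \<sigma> N' L"
    using g unfolding germ_def by blast
  have N': "N' \<subseteq> W'" "lift_on N' A' L" "\<And>y. y \<in> N' \<Longrightarrow> \<sigma> y = orb (s' y) (L y)"
    using l unfolding lifts_in_gauge_def by auto
  obtain N0 \<tau> where N0: "open N0" "x \<in> N0" "N0 \<subseteq> W' \<inter> W" "smooth_on N0 \<tau>"
    "\<And>y. y \<in> N0 \<Longrightarrow> s y = act B (\<tau> y) (s' y)" "\<And>y. y \<in> N0 \<Longrightarrow> GDERIV \<tau> y :> A y - A' y"
    using gauge_transition[OF 1(1) W(1) _ W(2)] 1(2) N'(1) by blast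
  let ?N = "N' \<inter> N0"
  have "open ?N" using N'(2) N0(1) by (auto simp: lift_on_def)
  then have "lift_on ?N A' L" using lift_on_subset[OF N'(2)] by blast
  then have "lift_on ?N A (\<lambda>y. rot (\<tau> y) (L y))"
    by (rule lift_on_rot) (use N0 smooth_on_subset[OF N0(4)] in auto)
  moreover have "\<sigma> y = orb (s y) (rot (\<tau> y) (L y))" if "y \<in> ?N" for y
  proof -
    have "s' y \<in> total B" using gauge_total[OF 1(1)] that N'(1) by blast
    then show ?thesis using N'(3) N0(5) that orb_shift by auto
  qed
  moreover have "?N \<subseteq> W" using N0(3) by blast
  ultimately have "lifts_in_gauge W s A \<sigma> ?N (\<lambda>y. rot (\<tau> y) (L y))"
    unfolding lifts_in_gauge_def by blast
  then show ?thesis using that[of ?N] 1(2) N0(2) by blast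
qed

lemma lifts_in_gaugeD:
  assumes "lifts_in_gauge W s A \<sigma> N L" "(W, s, A) \<in> gauges B" "y \<in> N"
  shows "y \<in> W" "y \<in> U" "open N" "\<sigma> y = orb (s y) (L y)" "hopf_lift (fst (L y)) (snd (L y)) y"
    "L y \<noteq> 0" "s y \<in> total B" "proj B (s y) = y"
  using assms hopf_lift_nonzero gauge_total gauge_proj
  unfolding lifts_in_gauge_def lift_on_def by blast+

text \<open>Unique continuation: read in one gauge over a ball, two sections have lifts that differ
  by a constant \<open>\<zeta>\<close>, and they agree at a point iff \<open>\<zeta>\<close> is 1 or
  -1, a condition independent of the point. Sections through a prescribed value arise from one lift
  by constant rotations, since the fibre is a single orbit.\<close>

lemma sheaf: "locally_constant_sheaf U stalk germ"
proof
  show "germ \<sigma>' x" if g: "germ \<sigma> x" and eq: "\<forall>\<^sub>F y in nhds x. \<sigma>' y = \<sigma> y" for \<sigma> \<sigma>' x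
  proof -
    obtain W s A N L where 1: "(W, s, A) \<in> gauges B" "x \<in> N" and l: "lifts_in_gauge W s A \<sigma> N L"
      using g unfolding germ_def by blast
    obtain T where T: "open T" "x \<in> T" "\<And>y. y \<in> T \<Longrightarrow> \<sigma>' y = \<sigma> y"
      using eq unfolding eventually_nhds by blast
    have "open (N \<inter> T)" using lifts_in_gaugeD(3)[OF l 1] T(1) by blast
    then have "lifts_in_gauge W s A \<sigma>' (N \<inter> T) L"
      using l T(3) lift_on_subset[of N A L "N \<inter> T"] unfolding lifts_in_gauge_def by auto
    then show ?thesis unfolding germ_def using 1 T(2) by blast
  qed
  show "\<sigma> x \<in> stalk x" if "germ \<sigma> x" for \<sigma> x
  proof -
    obtain W s A N L where 1: "(W, s, A) \<in> gauges B" "x \<in> N" and l: "lifts_in_gauge W s A \<sigma> N L"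
      using \<open>germ \<sigma> x\<close> unfolding germ_def by blast
    note D = lifts_in_gaugeD[OF l 1]
    show ?thesis unfolding stalk_def using D by blast
  qed
  show "\<forall>\<^sub>F y in nhds x. (\<sigma> y = \<sigma>' y) = (\<sigma> x = \<sigma>' x)"
    if "x \<in> U" and g: "germ \<sigma> x" and g': "germ \<sigma>' x" for \<sigma> \<sigma>' x
  proof -
    obtain W s A where W: "(W, s, A) \<in> gauges B" "x \<in> W" using gauge_cover[OF \<open>x \<in> U\<close>] by blast
    obtain N L where N: "x \<in> N" and l: "lifts_in_gauge W s A \<sigma> N L"
      using germ_any_gauge[OF g W] by blast
    obtain N' L' where N': "x \<in> N'" and l': "lifts_in_gauge W s A \<sigma>' N' L'"
      using germ_any_gauge[OF g' W] by blast
    have "open (N \<inter> N')" using lifts_in_gaugeD(3)[OF l W(1) N] lifts_in_gaugeD(3)[OF l' W(1) N'] by blast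
    then obtain \<delta> where \<delta>: "0 < \<delta>" "ball x \<delta> \<subseteq> N \<inter> N'" using N N' openE by blast
    have "lift_on (ball x \<delta>) A L" "lift_on (ball x \<delta>) A L'"
      using l l' \<delta>(2) lift_on_subset[of _ A _ "ball x \<delta>"] unfolding lifts_in_gauge_def by auto
    then obtain \<zeta> where \<zeta>: "\<And>y. y \<in> ball x \<delta> \<Longrightarrow> fst (L' y) = \<zeta> * fst (L y) \<and> snd (L' y) = cnj \<zeta> * snd (L y)"
      using lift_on_unique convex_ball by blast
    have "\<sigma> y = \<sigma>' y \<longleftrightarrow> \<zeta> = 1 \<or> \<zeta> = - 1" if y: "y \<in> ball x \<delta>" for y
    proof -
      have yN: "y \<in> N" "y \<in> N'" using y \<delta>(2) by auto
      note D = lifts_in_gaugeD[OF l W(1) yN(1)] and D' = lifts_in_gaugeD[OF l' W(1) yN(2)]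
      have "\<sigma> y = \<sigma>' y \<longleftrightarrow> L' y = L y \<or> L' y = - L y"
        unfolding D(4) D'(4) by (rule orb_eq_iff[OF D(7,6)])
      also have "\<dots> \<longleftrightarrow> \<zeta> = 1 \<or> \<zeta> = - 1"
      proof
        assume *: "L' y = L y \<or> L' y = - L y"
        have k: "k = 1 \<or> k = - 1" if "k * z = z \<or> k * z = - z" "z \<noteq> 0" for k z :: complex
          using that by (metis mult_cancel_right mult_minus1 mult_1)
        have "fst (L y) \<noteq> 0 \<or> snd (L y) \<noteq> 0" using D(6) by (auto simp: prod_eq_iff)
        then show "\<zeta> = 1 \<or> \<zeta> = - 1"
        proof
          assume "fst (L y) \<noteq> 0"
          then show ?thesis using k[of \<zeta> "fst (L y)"] \<zeta>[OF y] * by auto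
        next
          assume "snd (L y) \<noteq> 0"
          then have "cnj \<zeta> = 1 \<or> cnj \<zeta> = - 1" using k[of "cnj \<zeta>" "snd (L y)"] \<zeta>[OF y] * by auto
          then show ?thesis by (metis complex_cnj_cnj complex_cnj_minus complex_cnj_one)
        qed
      qed (use \<zeta>[OF y] in \<open>auto simp: prod_eq_iff\<close>)
      finally show ?thesis .
    qed
    moreover have "x \<in> ball x \<delta>" using \<delta>(1) by simp
    ultimately have "(\<sigma> y = \<sigma>' y) = (\<sigma> x = \<sigma>' x)" if "y \<in> ball x \<delta>" for y using that by blast
    then show ?thesis
      using eventually_nhds_in_open[OF open_ball \<open>x \<in> ball x \<delta>\<close>] by (auto elim: eventually_mono)
  qed
  show "\<exists>T. open T \<and> x \<in> T \<and> (\<forall>y\<in>T. \<forall>b\<in>stalk y. \<exists>\<sigma>. \<sigma> y = b \<and> (\<forall>z\<in>T. germ \<sigma> z))"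
    if x: "x \<in> U" for x
  proof -
    obtain W s A where W: "(W, s, A) \<in> gauges B" "x \<in> W" using gauge_cover[OF x] by blast
    obtain N L where N: "x \<in> N" "N \<subseteq> W" and L: "lift_on N A L"
      by (rule lift_exists[OF x gauge_open[OF W(1)] W(2) gauge_smooth[OF W(1)] gauge_curl[OF W(1)]])
    have o: "open N" using L by (simp add: lift_on_def)
    have "\<exists>\<sigma>. \<sigma> y = b \<and> (\<forall>z\<in>N. germ \<sigma> z)" if y: "y \<in> N" and b: "b \<in> stalk y" for y b
    proof -
      obtain m q where m: "m \<in> total B" "proj B m = y" and yU: "y \<in> U" and q: "hopf_lift (fst q) (snd q) y"
        and b_eq: "b = orb m q" using b unfolding stalk_def by blast
      have sy: "s y \<in> total B" "proj B (s y) = y"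
        using gauge_total[OF W(1)] gauge_proj[OF W(1)] y N(2) by auto
      obtain \<psi> where m_eq: "m = act B \<psi> (s y)" using act_transitive[OF sy(1) m(1)] sy(2) m(2) by auto
      have q': "hopf_lift (fst (rot (- \<psi>) q)) (snd (rot (- \<psi>) q)) y" using q by (simp add: hopf_lift_rot)
      have Ly: "hopf_lift (fst (L y)) (snd (L y)) y" using L y by (simp add: lift_on_def)
      obtain t where t: "rot (- \<psi>) q = rot t (L y)" using hopf_lift_transitive[OF yU Ly q'] by blast
      have "b = orb (act B \<psi> (s y)) (rot \<psi> (rot (- \<psi>) q))" by (simp add: b_eq m_eq rot_rot rot_0)
      also have "\<dots> = orb (s y) (rot t (L y))" unfolding t by (rule orb_shift[OF sy(1)])
      finally have b': "b = orb (s y) (rot t (L y))" .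
      have "lift_on N A (\<lambda>z. rot t (L z))"
        by (rule lift_on_rot[OF L smooth_on_const[OF o]]) (simp add: gderiv_def)
      then have "lifts_in_gauge W s A (\<lambda>z. orb (s z) (rot t (L z))) N (\<lambda>z. rot t (L z))"
        unfolding lifts_in_gauge_def using N(2) by simp
      then have "\<forall>z\<in>N. germ (\<lambda>z. orb (s z) (rot t (L z))) z"
        unfolding germ_def using W(1) by blast
      then show ?thesis using b' by (intro exI[of _ "\<lambda>z. orb (s z) (rot t (L z))"]) simp
    qed
    then have "\<forall>y\<in>N. \<forall>b\<in>stalk y. \<exists>\<sigma>. \<sigma> y = b \<and> (\<forall>z\<in>N. germ \<sigma> z)" by simp
    with o N(1) show ?thesis by (intro exI[of _ N]) simp
  qed
qed

lemma global_section: obtains \<sigma> where "\<And>x. x \<in> U \<Longrightarrow> germ \<sigma> x"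
proof -
  interpret locally_constant_sheaf U stalk germ by (rule sheaf)
  have SU: "string_free 1 \<subseteq> U" "string_free (- 1) \<subseteq> U" by (auto simp: string_free_def)
  then have pU: "x1 + e \<in> U" using string_free_center by blast
  obtain W s A where W: "(W, s, A) \<in> gauges B" "x1 + e \<in> W" using gauge_cover[OF pU] by blast
  obtain N L where N: "x1 + e \<in> N" "N \<subseteq> W" and L: "lift_on N A L"
    by (rule lift_exists[OF pU gauge_open[OF W(1)] W(2) gauge_smooth[OF W(1)] gauge_curl[OF W(1)]])
  have "hopf_lift (fst (L (x1 + e))) (snd (L (x1 + e))) (x1 + e)" using L N(1) by (simp add: lift_on_def)
  then have "orb (s (x1 + e)) (L (x1 + e)) \<in> stalk (x1 + e)"
    unfolding stalk_def using gauge_total[OF W] gauge_proj[OF W] pU by blast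
  moreover obtain q where "q \<in> string_free 1 \<inter> string_free (- 1)" using off_axis_nonempty by blast
  ultimately obtain \<sigma> where "\<And>x. x \<in> string_free 1 \<union> string_free (- 1) \<Longrightarrow> germ \<sigma> x"
    using section_on_union[OF open_string_free SU(1) starlike_string_free(1) open_string_free SU(2)
        starlike_string_free(2) connected_off_axis] by metis
  then show ?thesis using that string_free_cover by blast
qed

section \<open>The isometry in bundle coordinates\<close>

definition eh_of :: "(real^3 \<Rightarrow> complex \<times> complex) \<Rightarrow> (real^3) \<times> real \<Rightarrow> real \<times> complex \<times> complex" where
  "eh_of L u = (rr (fst u), rot (snd u) (L (fst u)))"

text \<open>The line element of the ansatz with the rescaling factor already included.\<close>

definition gh_metric :: "(real^3 \<Rightarrow> real^3) \<Rightarrow> (real^3) \<times> real \<Rightarrow> (real^3) \<times> real \<Rightarrow> real" where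
  "gh_metric A u v = a^2 / (8 * c) *
     (inverse (pot (fst u)) * (snd v + A (fst u) \<bullet> fst v)^2
      + pot (fst u) * (fst v \<bullet> fst v))"

lemma smooth_eh_of:
  assumes L: "lift_on N A L"
  shows "smooth_on (N \<times> UNIV) (eh_of L)"
proof -
  have N: "open N" "N \<subseteq> U" "smooth_on N L" using L by (auto simp: lift_on_def)
  have o: "open (N \<times> (UNIV :: real set))" using N by (simp add: open_Times)
  have f: "smooth_on (N \<times> (UNIV :: real set)) fst" and s: "smooth_on (N \<times> (UNIV :: real set)) snd"
    using o by (auto intro: smooth_on_bounded_linear bounded_linear_fst bounded_linear_snd)
  have "smooth_on (N \<times> (UNIV :: real set)) (\<lambda>u. rr (fst u))"
    by (rule smooth_on_compose[OF smooth_rr f o open_U]) (use N in auto)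
  moreover have "smooth_on (N \<times> (UNIV :: real set)) (\<lambda>u. L (fst u))"
    by (rule smooth_on_compose[OF N(3) f o N(1)]) auto
  ultimately show ?thesis
    unfolding eh_of_def using s o by (intro smooth_on_Pair smooth_on_rot)
qed

text \<open>Rotating the lift by the fibre coordinate turns its connection form \<open>A\<close>
  into \<open>d\<psi> + A \<cdot> dx\<close>, the form in the ansatz; \<open>eh_line_lift\<close>
  does the rest.\<close>

lemma eh_of_metric:
  assumes L: "lift_on N A L" and u: "u \<in> N \<times> UNIV" and H': "(eh_of L has_derivative H') (at u)"
  shows "eh_metric a (eh_of L u) (H' v) = gh_metric A u v"
proof -
  let ?M = "N \<times> (UNIV :: real set)"
  have N: "open N" "N \<subseteq> U" "smooth_on N L" using L by (auto simp: lift_on_def)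
  have o: "open ?M" using N by (simp add: open_Times)
  have x: "fst u \<in> N" "fst u \<in> U" using u N by auto
  define DL where "DL = fderiv L ((fst u))"
  have l: "hopf_lift (fst (L y)) (snd (L y)) y" if "y \<in> N" for y using L that by (simp add: lift_on_def)
  have DL: "((\<lambda>u. L (fst u)) has_derivative (\<lambda>v. DL (fst v))) (at u)"
    using has_derivative_compose[OF has_derivative_fst[OF has_derivative_ident] smooth_on_has_derivative[OF N(3) x(1)]]
    by (simp add: DL_def)
  have Dr: "((\<lambda>u. rr (fst u)) has_derivative (\<lambda>v. fst (H' v))) (at u)"
    using has_derivative_fst[OF H'] by (simp add: eh_of_def)
  have Dz: "((\<lambda>u. fst (rot (snd u) (L (fst u)))) has_derivative (\<lambda>v. fst (snd (H' v)))) (at u)"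
    using has_derivative_fst[OF has_derivative_snd[OF H']] by (simp add: eh_of_def)
  have Dw: "((\<lambda>u. snd (rot (snd u) (L (fst u)))) has_derivative (\<lambda>v. snd (snd (H' v)))) (at u)"
    using has_derivative_snd[OF has_derivative_snd[OF H']] by (simp add: eh_of_def)
  have "((\<lambda>u. rot (snd u) (L (fst u))) has_derivative (\<lambda>v. snd (H' v))) (at u)"
    using has_derivative_snd[OF H'] by (simp add: eh_of_def)
  from has_derivative_unique[OF this rot_has_derivative[OF has_derivative_snd[OF has_derivative_ident] DL]]
  have H: "snd (H' v) = (cis (snd u / 4) * (fst (DL (fst v)) + \<i> * of_real (snd v / 4) * fst (L (fst u))),
      cis (- (snd u / 4)) * (snd (DL (fst v)) - \<i> * of_real (snd v / 4) * snd (L (fst u))))"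
    by (rule fun_cong)
  have conn: "eh_conn (f (fst u)) (fst (rot (snd u) (L (fst u)))) (snd (rot (snd u) (L (fst u))))
      (fst (snd (H' v))) (snd (snd (H' v))) = snd v + A (fst u) \<bullet> fst v"
    unfolding H fst_conv snd_conv eh_conn_rot[OF hopf_lift_norm[OF l[OF x(1)]] f_pos[OF x(2)]]
    using L x(1) by (simp add: lift_on_def DL_def)
  have lift: "hopf_lift (fst (rot (snd y) (L (fst y)))) (snd (rot (snd y) (L (fst y)))) (fst y)" if "y \<in> ?M" for y
    using l that by (auto simp: hopf_lift_rot)
  have "eh_line a (rr (fst u)) (fst (rot (snd u) (L (fst u)))) (snd (rot (snd u) (L (fst u))))
      (fst (H' v)) (fst (snd (H' v))) (snd (snd (H' v))) = gh_metric A u v"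
    unfolding gh_metric_def conn[symmetric]
    by (rule eh_line_lift[OF o u x(2) lift has_derivative_fst[OF has_derivative_ident] Dz Dw Dr])
  then show ?thesis by (simp add: eh_metric_def eh_of_def)
qed

definition gh_patch :: "'m gauge \<Rightarrow> ((real^3) \<times> real, 'm) patch" where
  "gh_patch = (\<lambda>(W, s, A). \<lparr>cdom = (W \<inter> U) \<times> UNIV, par = (\<lambda>(x, \<psi>). act B \<psi> (s x)), ds2 = gh_metric A\<rparr>)"

definition eh_patch :: "complex \<times> complex \<Rightarrow> (eh_coords, real \<times> (complex \<times> complex) set) patch" where
  "eh_patch g = \<lparr>cdom = eh_dom a,
     par = (\<lambda>u. (fst (eh_map g u), {snd (eh_map g u), - snd (eh_map g u)})), ds2 = eh_ds2 a\<rparr>"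

abbreviation "GH \<equiv> gh_patch ` gauges B"

lemma gh_patches:
  "rescale (a^2 / (8 * c)) (restrict_to {m. proj B m \<notin> closed_segment x1 x2}
    (gibbons_hawking 0 [(x1, 1), (x2, 1)] B)) = GH"
proof -
  have "proj B (act B \<psi> (s x)) = x" if "(W, s, A) \<in> gauges B" "x \<in> W" for W s A x \<psi>
    using gauge_total[OF that] gauge_proj[OF that] by (simp add: act_proj)
  then show ?thesis
    unfolding rescale_def restrict_to_def gibbons_hawking_def image_image
    by (intro image_cong refl) (auto simp: gh_patch_def gh_metric_def fun_eq_iff U_def)
qed

lemma eh_patches: "eguchi_hanson a = eh_patch ` sphere 0 1"
  unfolding eguchi_hanson_def eh_patch_def eh_dom_def eh_map_def
  by (intro image_cong refl) (simp add: Let_def fun_eq_iff)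

lemma points_gh: "points (GH) = {m \<in> total B. proj B m \<in> U}"
proof (intro equalityI subsetI)
  fix m assume "m \<in> points (GH)"
  then obtain W s A x \<psi> where W: "(W, s, A) \<in> gauges B" "x \<in> W" and x: "x \<in> U" "m = act B \<psi> (s x)"
    unfolding points_def gh_patch_def by auto
  then show "m \<in> {m \<in> total B. proj B m \<in> U}"
    using gauge_total[OF W] gauge_proj[OF W] by (simp add: act_total act_proj)
next
  fix m assume "m \<in> {m \<in> total B. proj B m \<in> U}"
  then have m: "m \<in> total B" "proj B m \<in> U" by auto
  obtain W s A where W: "(W, s, A) \<in> gauges B" "proj B m \<in> W" using gauge_cover[OF m(2)] by blast
  obtain \<psi> where \<psi>: "m = act B \<psi> (s (proj B m))"
    using act_transitive[OF gauge_total[OF W] m(1)] gauge_proj[OF W] by auto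
  have "m \<in> par (gh_patch (W, s, A)) ` cdom (gh_patch (W, s, A))"
    unfolding gh_patch_def using \<psi> W(2) m(2) by (auto intro!: image_eqI[of _ _ "(proj B m, \<psi>)"])
  then show "m \<in> points (GH)" unfolding points_def using W(1) by blast
qed

lemma two_center_isometric: "isometric (GH) (eguchi_hanson a)"
proof -
  obtain \<sigma> where \<sigma>: "\<And>x. x \<in> U \<Longrightarrow> germ \<sigma> x" using global_section by blast
  \<comment> \<open>The fibre of a section over a point is a set of pairs, and \<open>F\<close>
    collects the partners of \<open>m\<close>. This needs no choice of gauge; \<open>F_eq\<close>
    identifies it with \<open>eh_of L\<close> in each gauge.\<close>
  define F where "F m = (rr (proj B m), {q. (m, q) \<in> \<sigma> (proj B m)})" for m
  have F_eq: "F (act B \<psi> (s y)) = (fst (eh_of L (y, \<psi>)), {snd (eh_of L (y, \<psi>)), - snd (eh_of L (y, \<psi>))})"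
    if l: "lifts_in_gauge W s A \<sigma> N L" "(W, s, A) \<in> gauges B" "y \<in> N" for W s A N L y \<psi>
  proof -
    note D = lifts_in_gaugeD[OF l]
    show ?thesis
      using orb_fibre[OF D(7,6), of \<psi>] by (simp add: F_def act_proj[OF D(7)] D(8,4) eh_of_def)
  qed
  have rep: "\<exists>W s A N L \<psi>. (W, s, A) \<in> gauges B \<and> lifts_in_gauge W s A \<sigma> N L \<and> proj B m \<in> N
      \<and> m = act B \<psi> (s (proj B m))" if m: "m \<in> total B" "proj B m \<in> U" for m
  proof -
    obtain W s A where W: "(W, s, A) \<in> gauges B" "proj B m \<in> W" using gauge_cover[OF m(2)] by blast
    obtain N L where N: "proj B m \<in> N" "lifts_in_gauge W s A \<sigma> N L"
      using germ_any_gauge[OF \<sigma>[OF m(2)] W] by blast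
    obtain \<psi> where "m = act B \<psi> (s (proj B m))"
      using act_transitive[OF gauge_total[OF W] m(1)] gauge_proj[OF W] by auto
    then show ?thesis using W(1) N by blast
  qed
  have inj: "inj_on F (points (GH))"
    unfolding points_gh
  proof (rule inj_onI)
    fix m m' assume "m \<in> {m \<in> total B. proj B m \<in> U}" "m' \<in> {m \<in> total B. proj B m \<in> U}" and eq: "F m = F m'"
    then have m: "m \<in> total B" "proj B m \<in> U" and m': "m' \<in> total B" "proj B m' \<in> U" by auto
    obtain W s A N L \<psi> where l: "lifts_in_gauge W s A \<sigma> N L" "(W, s, A) \<in> gauges B" "proj B m \<in> N"
      and m_eq: "m = act B \<psi> (s (proj B m))" using rep[OF m] by blast
    obtain W' s' A' N' L' \<psi>' where l': "lifts_in_gauge W' s' A' \<sigma> N' L'" "(W', s', A') \<in> gauges B" "proj B m' \<in> N'"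
      and m'_eq: "m' = act B \<psi>' (s' (proj B m'))" using rep[OF m'] by blast
    let ?x = "proj B m" and ?x' = "proj B m'"
    note D = lifts_in_gaugeD[OF l] and D' = lifts_in_gaugeD[OF l']
    have Fm: "F m = (rr ?x, {rot \<psi> (L ?x), - rot \<psi> (L ?x)})"
      using F_eq[OF l, of \<psi>] m_eq by (simp add: eh_of_def)
    have Fm': "F m' = (rr ?x', {rot \<psi>' (L' ?x'), - rot \<psi>' (L' ?x')})"
      using F_eq[OF l', of \<psi>'] m'_eq by (simp add: eh_of_def)
    have r: "rr ?x = rr ?x'" and q: "rot \<psi>' (L' ?x') = rot \<psi> (L ?x) \<or> rot \<psi>' (L' ?x') = rot (4 * pi + \<psi>) (L ?x)"
      using eq unfolding Fm Fm' by (auto simp: doubleton_eq_iff rot_4pi simp flip: rot_rot)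
    \<comment> \<open>The base point can be recovered from the image, so equal images come from the
      same fibre; there the freeness of both actions finishes the proof.\<close>
    have "base (rr ?x', rot \<psi>' (L' ?x')) = ?x'" by (rule base_unique[OF D'(2)]) (simp add: hopf_lift_rot D'(5))
    moreover have "base (rr ?x, rot t (L ?x)) = ?x" for t by (rule base_unique[OF D(2)]) (simp add: hopf_lift_rot D(5))
    ultimately have x: "?x' = ?x" using q r by metis
    \<comment> \<open>Both points are now written in the gauge of \<open>m\<close>, where they can
      be compared by their angles.\<close>
    obtain \<omega> where \<omega>: "m' = act B \<omega> (s ?x)" using act_transitive[OF D(7) m'(1)] D(8) x by auto
    have "F m' = (rr ?x, {rot \<omega> (L ?x), - rot \<omega> (L ?x)})"
      using F_eq[OF l, of \<omega>] \<omega> by (simp add: eh_of_def)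
    with Fm eq have "{rot \<psi> (L ?x), - rot \<psi> (L ?x)} = {rot \<omega> (L ?x), - rot \<omega> (L ?x)}" by simp
    then have "rot \<omega> (L ?x) = rot \<psi> (L ?x) \<or> rot \<omega> (L ?x) = - rot \<psi> (L ?x)" by (auto simp: doubleton_eq_iff)
    moreover have "rot \<omega> (L ?x) = rot (\<omega> - \<psi>) (rot \<psi> (L ?x))" by (simp add: rot_rot)
    moreover have "rot \<psi> (L ?x) \<noteq> 0" using D(6) norm_rot[of \<psi> "L ?x"] by auto
    ultimately have "\<exists>k::int. \<omega> - \<psi> = 4 * pi * of_int k" using rot_eq_iff by metis
    then have "act B \<omega> (s ?x) = act B \<psi> (s ?x)" using act_eq_iff[OF D(7)] by blast
    then show "m = m'" using \<omega> m_eq by metis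
  qed
  have onto: "\<exists>W s A N L x \<psi>. (W, s, A) \<in> gauges B \<and> lifts_in_gauge W s A \<sigma> N L \<and> x \<in> N \<and> base (r, q) = x
      \<and> rr x = r \<and> rot \<psi> (L x) = q" if r: "a < r" and q: "q \<in> sphere 0 1" for r q
  proof -
    let ?x = "base (r, q)"
    note b = base[OF r q]
    obtain W s A where W: "(W, s, A) \<in> gauges B" "?x \<in> W" using gauge_cover[OF b(1)] by blast
    obtain N L where N: "?x \<in> N" and l: "lifts_in_gauge W s A \<sigma> N L"
      using germ_any_gauge[OF \<sigma>[OF b(1)] W] by blast
    note D = lifts_in_gaugeD[OF l W(1) N]
    obtain t where "q = rot t (L ?x)" using hopf_lift_transitive[OF D(2,5) b(3)] by blast
    then show ?thesis using W N l b(2) by metis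
  qed
  have bij: "bij_betw F (points (GH)) (points (eguchi_hanson a))"
    unfolding bij_betw_def
  proof (intro conjI inj equalityI subsetI)
    fix y assume "y \<in> F ` points (GH)"
    then obtain m where m: "m \<in> total B" "proj B m \<in> U" and y: "y = F m" unfolding points_gh by auto
    obtain W s A N L \<psi> where l: "lifts_in_gauge W s A \<sigma> N L" "(W, s, A) \<in> gauges B" "proj B m \<in> N"
      and m_eq: "m = act B \<psi> (s (proj B m))" using rep[OF m] by blast
    have "y = (rr (proj B m), {rot \<psi> (L (proj B m)), - rot \<psi> (L (proj B m))})"
      using F_eq[OF l, of \<psi>] m_eq y by (simp add: eh_of_def)
    moreover have "rot \<psi> (L (proj B m)) \<in> sphere 0 1"
      using hopf_lift_sphere[OF lifts_in_gaugeD(5)[OF l]] by (simp add: norm_rot)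
    ultimately show "y \<in> points (eguchi_hanson a)"
      unfolding points_eguchi_hanson using rr_gt[OF m(2)] by blast
  next
    fix y assume "y \<in> points (eguchi_hanson a)"
    then obtain r q where r: "a < r" and q: "q \<in> sphere 0 1" and y: "y = (r, {q, - q})"
      unfolding points_eguchi_hanson by blast
    obtain W s A N L x \<psi> where l: "lifts_in_gauge W s A \<sigma> N L" "(W, s, A) \<in> gauges B" "x \<in> N"
      and x: "rr x = r" "rot \<psi> (L x) = q" using onto[OF r q] by blast
    note D = lifts_in_gaugeD[OF l]
    have "F (act B \<psi> (s x)) = y" using F_eq[OF l, of \<psi>] x y by (simp add: eh_of_def)
    moreover have "act B \<psi> (s x) \<in> points (GH)"
      unfolding points_gh using D by (simp add: act_total act_proj)
    ultimately show "y \<in> F ` points (GH)" by blast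
  qed
  have forward: "metric_preserving (GH) (eguchi_hanson a) F"
    unfolding metric_preserving_def
  proof (intro ballI)
    fix P u0 assume "P \<in> GH" and u0: "u0 \<in> cdom P"
    then obtain W s A where W: "(W, s, A) \<in> gauges B" and P: "P = gh_patch (W, s, A)" by auto
    have x0: "fst u0 \<in> W" "fst u0 \<in> U" using u0 by (auto simp: P gh_patch_def)
    obtain N L where N: "fst u0 \<in> N" and l: "lifts_in_gauge W s A \<sigma> N L"
      using germ_any_gauge[OF \<sigma>[OF x0(2)] W x0(1)] by blast
    have L: "lift_on N A L" and NW: "N \<subseteq> W \<inter> U" using l unfolding lifts_in_gauge_def lift_on_def by auto
    note D = lifts_in_gaugeD[OF l W]
    let ?M = "N \<times> (UNIV :: real set)"
    have oM: "open ?M" using D(3)[OF N] by (simp add: open_Times)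
    have sH: "smooth_on ?M (eh_of L)" by (rule smooth_eh_of[OF L])
    have sph: "a < fst (eh_of L y)" "snd (eh_of L y) \<in> sphere 0 1" if "y \<in> ?M" for y
      using that rr_gt[OF D(2)] hopf_lift_sphere[OF D(5)] by (auto simp: eh_of_def norm_rot)
    have u0M: "u0 \<in> ?M" using N by (cases u0) auto
    obtain g Ob E where g: "g \<in> sphere 0 1" and Ob: "open Ob" "eh_of L u0 \<in> Ob" "smooth_on Ob E"
      and E: "\<And>r q. (r, q) \<in> Ob \<Longrightarrow> a < r \<Longrightarrow> q \<in> sphere 0 1 \<Longrightarrow> E (r, q) \<in> eh_dom a \<and> eh_map g (E (r, q)) = (r, q)"
      using eh_chart[OF sph[OF u0M]] by (metis prod.collapse)
    let ?N = "?M \<inter> eh_of L -` Ob" and ?h = "\<lambda>y. E (eh_of L y)"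
    have oN: "open ?N" by (rule continuous_open_preimage[OF smooth_on_continuous[OF sH] oM Ob(1)])
    have sHN: "smooth_on ?N (eh_of L)" by (rule smooth_on_subset[OF sH]) auto
    have sh: "smooth_on ?N ?h" by (rule smooth_on_compose[OF Ob(3) sHN oN Ob(1)]) auto
    have Eh: "?h y \<in> eh_dom a" "eh_map g (?h y) = eh_of L y" if "y \<in> ?N" for y
      using E[of "fst (eh_of L y)" "snd (eh_of L y)"] sph[of y] that by auto
    have ds: "eh_ds2 a (?h y) (fderiv ?h y v) = gh_metric A y v" if y: "y \<in> ?N" for y v
    proof -
      let ?h' = "fderiv ?h y" and ?Q' = "fderiv (eh_map g) ((?h y))"
      have Dh: "(?h has_derivative ?h') (at y)" by (rule smooth_on_has_derivative[OF sh y])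
      have DQ: "(eh_map g has_derivative ?Q') (at (?h y))"
        by (rule smooth_on_has_derivative[OF smooth_eh_map UNIV_I])
      \<comment> \<open>The chart \<open>E\<close> is used only through the fact that the
        parametrisation after \<open>?h\<close> is \<open>eh_of L\<close>; differentiating this
        identity avoids computing the derivative of \<open>E\<close>.\<close>
      have "(eh_of L has_derivative (\<lambda>v. ?Q' (?h' v))) (at y)"
        by (rule has_derivative_transform_within_open[OF has_derivative_compose[OF Dh DQ] oN y]) (rule Eh)
      then have "eh_metric a (eh_of L y) (?Q' (?h' v)) = gh_metric A y v"
        using y by (intro eh_of_metric[OF L]) auto
      then show ?thesis unfolding eh_ds2_eq_eh_metric[OF g DQ] Eh(2)[OF y] .
    qed
    show "\<exists>Q\<in>eguchi_hanson a. \<exists>N h. open N \<and> u0 \<in> N \<and> N \<subseteq> cdom P \<and> smooth_on N h \<and> h ` N \<subseteq> cdom Q \<and>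
        (\<forall>y\<in>N. F (par P y) = par Q (h y) \<and> (\<forall>v. ds2 Q (h y) (fderiv h y v) = ds2 P y v))"
    proof (intro bexI[of _ "eh_patch g"] exI[of _ ?N] exI[of _ ?h] conjI ballI allI)
      show "eh_patch g \<in> eguchi_hanson a" unfolding eh_patches using g by blast
      show "?N \<subseteq> cdom P" using NW by (auto simp: P gh_patch_def)
      have "cdom (eh_patch g) = eh_dom a" by (simp add: eh_patch_def)
      then show "?h ` ?N \<subseteq> cdom (eh_patch g)" using image_subsetI[of ?N, OF Eh(1)] by simp
      fix y assume y: "y \<in> ?N"
      have "par P y = act B (snd y) (s (fst y))" by (simp add: P gh_patch_def case_prod_beta)
      then show "F (par P y) = par (eh_patch g) (?h y)"
        using F_eq[OF l W, of "fst y" "snd y"] y Eh(2)[OF y] by (auto simp: eh_patch_def)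
      show "ds2 (eh_patch g) (?h y) (fderiv ?h y v) = ds2 P y v" for v
        using ds[OF y] by (simp add: eh_patch_def P gh_patch_def)
    qed (use oN u0M Ob(2) sh in auto)
  qed
  have backward: "metric_preserving (eguchi_hanson a) (GH)
      (inv_into (points (GH)) F)"
    unfolding metric_preserving_def
  proof (intro ballI)
    fix Q u0 assume "Q \<in> eguchi_hanson a" and u0Q: "u0 \<in> cdom Q"
    then obtain g where g: "g \<in> sphere 0 1" and Q: "Q = eh_patch g" unfolding eh_patches by auto
    have u0: "u0 \<in> eh_dom a" using u0Q by (simp add: Q eh_patch_def)
    let ?K = "eh_map g" and ?D = "eh_dom a"
    have K: "a < fst (?K u)" "snd (?K u) \<in> sphere 0 1" if "u \<in> ?D" for u
      using that eh_map_sphere[OF g, of u] by (auto simp: eh_dom_def eh_map_def simp del: mem_sphere mem_sphere_0)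
    define X where "X u = base (?K u)" for u
    have sK: "smooth_on ?D ?K" by (rule smooth_on_subset[OF smooth_eh_map]) auto
    have oB: "open ({a<..} \<times> (UNIV :: (complex \<times> complex) set))" by (simp add: open_Times)
    have sX: "smooth_on ?D X"
      unfolding X_def
    proof (rule smooth_on_compose[OF smooth_base sK open_eh_dom oB])
      show "?K ` ?D \<subseteq> {a<..} \<times> UNIV"
        by (rule image_subsetI) (simp add: mem_Times_iff K(1))
    qed
    have X: "X u \<in> U" "rr (X u) = fst (?K u)" "hopf_lift (fst (snd (?K u))) (snd (snd (?K u))) (X u)"
      if "u \<in> ?D" for u
      using base[OF K[OF that]] by (auto simp: X_def)
    obtain W s A N L \<psi>0 where l: "lifts_in_gauge W s A \<sigma> N L" and W: "(W, s, A) \<in> gauges B" and x0: "X u0 \<in> N"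
      and \<psi>0: "rot \<psi>0 (L (X u0)) = snd (?K u0)" using onto[OF K[OF u0]] unfolding X_def by force
    have L: "lift_on N A L" and NW: "N \<subseteq> W \<inter> U" using l unfolding lifts_in_gauge_def lift_on_def by auto
    note D = lifts_in_gaugeD[OF l W]
    have oN: "open N" by (rule D(3)[OF x0])
    let ?M = "?D \<inter> X -` N"
    have oM: "open ?M" by (rule continuous_open_preimage[OF smooth_on_continuous[OF sX] open_eh_dom oN])
    have sXM: "smooth_on ?M X" by (rule smooth_on_subset[OF sX]) auto
    have sLX: "smooth_on ?M (\<lambda>u. L (X u))"
      by (rule smooth_on_compose[OF _ sXM oM oN]) (use L in \<open>auto simp: lift_on_def\<close>)
    have sKM: "smooth_on ?M ?K" by (rule smooth_on_subset[OF smooth_eh_map]) auto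
    \<comment> \<open>The rotation taking the lift over the projected point to the given point of
      the sphere, by \<open>hopf_lift_unit\<close>; its phase is a quarter of the missing fibre
      coordinate.\<close>
    define \<zeta> where "\<zeta> u = fst (snd (?K u)) * cnj (fst (L (X u))) + cnj (snd (snd (?K u))) * snd (L (X u))" for u
    have s\<zeta>: "smooth_on ?M \<zeta>"
      unfolding \<zeta>_def
      by (intro smooth_intros sLX sKM oM)
    have \<zeta>: "fst (snd (?K u)) = \<zeta> u * fst (L (X u))" "snd (snd (?K u)) = cnj (\<zeta> u) * snd (L (X u))" "cmod (\<zeta> u) = 1"
      if "u \<in> ?M" for u
      using hopf_lift_unit[OF X(1) D(5) X(3), of u] that unfolding \<zeta>_def by auto
    let ?N = "?M \<inter> (\<lambda>u. \<zeta> u * cis (- (\<psi>0 / 4))) -` {w. 0 < Re w}"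
    have oNN: "open ?N"
      by (intro continuous_open_preimage continuous_intros smooth_on_continuous[OF s\<zeta>] oM open_halfspace_Re_gt)
    have u0N: "u0 \<in> ?N"
    proof -
      have u0M: "u0 \<in> ?M" using u0 x0 by auto
      have n: "(cmod (fst (L (X u0))))^2 + (cmod (snd (L (X u0))))^2 = 1" by (rule hopf_lift_norm[OF D(5)[OF x0]])
      then have "fst (L (X u0)) * cnj (fst (L (X u0))) + cnj (snd (L (X u0))) * snd (L (X u0)) = 1"
        by (metis complex_norm_square mult.commute of_real_1 of_real_add)
      moreover have "\<zeta> u0 = cis (\<psi>0 / 4) * (fst (L (X u0)) * cnj (fst (L (X u0))) + cnj (snd (L (X u0))) * snd (L (X u0)))"
        unfolding \<zeta>_def \<psi>0[symmetric] rot_def by (simp add: cis_cnj algebra_simps)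
      ultimately have "\<zeta> u0 = cis (\<psi>0 / 4)" by simp
      then show ?thesis using u0M by (simp add: cis_mult)
    qed
    \<comment> \<open>At \<open>u0\<close> the rotation is \<open>cis (\<psi>0 / 4)\<close>, so the
      branch of the argument centred at \<open>\<psi>0 / 4\<close> is smooth nearby; the factor 4
      undoes the quarter angle of \<open>rot\<close>.\<close>
    define \<Psi> where "\<Psi> u = 4 * local_arg (\<psi>0 / 4) (\<zeta> u)" for u
    define h where "h u = (X u, \<Psi> u)" for u
    have s\<Psi>: "smooth_on ?N \<Psi>"
      unfolding \<Psi>_def
      by (intro smooth_intros smooth_on_local_arg smooth_on_subset[OF s\<zeta>] oNN) auto
    have sh: "smooth_on ?N h"
      unfolding h_def by (intro smooth_on_Pair smooth_on_subset[OF sXM] s\<Psi> oNN) auto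
    have Hh: "eh_of L (h u) = ?K u" if u: "u \<in> ?N" for u
    proof -
      have uM: "u \<in> ?M" and uD: "u \<in> ?D" using u by auto
      have "cis (\<Psi> u / 4) = \<zeta> u"
        using local_arg_cis[of "\<zeta> u" "\<psi>0 / 4"] u \<zeta>(3)[OF uM] by (simp add: \<Psi>_def)
      then have "rot (\<Psi> u) (L (X u)) = snd (?K u)"
        using \<zeta>(1,2)[OF uM] by (simp add: rot_def prod_eq_iff flip: cis_cnj)
      then show ?thesis using X(2)[OF uD] by (simp add: eh_of_def h_def prod_eq_iff)
    qed
    have hM: "h u \<in> N \<times> UNIV" if "u \<in> ?N" for u using that by (auto simp: h_def)
    have ds: "gh_metric A (h u) (fderiv h u v) = eh_ds2 a u v" if u: "u \<in> ?N" for u v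
    proof -
      let ?h' = "fderiv h u" and ?H' = "fderiv (eh_of L) ((h u))"
      have Dh: "(h has_derivative ?h') (at u)" by (rule smooth_on_has_derivative[OF sh u])
      have DH: "(eh_of L has_derivative ?H') (at (h u))"
        by (rule smooth_on_has_derivative[OF smooth_eh_of[OF L] hM[OF u]])
      have "(?K has_derivative (\<lambda>v. ?H' (?h' v))) (at u)"
        by (rule has_derivative_transform_within_open[OF has_derivative_compose[OF Dh DH] oNN u]) (rule Hh)
      from eh_ds2_eq_eh_metric[OF g this] have "eh_ds2 a u v = eh_metric a (eh_of L (h u)) (?H' (?h' v))"
        by (simp only: Hh[OF u])
      also have "\<dots> = gh_metric A (h u) (?h' v)" by (rule eh_of_metric[OF L hM[OF u] DH])
      finally show ?thesis ..
    qed
    let ?P = "gh_patch (W, s, A)"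
    show "\<exists>P\<in>GH. \<exists>N h. open N \<and> u0 \<in> N \<and> N \<subseteq> cdom Q \<and> smooth_on N h \<and> h ` N \<subseteq> cdom P \<and>
        (\<forall>y\<in>N. inv_into (points (GH)) F (par Q y) = par P (h y) \<and>
          (\<forall>v. ds2 P (h y) (fderiv h y v) = ds2 Q y v))"
    proof (intro bexI[of _ ?P] exI[of _ ?N] exI[of _ h] conjI ballI allI)
      show "?P \<in> GH" using W by blast
      show "?N \<subseteq> cdom Q" by (auto simp: Q eh_patch_def)
      show hP: "h ` ?N \<subseteq> cdom ?P" using hM NW by (fastforce simp: gh_patch_def)
      fix y assume y: "y \<in> ?N"
      have parP: "par ?P (h y) = act B (\<Psi> y) (s (X y))" by (simp add: gh_patch_def h_def)
      have "X y \<in> N" using y by auto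
      then have "F (par ?P (h y)) = par Q y"
        using F_eq[OF l W, of "X y" "\<Psi> y"] Hh[OF y] unfolding parP by (simp add: Q eh_patch_def h_def)
      moreover have "par ?P (h y) \<in> points (GH)"
        unfolding points_def using hP y W by blast
      ultimately show "inv_into (points (GH)) F (par Q y) = par ?P (h y)"
        \<comment> \<open>Injectivity of \<open>F\<close> identifies the inverse image, so the
          coordinate expression found for a preimage is one for the inverse map.\<close>
        using inv_into_f_eq[OF inj] by blast
      show "ds2 ?P (h y) (fderiv h y v) = ds2 Q y v" for v
        using ds[OF y] by (simp add: gh_patch_def Q eh_patch_def)
    qed (use oNN u0N sh in auto)
  qed
  show ?thesis
    unfolding isometric_def isometry_def using bij forward backward by blast
qed

end

section \<open>Choice of an adapted frame and conclusion\<close>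

lemma two_centers_exist:
  fixes x1 x2 :: "real^3" and a :: real
  assumes "x1 \<noteq> x2" "0 < a"
  obtains e1 e2 e c where "two_centers x1 x2 e1 e2 e c a"
proof -
  define c where "c = norm (x1 - x2) / 2"
  define e where "e = (1 / (2 * c)) *\<^sub>R (x1 - x2)"
  have c: "0 < c" using assms by (simp add: c_def)
  have ne: "norm e = 1" using c by (simp add: e_def) (simp add: c_def)
  have "2 \<le> DIM(real^3)" by simp
  then obtain y where y: "y \<noteq> 0" "orthogonal e y" using orthogonal_to_vector_exists by blast
  define e1 where "e1 = (1 / norm y) *\<^sub>R y"
  define e2 where "e2 = cross3 e e1"
  have n1: "norm e1 = 1" using y by (simp add: e1_def)
  have o1: "e \<bullet> e1 = 0" using y by (simp add: e1_def orthogonal_def)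
  have "(norm e2)^2 = 1" unfolding e2_def norm_cross using ne n1 o1 by simp
  then have ip: "e1 \<bullet> e1 = 1" "e2 \<bullet> e2 = 1" "e \<bullet> e = 1"
    using ne n1 by (simp_all flip: power2_norm_eq_inner)
  have "cross3 e1 e2 = e" unfolding e2_def Lagrange using ip o1 by (simp add: inner_commute)
  then have "two_centers x1 x2 e1 e2 e c a"
    using c assms ip o1 by unfold_locales (auto simp: e_def[symmetric] e2_def dot_cross_self inner_commute, simp add: e_def)
  then show ?thesis by (rule that)
qed

theorem theorem3p10:
  fixes x1 x2 :: "real^3" and a :: real and B :: "'m circle_bundle"
  assumes "x1 \<noteq> x2" and "0 < a" and "gh_bundle 0 [(x1, 1), (x2, 1)] B"
  shows "\<exists>c>0. isometric
    (rescale c (restrict_to {m. proj B m \<notin> closed_segment x1 x2}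
      (gibbons_hawking 0 [(x1, 1), (x2, 1)] B)))
    (eguchi_hanson a)"
proof -
  obtain e1 e2 e c where "two_centers x1 x2 e1 e2 e c a"
    using two_centers_exist[OF assms(1,2)] by blast
  then interpret two_center_bundle x1 x2 e1 e2 e c a B
    using assms(3) by (simp add: two_center_bundle_def two_center_bundle_axioms_def)
  show ?thesis
    using two_center_isometric gh_patches a c by (intro exI[of _ "a^2 / (8 * c)"]) simp
qed

end
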